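(* Let $N$ be a positive integer and let $A,B$ be $N\times N$ integer matrices such that all entries of $A$ are non-negative, $A$ has no zero row, and $B_{i,j}=0$ whenever $A_{i,j}=0$. Assume that the Katsura--Exel--Pardo groupoid $\mathcal{G}_{A,B}$ is Hausdorff, effective and minimal, and that $A$ is irreducible. Assume moreover that $|B_{i,j}|<A_{i,j}$ whenever $A_{i,j}\neq0$. Then the topological full group $[[\mathcal{G}_{A,B}]]$ is finitely generated.
   Context: Katsura--Exel--Pardo groupoid. $E_A$ is the directed graph with vertex set $E_A^0=\{1,\dots,N\}$ and edge set $E_A^1=\{e_{i,j,n} : 1\le i,j\le N,\ 0\le n<A_{i,j}\}$, where $s(e_{i,j,n})=i$ and $r(e_{i,j,n})=j$. Paths are sequences $e_1e_2\cdots$ of edges with $r(e_k)=s(e_{k+1})$; $E_A^*$ is the set of finite paths (vertices being paths of length $0$), $E_A^n$ the set of paths of length $n$, $|\mu|$ the length of $\mu$, and $E_A^\infty$ the space of infinite paths, with topology generated by the cylinder sets $Z(\mu)=\{\mu y : y\in E_A^\infty,\ s(y)=r(\mu)\}$, $\mu \in E_A^*$. For $m\in\mathbb{Z}$ and $e=e_{i,j,n}\in E_A^1$ let $q,r$ be the unique integers with $mB_{i,j}+n=qA_{i,j}+r$ and $0\le r<A_{i,j}$, and set $\kappa_m(e)=e_{i,j,r}$, $\varphi(m,e)=q$. For a vertex $v$ put $\kappa_m(v)=v$, $\varphi(m,v)=m$. Extend to finite paths by $\kappa_m(\mu e)=\kappa_m(\mu)\kappa_{\varphi(m,\mu)}(e)$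 and $\varphi(m,\mu e)=\varphi(\varphi(m,\mu),e)$, and (by continuing indefinitely) let $\kappa_m$ act on $E_A^\infty$. Consider quadruples $(\mu,m,\nu;x)$ with $\mu,\nu\in E_A^*$, $r(\mu)=r(\nu)$, $m\in\mathbb{Z}$, $x\in Z(\nu)$, and the equivalence relation generated by $(\mu,m,\nu;\nu e z)\sim(\mu\kappa_m(e),\varphi(m,e),\nu e;\nu e z)$ ($e\in E_A^1$, $z \in E_A^\infty$). $\mathcal{G}_{A,B}$ is the set of equivalence classes $[\mu,m,\nu;x]$, with $s([\mu,m,\nu;\nu y])=\nu y$, $r([\mu,m,\nu;\nu y])=\mu\kappa_m(y)$ (unit space identified with $E_A^\infty$ via $x\leftrightarrow[s(x),0,s(x);x]$), product determined by $[\lambda,n,\mu;\mu\kappa_m(y)]\cdot[\mu,m,\nu;\nu y]=[\lambda,n+m,\nu;\nu y]$ (every composable pair has representatives of this form), and inverse $[\mu,m,\nu;\nu y]^{-1}=[\nu,-m,\mu;\mu\kappa_m(y)]$. Its topology has basis $Z(\mu,m,\nu)=\{[\mu,m,\nu;x] : x\in Z(\nu)\}$; these are compact open bisections, and $\mathcal{G}_{A,B}$ is an ample groupoid with compact unit space. $A$ is irreducible if $E_A$ is strongly connected. A groupoid is effective if the interior of its isotropy is its unit space, and minimal if every orbit is dense in the unit space. Topological full group. For an effective Hausdorff ample groupoid $\mathcal{G}$ with compact unit space, a bisection is an open subset on which $r$ and $s$ are injective; a bisection $U$ is full if $s(U)=r(U)=\mathcal{G}^{(0)}$, and then $\pi_U=r|_U\circ(s|_U)^{-1}$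 is a homeomorphism of $\mathcal{G}^{(0)}$. The topological full group is the group $[[\mathcal{G}]]=\{\pi_U : U \text{ a full bisection}\}$ under composition. *)

theory Defs
  imports
    "HOL-Analysis.T1_Spaces"
    "HOL-Algebra.Bij"
    "HOL-Algebra.Generated_Groups"
    "HOL-Library.Stream"
    "Graph_Theory.Digraph_Component"
begin

section \<open>Topological groupoids and topological full groups\<close>

text \<open>
  The unit space is a set of arrows, so \<open>src\<close> and \<open>rng\<close> are maps from arrows to arrows.
  The product is only meaningful on pairs \<open>(g, h)\<close> with \<open>src g = rng h\<close>.
\<close>

record 'g topological_groupoid =
  arrows :: "'g set"
  units :: "'g set"
  src :: "'g \<Rightarrow> 'g"
  rng :: "'g \<Rightarrow> 'g"
  gprod :: "'g \<Rightarrow> 'g \<Rightarrow> 'g"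
  ginv :: "'g \<Rightarrow> 'g"
  gtop :: "'g topology"

definition hausdorff_groupoid :: "'g topological_groupoid \<Rightarrow> bool" where
  "hausdorff_groupoid G \<longleftrightarrow> Hausdorff_space (gtop G)"

definition isotropy :: "'g topological_groupoid \<Rightarrow> 'g set" where
  "isotropy G = {g \<in> arrows G. src G g = rng G g}"

definition effective_groupoid :: "'g topological_groupoid \<Rightarrow> bool" where
  "effective_groupoid G \<longleftrightarrow> gtop G interior_of (isotropy G) = units G"

definition orbit :: "'g topological_groupoid \<Rightarrow> 'g \<Rightarrow> 'g set" where
  "orbit G x = rng G ` {g \<in> arrows G. src G g = x}"

definition minimal_groupoid :: "'g topological_groupoid \<Rightarrow> bool" where
  "minimal_groupoid G \<longleftrightarrow>
     (\<forall>x \<in> units G. subtopology (gtop G) (units G) closure_of (orbit G x) = units G)"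

definition full_bisection :: "'g topological_groupoid \<Rightarrow> 'g set \<Rightarrow> bool" where
  "full_bisection G U \<longleftrightarrow>
     openin (gtop G) U \<and> inj_on (src G) U \<and> inj_on (rng G) U \<and>
     src G ` U = units G \<and> rng G ` U = units G"

definition bisection_map :: "'g topological_groupoid \<Rightarrow> 'g set \<Rightarrow> 'g \<Rightarrow> 'g" where
  "bisection_map G U = (\<lambda>x \<in> units G. rng G (the_inv_into U (src G) x))"

text \<open>The group law of \<^const>\<open>BijGroup\<close> is composition of maps.\<close>

definition topological_full_group :: "'g topological_groupoid \<Rightarrow> ('g \<Rightarrow> 'g) monoid" where
  "topological_full_group G =
     (BijGroup (units G))\<lparr>carrier := bisection_map G ` {U. full_bisection G U}\<rparr>"

lemma bisection_map_Bij:
  assumes "full_bisection G U"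
  shows "bisection_map G U \<in> Bij (units G)"
proof -
  have s: "bij_betw (src G) U (units G)" and r: "bij_betw (rng G) U (units G)"
    using assms by (auto simp: full_bisection_def bij_betw_def)
  have "bij_betw (rng G \<circ> the_inv_into U (src G)) (units G) (units G)"
    using bij_betw_trans[OF bij_betw_the_inv_into[OF s] r] .
  then have "bij_betw (bisection_map G U) (units G) (units G)"
    by (rule bij_betw_cong[THEN iffD1, rotated]) (simp add: bisection_map_def)
  then show ?thesis
    by (simp add: Bij_def bisection_map_def)
qed

definition finitely_generated_group :: "('a, 'b) monoid_scheme \<Rightarrow> bool" where
  "finitely_generated_group G \<longleftrightarrow>
     group G \<and> (\<exists>S. finite S \<and> S \<subseteq> carrier G \<and> generate G S = carrier G)"


section \<open>The graph of a matrix and the action of the integers on its paths\<close>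

text \<open>
  An \<open>N \<times> N\<close> integer matrix is a function on pairs of indices of which only the values on
  \<open>{1..N} \<times> {1..N}\<close> are used. The edge \<open>e\<^bsub>i,j,n\<^esub>\<close> is the triple \<open>(i, j, n)\<close>;
  the source of an edge is its \<^const>\<open>tail\<close>, its range is its \<^const>\<open>head\<close>.
\<close>

type_synonym int_matrix = "nat \<Rightarrow> nat \<Rightarrow> int"
type_synonym edge = "nat \<times> nat \<times> int"

definition matrix_graph :: "nat \<Rightarrow> int_matrix \<Rightarrow> (nat, edge) pre_digraph" where
  "matrix_graph N A =
     \<lparr>verts = {1..N},
      arcs = {(i, j, n) | i j n. i \<in> {1..N} \<and> j \<in> {1..N} \<and> 0 \<le> n \<and> n < A i j},
      tail = (\<lambda>(i, j, n). i),
      head = (\<lambda>(i, j, n). j)\<rparr>"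

text \<open>
  A finite path is a pair \<open>(u, p)\<close> of its source and its list of edges, so that the vertex \<open>u\<close>,
  as a path of length zero, is \<open>(u, [])\<close>. An infinite path is a stream of edges.
\<close>

type_synonym fpath = "nat \<times> edge list"

definition finite_paths :: "nat \<Rightarrow> int_matrix \<Rightarrow> fpath set" where
  "finite_paths N A = {(u, p). \<exists>v. pre_digraph.awalk (matrix_graph N A) u p v}"

definition path_range :: "nat \<Rightarrow> int_matrix \<Rightarrow> fpath \<Rightarrow> nat" where
  "path_range N A \<mu> = pre_digraph.awlast (matrix_graph N A) (fst \<mu>) (snd \<mu>)"

definition snoc :: "fpath \<Rightarrow> edge \<Rightarrow> fpath" where
  "snoc \<mu> e = (fst \<mu>, snd \<mu> @ [e])"

definition infinite_paths :: "nat \<Rightarrow> int_matrix \<Rightarrow> edge stream set" where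
  "infinite_paths N A =
     {x. \<forall>k. x !! k \<in> arcs (matrix_graph N A) \<and>
             head (matrix_graph N A) (x !! k) = tail (matrix_graph N A) (x !! Suc k)}"

definition ipath_source :: "nat \<Rightarrow> int_matrix \<Rightarrow> edge stream \<Rightarrow> nat" where
  "ipath_source N A x = tail (matrix_graph N A) (shd x)"

definition prepend :: "fpath \<Rightarrow> edge stream \<Rightarrow> edge stream" where
  "prepend \<mu> y = snd \<mu> @- y"

definition tails_of :: "nat \<Rightarrow> int_matrix \<Rightarrow> fpath \<Rightarrow> edge stream set" where
  "tails_of N A \<mu> = {y \<in> infinite_paths N A. ipath_source N A y = path_range N A \<mu>}"

definition cylinder :: "nat \<Rightarrow> int_matrix \<Rightarrow> fpath \<Rightarrow> edge stream set" where
  "cylinder N A \<mu> = prepend \<mu> ` tails_of N A \<mu>"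

text \<open>
  On an edge \<open>e\<^bsub>i,j,n\<^esub>\<close> one has \<open>A i j > 0\<close>, so \<open>div\<close> and \<open>mod\<close> give the unique \<open>q\<close> and \<open>r\<close>
  with \<open>m * B i j + n = q * A i j + r\<close> and \<open>0 \<le> r < A i j\<close>.
\<close>

definition kappa :: "int_matrix \<Rightarrow> int_matrix \<Rightarrow> int \<Rightarrow> edge \<Rightarrow> edge" where
  "kappa A B m = (\<lambda>(i, j, n). (i, j, (m * B i j + n) mod A i j))"

definition phi :: "int_matrix \<Rightarrow> int_matrix \<Rightarrow> int \<Rightarrow> edge \<Rightarrow> int" where
  "phi A B m = (\<lambda>(i, j, n). (m * B i j + n) div A i j)"

lemma kappa_phi_unique:
  assumes "(i, j, n) \<in> arcs (matrix_graph N A)"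
    and "m * B i j + n = q * A i j + r" "0 \<le> r" "r < A i j"
  shows "kappa A B m (i, j, n) = (i, j, r)" "phi A B m (i, j, n) = q"
  using assms by (auto simp: kappa_def phi_def)

text \<open>
  The recursion from the head below agrees with the defining one from the end of a path, see
  \<open>phi_path_snoc\<close> and \<open>kappa_path_snoc\<close>; \<open>stake_kappa_inf\<close> says that the action on an infinite
  path extends the action on its finite initial segments.
\<close>

definition phi_path :: "int_matrix \<Rightarrow> int_matrix \<Rightarrow> int \<Rightarrow> edge list \<Rightarrow> int" where
  "phi_path A B = foldl (phi A B)"

fun kappa_path :: "int_matrix \<Rightarrow> int_matrix \<Rightarrow> int \<Rightarrow> edge list \<Rightarrow> edge list" where
  "kappa_path A B m [] = []"
| "kappa_path A B m (e # p) = kappa A B m e # kappa_path A B (phi A B m e) p"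

primcorec kappa_inf ::
    "int_matrix \<Rightarrow> int_matrix \<Rightarrow> int \<Rightarrow> edge stream \<Rightarrow> edge stream" where
  "kappa_inf A B m x = kappa A B m (shd x) ## kappa_inf A B (phi A B m (shd x)) (stl x)"

lemma phi_path_snoc:
  "phi_path A B m (p @ [e]) = phi A B (phi_path A B m p) e"
  by (simp add: phi_path_def)

lemma kappa_path_snoc:
  "kappa_path A B m (p @ [e]) = kappa_path A B m p @ [kappa A B (phi_path A B m p) e]"
  by (induction p arbitrary: m) (simp_all add: phi_path_def)

lemma stake_kappa_inf:
  "stake k (kappa_inf A B m x) = kappa_path A B m (stake k x)"
  by (induction k arbitrary: m x) simp_all


section \<open>The Katsura--Exel--Pardo groupoid\<close>

type_synonym quadruple = "fpath \<times> int \<times> fpath \<times> edge stream"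

definition quadruples :: "nat \<Rightarrow> int_matrix \<Rightarrow> quadruple set" where
  "quadruples N A =
     {(\<mu>, m, \<nu>, x) | \<mu> m \<nu> x.
        \<mu> \<in> finite_paths N A \<and> \<nu> \<in> finite_paths N A \<and>
        path_range N A \<mu> = path_range N A \<nu> \<and> x \<in> cylinder N A \<nu>}"

definition kep_step :: "nat \<Rightarrow> int_matrix \<Rightarrow> int_matrix \<Rightarrow> (quadruple \<times> quadruple) set" where
  "kep_step N A B =
     {((\<mu>, m, \<nu>, prepend \<nu> (e ## z)),
       (snoc \<mu> (kappa A B m e), phi A B m e, snoc \<nu> e, prepend \<nu> (e ## z))) | \<mu> m \<nu> e z.
        (\<mu>, m, \<nu>, prepend \<nu> (e ## z)) \<in> quadruples N A \<and> e ## z \<in> tails_of N A \<nu>}"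

definition kep_equiv :: "nat \<Rightarrow> int_matrix \<Rightarrow> int_matrix \<Rightarrow> (quadruple \<times> quadruple) set" where
  "kep_equiv N A B = (kep_step N A B \<union> (kep_step N A B)\<inverse>)\<^sup>*"

definition kep_class :: "nat \<Rightarrow> int_matrix \<Rightarrow> int_matrix \<Rightarrow>
    fpath \<Rightarrow> int \<Rightarrow> fpath \<Rightarrow> edge stream \<Rightarrow> quadruple set" where
  "kep_class N A B \<mu> m \<nu> x = kep_equiv N A B `` {(\<mu>, m, \<nu>, x)}"

definition kep_arrows :: "nat \<Rightarrow> int_matrix \<Rightarrow> int_matrix \<Rightarrow> quadruple set set" where
  "kep_arrows N A B =
     {kep_class N A B \<mu> m \<nu> x | \<mu> m \<nu> x. (\<mu>, m, \<nu>, x) \<in> quadruples N A}"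

text \<open>
  The identification of an infinite path with a unit. Under it the cylinder set of a path \<open>\<mu>\<close>
  becomes the basic open set of \<open>(\<mu>, 0, \<mu>)\<close> in the topology below.
\<close>

definition kep_unit :: "nat \<Rightarrow> int_matrix \<Rightarrow> int_matrix \<Rightarrow> edge stream \<Rightarrow> quadruple set" where
  "kep_unit N A B x =
     kep_class N A B (ipath_source N A x, []) 0 (ipath_source N A x, []) x"

definition kep_src :: "nat \<Rightarrow> int_matrix \<Rightarrow> int_matrix \<Rightarrow> quadruple set \<Rightarrow> quadruple set" where
  "kep_src N A B g =
     (THE u. \<exists>\<mu> m \<nu> y. (\<mu>, m, \<nu>, prepend \<nu> y) \<in> quadruples N A \<and> y \<in> tails_of N A \<nu> \<and>
        g = kep_class N A B \<mu> m \<nu> (prepend \<nu> y) \<and>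
        u = kep_unit N A B (prepend \<nu> y))"

definition kep_rng :: "nat \<Rightarrow> int_matrix \<Rightarrow> int_matrix \<Rightarrow> quadruple set \<Rightarrow> quadruple set" where
  "kep_rng N A B g =
     (THE u. \<exists>\<mu> m \<nu> y. (\<mu>, m, \<nu>, prepend \<nu> y) \<in> quadruples N A \<and> y \<in> tails_of N A \<nu> \<and>
        g = kep_class N A B \<mu> m \<nu> (prepend \<nu> y) \<and>
        u = kep_unit N A B (prepend \<mu> (kappa_inf A B m y)))"

definition kep_prod ::
    "nat \<Rightarrow> int_matrix \<Rightarrow> int_matrix \<Rightarrow> quadruple set \<Rightarrow> quadruple set \<Rightarrow> quadruple set" where
  "kep_prod N A B g h =
     (THE k. \<exists>\<Lambda> n \<mu> m \<nu> y.
        (\<Lambda>, n, \<mu>, prepend \<mu> (kappa_inf A B m y)) \<in> quadruples N A \<and>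
        (\<mu>, m, \<nu>, prepend \<nu> y) \<in> quadruples N A \<and> y \<in> tails_of N A \<nu> \<and>
        g = kep_class N A B \<Lambda> n \<mu> (prepend \<mu> (kappa_inf A B m y)) \<and>
        h = kep_class N A B \<mu> m \<nu> (prepend \<nu> y) \<and>
        k = kep_class N A B \<Lambda> (n + m) \<nu> (prepend \<nu> y))"

definition kep_inv :: "nat \<Rightarrow> int_matrix \<Rightarrow> int_matrix \<Rightarrow> quadruple set \<Rightarrow> quadruple set" where
  "kep_inv N A B g =
     (THE k. \<exists>\<mu> m \<nu> y. (\<mu>, m, \<nu>, prepend \<nu> y) \<in> quadruples N A \<and> y \<in> tails_of N A \<nu> \<and>
        g = kep_class N A B \<mu> m \<nu> (prepend \<nu> y) \<and>
        k = kep_class N A B \<nu> (- m) \<mu> (prepend \<mu> (kappa_inf A B m y)))"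

definition kep_basic ::
    "nat \<Rightarrow> int_matrix \<Rightarrow> int_matrix \<Rightarrow> fpath \<Rightarrow> int \<Rightarrow> fpath \<Rightarrow> quadruple set set" where
  "kep_basic N A B \<mu> m \<nu> = kep_class N A B \<mu> m \<nu> ` cylinder N A \<nu>"

definition kep_basis :: "nat \<Rightarrow> int_matrix \<Rightarrow> int_matrix \<Rightarrow> quadruple set set set" where
  "kep_basis N A B =
     {kep_basic N A B \<mu> m \<nu> | \<mu> m \<nu>.
        \<mu> \<in> finite_paths N A \<and> \<nu> \<in> finite_paths N A \<and>
        path_range N A \<mu> = path_range N A \<nu>}"

text \<open>
  \<open>kep_basis\<close> is a basis and not just a subbasis: an arrow in two of its members has, after
  extending the representatives, a common one, whose basic set lies in both.
\<close>

definition kep_groupoid ::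
    "nat \<Rightarrow> int_matrix \<Rightarrow> int_matrix \<Rightarrow> quadruple set topological_groupoid" where
  "kep_groupoid N A B =
     \<lparr>arrows = kep_arrows N A B,
      units = kep_unit N A B ` infinite_paths N A,
      src = kep_src N A B,
      rng = kep_rng N A B,
      gprod = kep_prod N A B,
      ginv = kep_inv N A B,
      gtop = topology_generated_by (kep_basis N A B)\<rparr>"

lemma topspace_kep_groupoid:
  "topspace (gtop (kep_groupoid N A B)) = arrows (kep_groupoid N A B)"
  by (auto simp: kep_groupoid_def topology_generated_by_topspace kep_basis_def kep_basic_def
      kep_arrows_def quadruples_def) blast+


section \<open>Independence of representatives\<close>

text \<open>
  Source, range, product and inverse are given by definite descriptions. The lemmas
  \<open>kep_src_class\<close>, \<open>kep_rng_class\<close>, \<open>kep_prod_class\<close> and \<open>kep_inv_class\<close> show that each of them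
  describes a unique object, and evaluate it on a representative.
\<close>

lemma kep_class_eq_iff:
  "kep_class N A B \<mu> m \<nu> x = kep_class N A B \<mu>' m' \<nu>' x' \<longleftrightarrow>
     ((\<mu>, m, \<nu>, x), (\<mu>', m', \<nu>', x')) \<in> kep_equiv N A B"
proof -
  have "equiv UNIV (kep_equiv N A B)"
    unfolding kep_equiv_def
    by (intro equivI refl_rtrancl trans_rtrancl sym_rtrancl) (auto simp: sym_def)
  from eq_equiv_class_iff[OF this] show ?thesis
    by (simp add: kep_class_def)
qed

definition quad_range :: "int_matrix \<Rightarrow> int_matrix \<Rightarrow> quadruple \<Rightarrow> edge stream" where
  "quad_range A B = (\<lambda>(\<mu>, m, \<nu>, x). prepend \<mu> (kappa_inf A B m (sdrop (length (snd \<nu>)) x)))"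

lemma sdrop_length_shift [simp]: "sdrop (length p) (p @- y) = y"
  by (induction p) auto

lemma quad_range_prepend [simp]:
  "quad_range A B (\<mu>, m, \<nu>, prepend \<nu> y) = prepend \<mu> (kappa_inf A B m y)"
  by (simp add: quad_range_def prepend_def)

lemma kep_step_invariant:
  assumes "(q, q') \<in> kep_step N A B"
  shows "snd (snd (snd q)) = snd (snd (snd q'))" "quad_range A B q = quad_range A B q'"
proof -
  from assms obtain \<mu> m \<nu> e z where q: "q = (\<mu>, m, \<nu>, prepend \<nu> (e ## z))"
    and q': "q' = (snoc \<mu> (kappa A B m e), phi A B m e, snoc \<nu> e, prepend \<nu> (e ## z))"
    by (auto simp: kep_step_def)
  show "snd (snd (snd q)) = snd (snd (snd q'))"
    by (simp add: q q')
  have *: "prepend \<nu> (e ## z) = prepend (snoc \<nu> e) z"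
    by (simp add: prepend_def snoc_def)
  have "kappa_inf A B m (e ## z) = kappa A B m e ## kappa_inf A B (phi A B m e) z"
    by (subst kappa_inf.code) simp
  then show "quad_range A B q = quad_range A B q'"
    unfolding q q' quad_range_prepend unfolding * quad_range_prepend
    by (simp add: prepend_def snoc_def)
qed

lemma kep_equiv_invariant:
  assumes "(q, q') \<in> kep_equiv N A B"
  shows "snd (snd (snd q)) = snd (snd (snd q'))" "quad_range A B q = quad_range A B q'"
  using assms unfolding kep_equiv_def
  by (induction rule: rtrancl_induct) (auto dest: kep_step_invariant)

lemma kep_src_class:
  assumes "(\<mu>, m, \<nu>, prepend \<nu> y) \<in> quadruples N A" "y \<in> tails_of N A \<nu>"
  shows "kep_src N A B (kep_class N A B \<mu> m \<nu> (prepend \<nu> y)) = kep_unit N A B (prepend \<nu> y)"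
  unfolding kep_src_def
proof (rule the_equality)
  show "\<exists>\<mu>' m' \<nu>' y'. (\<mu>', m', \<nu>', prepend \<nu>' y') \<in> quadruples N A \<and> y' \<in> tails_of N A \<nu>' \<and>
      kep_class N A B \<mu> m \<nu> (prepend \<nu> y) = kep_class N A B \<mu>' m' \<nu>' (prepend \<nu>' y') \<and>
      kep_unit N A B (prepend \<nu> y) = kep_unit N A B (prepend \<nu>' y')"
    using assms by blast
qed (use kep_equiv_invariant(1) in \<open>fastforce simp: kep_class_eq_iff\<close>)

lemma kep_rng_class:
  assumes "(\<mu>, m, \<nu>, prepend \<nu> y) \<in> quadruples N A" "y \<in> tails_of N A \<nu>"
  shows "kep_rng N A B (kep_class N A B \<mu> m \<nu> (prepend \<nu> y)) =
    kep_unit N A B (prepend \<mu> (kappa_inf A B m y))"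
  unfolding kep_rng_def
proof (rule the_equality)
  show "\<exists>\<mu>' m' \<nu>' y'. (\<mu>', m', \<nu>', prepend \<nu>' y') \<in> quadruples N A \<and> y' \<in> tails_of N A \<nu>' \<and>
      kep_class N A B \<mu> m \<nu> (prepend \<nu> y) = kep_class N A B \<mu>' m' \<nu>' (prepend \<nu>' y') \<and>
      kep_unit N A B (prepend \<mu> (kappa_inf A B m y)) =
        kep_unit N A B (prepend \<mu>' (kappa_inf A B m' y'))"
    using assms by blast
qed (use kep_equiv_invariant(2) in \<open>fastforce simp: kep_class_eq_iff\<close>)

lemma kep_unit_inject:
  "kep_unit N A B x = kep_unit N A B y \<Longrightarrow> x = y"
  by (auto simp: kep_unit_def kep_class_eq_iff dest: kep_equiv_invariant(1))

text \<open>
  The generating relation is the graph of a function on quadruples, so that two quadruples are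
  equivalent precisely if iterating this function makes them agree.
\<close>

definition quad_ext :: "int_matrix \<Rightarrow> int_matrix \<Rightarrow> quadruple \<Rightarrow> quadruple" where
  "quad_ext A B = (\<lambda>(\<mu>, m, \<nu>, x). let e = x !! length (snd \<nu>) in
     (snoc \<mu> (kappa A B m e), phi A B m e, snoc \<nu> e, x))"

lemma quad_ext_prepend:
  "quad_ext A B (\<mu>, m, \<nu>, prepend \<nu> (e ## z)) =
     (snoc \<mu> (kappa A B m e), phi A B m e, snoc \<nu> e, prepend \<nu> (e ## z))"
  by (simp add: quad_ext_def prepend_def)

lemma path_range_snoc [simp]:
  "path_range N A (snoc \<mu> e) = head (matrix_graph N A) e"
proof -
  have "pre_digraph.awlast G u (p @ [e]) = head G e"
    for u p and G :: "(nat, edge) pre_digraph"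
  proof (induction p arbitrary: u)
    case (Cons a p)
    have "pre_digraph.awalk_verts G (head G a) (p @ [e]) \<noteq> []"
      by (cases p) (auto simp: pre_digraph.awalk_verts.simps)
    then show ?case using Cons by (simp add: pre_digraph.awalk_verts.simps)
  qed (simp add: pre_digraph.awalk_verts.simps)
  then show ?thesis by (simp add: path_range_def snoc_def)
qed

lemma cas_awlast:
  fixes G :: "(nat, edge) pre_digraph"
  assumes "pre_digraph.cas G u p v"
  shows "pre_digraph.awlast G u p = v"
  using assms
proof (induction p arbitrary: u)
  case (Cons a p)
  have "pre_digraph.awalk_verts G (head G a) p \<noteq> []"
    by (cases p) (auto simp: pre_digraph.awalk_verts.simps)
  then show ?case
    using Cons by (simp add: pre_digraph.cas.simps pre_digraph.awalk_verts.simps)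
qed (simp add: pre_digraph.cas.simps pre_digraph.awalk_verts.simps)

lemma quadruples_iff:
  "(\<mu>, m, \<nu>, x) \<in> quadruples N A \<longleftrightarrow> \<mu> \<in> finite_paths N A \<and> \<nu> \<in> finite_paths N A \<and>
     path_range N A \<mu> = path_range N A \<nu> \<and> x \<in> cylinder N A \<nu>"
  unfolding quadruples_def by blast

lemma snoc_finite_paths:
  assumes "\<mu> \<in> finite_paths N A" "e \<in> arcs (matrix_graph N A)"
    "tail (matrix_graph N A) e = path_range N A \<mu>"
  shows "snoc \<mu> e \<in> finite_paths N A"
proof -
  let ?G = "matrix_graph N A"
  obtain u p where \<mu>: "\<mu> = (u, p)" by fastforce
  from assms(1) obtain v where "pre_digraph.awalk ?G u p v"
    by (auto simp: finite_paths_def \<mu>)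
  then have v: "u \<in> verts ?G" "set p \<subseteq> arcs ?G" "pre_digraph.cas ?G u p v"
    by (auto simp: pre_digraph.awalk_def)
  have "v = path_range N A \<mu>" using cas_awlast[OF v(3)] by (simp add: path_range_def \<mu>)
  have "pre_digraph.cas ?G u (p @ [e]) (head ?G e)"
    if "pre_digraph.cas ?G u p v" "tail ?G e = v" for u
    using that by (induction p arbitrary: u) (auto simp: pre_digraph.cas.simps)
  with v assms(2,3) \<open>v = _\<close> have "pre_digraph.awalk ?G u (p @ [e]) (head ?G e)"
    by (auto simp: pre_digraph.awalk_def)
  then show ?thesis by (auto simp: finite_paths_def snoc_def \<mu>)
qed

lemma kappa_ends [simp]:
  "tail (matrix_graph N A) (kappa A B m e) = tail (matrix_graph N A) e"
  "head (matrix_graph N A) (kappa A B m e) = head (matrix_graph N A) e"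
  by (auto simp: kappa_def matrix_graph_def split: prod.splits)

lemma kappa_arcs:
  "e \<in> arcs (matrix_graph N A) \<Longrightarrow> kappa A B m e \<in> arcs (matrix_graph N A)"
  by (auto simp: kappa_def matrix_graph_def)

lemma infinite_paths_SCons:
  "e ## z \<in> infinite_paths N A \<longleftrightarrow> e \<in> arcs (matrix_graph N A) \<and> z \<in> infinite_paths N A \<and>
     head (matrix_graph N A) e = ipath_source N A z"
  (is "?l \<longleftrightarrow> ?r")
proof
  assume l: ?l
  have "\<forall>k. z !! k \<in> arcs (matrix_graph N A) \<and>
      head (matrix_graph N A) (z !! k) = tail (matrix_graph N A) (z !! Suc k)"
    using l unfolding infinite_paths_def by (auto dest: spec[of _ "Suc _"])
  then show ?r using l unfolding infinite_paths_def ipath_source_def by (auto dest: spec[of _ 0])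
next
  assume r: ?r
  have "(e ## z) !! k \<in> arcs (matrix_graph N A) \<and>
      head (matrix_graph N A) ((e ## z) !! k) = tail (matrix_graph N A) ((e ## z) !! Suc k)" for k
    using r unfolding infinite_paths_def ipath_source_def by (cases k) auto
  then show ?l unfolding infinite_paths_def by blast
qed

lemma kappa_inf_SCons [simp]:
  "kappa_inf A B m (e ## z) = kappa A B m e ## kappa_inf A B (phi A B m e) z"
  by (subst kappa_inf.code) simp

lemma ipath_source_kappa_inf [simp]:
  "ipath_source N A (kappa_inf A B m y) = ipath_source N A y"
  by (simp add: ipath_source_def)

lemma kappa_inf_snth:
  "\<exists>m'. kappa_inf A B m y !! k = kappa A B m' (y !! k)"
  by (induction k arbitrary: m y) auto

lemma kappa_inf_infinite_paths:
  assumes "y \<in> infinite_paths N A"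
  shows "kappa_inf A B m y \<in> infinite_paths N A"
proof -
  have "kappa_inf A B m y !! k \<in> arcs (matrix_graph N A) \<and>
      head (matrix_graph N A) (kappa_inf A B m y !! k) =
      tail (matrix_graph N A) (kappa_inf A B m y !! Suc k)" for k
  proof -
    obtain m1 m2 where "kappa_inf A B m y !! k = kappa A B m1 (y !! k)"
      "kappa_inf A B m y !! Suc k = kappa A B m2 (y !! Suc k)"
      using kappa_inf_snth by metis
    with assms show ?thesis
      unfolding infinite_paths_def by (simp del: snth.simps add: kappa_arcs)
  qed
  then show ?thesis unfolding infinite_paths_def by blast
qed

lemma quad_cases:
  assumes "q \<in> quadruples N A"
  obtains \<mu> m \<nu> e z where "q = (\<mu>, m, \<nu>, prepend \<nu> (e ## z))" "e ## z \<in> tails_of N A \<nu>"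
    "e \<in> arcs (matrix_graph N A)" "tail (matrix_graph N A) e = path_range N A \<mu>"
    "\<mu> \<in> finite_paths N A" "\<nu> \<in> finite_paths N A" "path_range N A \<mu> = path_range N A \<nu>"
    "z \<in> tails_of N A (snoc \<nu> e)"
proof -
  from assms obtain \<mu> m \<nu> y where q: "q = (\<mu>, m, \<nu>, prepend \<nu> y)" "y \<in> tails_of N A \<nu>"
    "\<mu> \<in> finite_paths N A" "\<nu> \<in> finite_paths N A" "path_range N A \<mu> = path_range N A \<nu>"
    by (auto simp: quadruples_def cylinder_def)
  obtain e z where "y = e ## z" by (cases y)
  with q show ?thesis
    by (intro that[of \<mu> m \<nu> e z]) (auto simp: tails_of_def infinite_paths_SCons ipath_source_def)
qed

lemma quad_ext_step:
  assumes "q \<in> quadruples N A"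
  shows "(q, quad_ext A B q) \<in> kep_step N A B" "quad_ext A B q \<in> quadruples N A"
proof -
  from assms show "(q, quad_ext A B q) \<in> kep_step N A B"
  proof (cases rule: quad_cases)
    case (1 \<mu> m \<nu> e z)
    with assms show ?thesis
      unfolding kep_step_def mem_Collect_eq 1(1) quad_ext_prepend by blast
  qed
  from assms show "quad_ext A B q \<in> quadruples N A"
  proof (cases rule: quad_cases)
    case (1 \<mu> m \<nu> e z)
    have "prepend \<nu> (e ## z) = prepend (snoc \<nu> e) z"
      by (simp add: prepend_def snoc_def)
    then have "prepend \<nu> (e ## z) \<in> cylinder N A (snoc \<nu> e)"
      using 1 unfolding cylinder_def by (metis imageI)
    with 1 show ?thesis
      by (simp add: quadruples_iff quad_ext_prepend snoc_finite_paths kappa_arcs)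
  qed
qed

lemma kep_step_quad_ext:
  "(q, q') \<in> kep_step N A B \<Longrightarrow> q \<in> quadruples N A \<and> q' = quad_ext A B q"
  by (auto simp: kep_step_def quad_ext_prepend)

lemma quad_ext_iter:
  assumes "q \<in> quadruples N A"
  shows "(q, (quad_ext A B ^^ k) q) \<in> kep_equiv N A B" "(quad_ext A B ^^ k) q \<in> quadruples N A"
proof -
  have "(q, (quad_ext A B ^^ k) q) \<in> kep_equiv N A B \<and> (quad_ext A B ^^ k) q \<in> quadruples N A"
  proof (induction k)
    case 0
    then show ?case using assms by (simp add: kep_equiv_def)
  next
    case (Suc k)
    then show ?case using quad_ext_step[of "(quad_ext A B ^^ k) q" N A B]
      by (auto simp: kep_equiv_def intro: rtrancl_into_rtrancl)
  qed
  then show "(q, (quad_ext A B ^^ k) q) \<in> kep_equiv N A B"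
    "(quad_ext A B ^^ k) q \<in> quadruples N A" by auto
qed

lemma sym_kep_equiv: "sym (kep_equiv N A B)"
  unfolding kep_equiv_def by (intro sym_rtrancl) (auto simp: sym_def)

lemma kep_equiv_join:
  assumes "q \<in> quadruples N A" "q' \<in> quadruples N A"
    and "(quad_ext A B ^^ k) q = (quad_ext A B ^^ k') q'"
  shows "(q, q') \<in> kep_equiv N A B"
proof -
  have "(q, (quad_ext A B ^^ k') q') \<in> kep_equiv N A B"
    using quad_ext_iter(1)[OF assms(1), where B = B and k = k] unfolding assms(3) .
  moreover have "((quad_ext A B ^^ k') q', q') \<in> kep_equiv N A B"
    by (rule symD[OF sym_kep_equiv]) (rule quad_ext_iter(1)[OF assms(2)])
  ultimately show ?thesis
    unfolding kep_equiv_def by (rule rtrancl_trans)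
qed

lemma kep_equiv_imp_join:
  assumes "(q, q') \<in> kep_equiv N A B"
  shows "\<exists>k k'. (quad_ext A B ^^ k) q = (quad_ext A B ^^ k') q'"
  using assms unfolding kep_equiv_def
proof (induction rule: rtrancl_induct)
  case base
  then show ?case by blast
next
  case (step q1 q2)
  then obtain k k' where k: "(quad_ext A B ^^ k) q = (quad_ext A B ^^ k') q1" by blast
  from step(2) consider "q2 = quad_ext A B q1" | "q1 = quad_ext A B q2"
    by (auto dest: kep_step_quad_ext)
  then show ?case
  proof cases
    case 1
    have "(quad_ext A B ^^ Suc k) q = (quad_ext A B ^^ k') q2"
      using k by (simp add: 1 funpow_swap1)
    then show ?thesis by blast
  next
    case 2
    have "(quad_ext A B ^^ k) q = (quad_ext A B ^^ Suc k') q2"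
      using k by (simp add: 2 funpow_swap1)
    then show ?thesis by blast
  qed
qed

definition quad_inv :: "int_matrix \<Rightarrow> int_matrix \<Rightarrow> quadruple \<Rightarrow> quadruple" where
  "quad_inv A B q = (case q of (\<mu>, m, \<nu>, x) \<Rightarrow> (\<nu>, - m, \<mu>, quad_range A B q))"

lemma kappa_phi_minus:
  assumes "e \<in> arcs (matrix_graph N A)"
  shows "kappa A B (- m) (kappa A B m e) = e" "phi A B (- m) (kappa A B m e) = - phi A B m e"
proof -
  obtain i j n where e: "e = (i, j, n)" by (cases e)
  have n: "0 \<le> n" "n < A i j" using assms by (auto simp: e matrix_graph_def)
  have eq: "- m * B i j + (m * B i j + n) mod A i j = - ((m * B i j + n) div A i j) * A i j + n"
    using minus_mod_eq_mult_div[of "m * B i j + n" "A i j"] by (simp add: algebra_simps)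
  have arc: "(i, j, (m * B i j + n) mod A i j) \<in> arcs (matrix_graph N A)"
    using kappa_arcs[OF assms, of B m] by (simp add: e kappa_def)
  show "kappa A B (- m) (kappa A B m e) = e" "phi A B (- m) (kappa A B m e) = - phi A B m e"
    using kappa_phi_unique[where A = A and B = B and i = i and j = j, OF arc eq n]
    by (simp_all add: e kappa_def phi_def)
qed

lemma quad_inv_prepend:
  "quad_inv A B (\<mu>, m, \<nu>, prepend \<nu> y) = (\<nu>, - m, \<mu>, prepend \<mu> (kappa_inf A B m y))"
  by (simp add: quad_inv_def)

lemma quad_range_ext:
  assumes "q \<in> quadruples N A"
  shows "quad_range A B (quad_ext A B q) = quad_range A B q"
  using kep_step_invariant(2)[OF quad_ext_step(1)[OF assms]] by simp

lemma quad_inv_quadruples: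
  assumes "q \<in> quadruples N A"
  shows "quad_inv A B q \<in> quadruples N A"
  using assms
proof (cases rule: quad_cases)
  case (1 \<mu> m \<nu> e z)
  then have "kappa_inf A B m (e ## z) \<in> tails_of N A \<mu>"
    using kappa_inf_infinite_paths[of "e ## z" N A B m] ipath_source_kappa_inf[of N A B m "e ## z"]
    by (simp add: tails_of_def del: kappa_inf_SCons ipath_source_kappa_inf)
  then have "prepend \<mu> (kappa_inf A B m (e ## z)) \<in> cylinder N A \<mu>"
    by (simp add: cylinder_def del: kappa_inf_SCons)
  with 1 show ?thesis by (simp add: quad_inv_prepend quadruples_iff del: kappa_inf_SCons)
qed

lemma quad_ext_inv:
  assumes "q \<in> quadruples N A"
  shows "quad_ext A B (quad_inv A B q) = quad_inv A B (quad_ext A B q)"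
  using assms
proof (cases rule: quad_cases)
  case (1 \<mu> m \<nu> e z)
  have "quad_range A B q = prepend \<mu> (kappa A B m e ## kappa_inf A B (phi A B m e) z)"
    by (simp add: 1)
  then show ?thesis
    using quad_range_ext[OF assms, of B] 1
    by (simp add: quad_inv_def quad_ext_prepend kappa_phi_minus)
qed

lemma quad_ext_inv_iter:
  assumes "q \<in> quadruples N A"
  shows "(quad_ext A B ^^ k) (quad_inv A B q) = quad_inv A B ((quad_ext A B ^^ k) q)"
  by (induction k) (simp_all add: quad_ext_inv[OF quad_ext_iter(2)[OF assms]])

lemma kep_inv_class:
  assumes "(\<mu>, m, \<nu>, prepend \<nu> y) \<in> quadruples N A" "y \<in> tails_of N A \<nu>"
  shows "kep_inv N A B (kep_class N A B \<mu> m \<nu> (prepend \<nu> y)) =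
    kep_class N A B \<nu> (- m) \<mu> (prepend \<mu> (kappa_inf A B m y))"
  unfolding kep_inv_def
proof (rule the_equality)
  show "\<exists>\<mu>' m' \<nu>' y'. (\<mu>', m', \<nu>', prepend \<nu>' y') \<in> quadruples N A \<and> y' \<in> tails_of N A \<nu>' \<and>
      kep_class N A B \<mu> m \<nu> (prepend \<nu> y) = kep_class N A B \<mu>' m' \<nu>' (prepend \<nu>' y') \<and>
      kep_class N A B \<nu> (- m) \<mu> (prepend \<mu> (kappa_inf A B m y)) =
      kep_class N A B \<nu>' (- m') \<mu>' (prepend \<mu>' (kappa_inf A B m' y'))"
    by (intro exI conjI) (rule assms refl)+
next
  fix k
  assume "\<exists>\<mu>' m' \<nu>' y'. (\<mu>', m', \<nu>', prepend \<nu>' y') \<in> quadruples N A \<and> y' \<in> tails_of N A \<nu>' \<and>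
      kep_class N A B \<mu> m \<nu> (prepend \<nu> y) = kep_class N A B \<mu>' m' \<nu>' (prepend \<nu>' y') \<and>
      k = kep_class N A B \<nu>' (- m') \<mu>' (prepend \<mu>' (kappa_inf A B m' y'))"
  then obtain \<mu>' m' \<nu>' y' where q': "(\<mu>', m', \<nu>', prepend \<nu>' y') \<in> quadruples N A"
    and eq: "((\<mu>, m, \<nu>, prepend \<nu> y), (\<mu>', m', \<nu>', prepend \<nu>' y')) \<in> kep_equiv N A B"
    and k: "k = kep_class N A B \<nu>' (- m') \<mu>' (prepend \<mu>' (kappa_inf A B m' y'))"
    unfolding kep_class_eq_iff by (elim exE conjE) (rule that)
  let ?q = "(\<mu>, m, \<nu>, prepend \<nu> y)" and ?q' = "(\<mu>', m', \<nu>', prepend \<nu>' y')"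
  from kep_equiv_imp_join[OF eq] obtain i j
    where ij: "(quad_ext A B ^^ i) ?q = (quad_ext A B ^^ j) ?q'" by blast
  have "(quad_ext A B ^^ i) (quad_inv A B ?q) = (quad_ext A B ^^ j) (quad_inv A B ?q')"
    by (simp add: quad_ext_inv_iter[OF assms(1)] quad_ext_inv_iter[OF q'] ij)
  then have "(quad_inv A B ?q, quad_inv A B ?q') \<in> kep_equiv N A B"
    by (rule kep_equiv_join[OF quad_inv_quadruples[OF assms(1)] quad_inv_quadruples[OF q']])
  then show "k = kep_class N A B \<nu> (- m) \<mu> (prepend \<mu> (kappa_inf A B m y))"
    unfolding k quad_inv_prepend kep_class_eq_iff by (rule symD[OF sym_kep_equiv])
qed

definition quad_prod :: "quadruple \<Rightarrow> quadruple \<Rightarrow> quadruple" where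
  "quad_prod = (\<lambda>(\<Lambda>, n, _, _) (_, m, \<nu>, x). (\<Lambda>, n + m, \<nu>, x))"

definition quad_composable :: "int_matrix \<Rightarrow> int_matrix \<Rightarrow> quadruple \<Rightarrow> quadruple \<Rightarrow> bool" where
  "quad_composable A B = (\<lambda>(_, _, \<mu>', x) q. \<mu>' = fst q \<and> x = quad_range A B q)"

lemma kappa_phi_add:
  assumes "e \<in> arcs (matrix_graph N A)"
  shows "kappa A B (n + m) e = kappa A B n (kappa A B m e)"
    "phi A B (n + m) e = phi A B n (kappa A B m e) + phi A B m e"
proof -
  obtain i j k where e: "e = (i, j, k)" by (cases e)
  have pos: "0 < A i j" using assms by (auto simp: e matrix_graph_def)
  define r where "r = (m * B i j + k) mod A i j"
  define q where "q = (m * B i j + k) div A i j"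
  have "m * B i j + k = q * A i j + r"
    by (simp add: q_def r_def)
  then have eq: "(n + m) * B i j + k =
      ((n * B i j + r) div A i j + q) * A i j + (n * B i j + r) mod A i j"
    using div_mult_mod_eq[of "n * B i j + r" "A i j"]
    by (simp only: distrib_right)
  have "0 \<le> (n * B i j + r) mod A i j" "(n * B i j + r) mod A i j < A i j"
    using pos by simp_all
  from kappa_phi_unique[where A = A and B = B and i = i and j = j, OF assms[unfolded e] eq this]
  show "kappa A B (n + m) e = kappa A B n (kappa A B m e)"
    "phi A B (n + m) e = phi A B n (kappa A B m e) + phi A B m e"
    by (simp_all only: e kappa_def phi_def prod.case q_def r_def)
qed

lemma quad_ext_prod:
  assumes "g \<in> quadruples N A" "q \<in> quadruples N A" "quad_composable A B g q"
  shows "quad_prod g q \<in> quadruples N A"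
    and "quad_ext A B (quad_prod g q) = quad_prod (quad_ext A B g) (quad_ext A B q)"
    and "quad_composable A B (quad_ext A B g) (quad_ext A B q)"
proof -
  from assms(2) obtain \<mu> m \<nu> e z where q: "q = (\<mu>, m, \<nu>, prepend \<nu> (e ## z))"
    "e ## z \<in> tails_of N A \<nu>" "e \<in> arcs (matrix_graph N A)"
    "path_range N A \<mu> = path_range N A \<nu>" "\<nu> \<in> finite_paths N A"
    by (elim quad_cases)
  obtain \<Lambda> n where g: "g = (\<Lambda>, n, \<mu>, quad_range A B q)"
    using assms(3) by (cases g) (auto simp: quad_composable_def q)
  have r: "quad_range A B q = prepend \<mu> (kappa A B m e ## kappa_inf A B (phi A B m e) z)"
    by (simp add: q)
  show "quad_prod g q \<in> quadruples N A"
    using assms(1,2) by (auto simp: quad_prod_def g q quadruples_iff)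
  show "quad_ext A B (quad_prod g q) = quad_prod (quad_ext A B g) (quad_ext A B q)"
    unfolding g r by (simp add: q quad_prod_def quad_ext_prepend kappa_phi_add[OF q(3)])
  show "quad_composable A B (quad_ext A B g) (quad_ext A B q)"
    using quad_range_ext[OF assms(2), of B]
    unfolding g r quad_composable_def by (simp add: q quad_ext_prepend)
qed

lemma quad_ext_prod_iter:
  assumes "g \<in> quadruples N A" "q \<in> quadruples N A" "quad_composable A B g q"
  shows "(quad_ext A B ^^ k) (quad_prod g q) =
      quad_prod ((quad_ext A B ^^ k) g) ((quad_ext A B ^^ k) q)"
proof -
  have "(quad_ext A B ^^ k) (quad_prod g q) =
      quad_prod ((quad_ext A B ^^ k) g) ((quad_ext A B ^^ k) q) \<and>
      quad_composable A B ((quad_ext A B ^^ k) g) ((quad_ext A B ^^ k) q)"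
  proof (induction k)
    case 0
    show ?case using assms(3) by simp
  next
    case (Suc k)
    with quad_ext_prod(2,3)[OF quad_ext_iter(2)[OF assms(1)] quad_ext_iter(2)[OF assms(2)]]
    show ?case by simp
  qed
  then show ?thesis by blast
qed

lemma quad_ext_length:
  "length (snd (fst ((quad_ext A B ^^ k) q))) = length (snd (fst q)) + k"
  "length (snd (fst (snd (snd ((quad_ext A B ^^ k) q))))) = length (snd (fst (snd (snd q)))) + k"
proof -
  have "length (snd (fst (quad_ext A B q))) = Suc (length (snd (fst q)))"
    "length (snd (fst (snd (snd (quad_ext A B q))))) = Suc (length (snd (fst (snd (snd q)))))" for q
    by (cases q; simp add: quad_ext_def Let_def snoc_def)+
  then show "length (snd (fst ((quad_ext A B ^^ k) q))) = length (snd (fst q)) + k"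
    "length (snd (fst (snd (snd ((quad_ext A B ^^ k) q))))) = length (snd (fst (snd (snd q)))) + k"
    by (induction k) simp_all
qed

lemma kep_equiv_prod:
  assumes "g \<in> quadruples N A" "q \<in> quadruples N A" "quad_composable A B g q"
    and "g' \<in> quadruples N A" "q' \<in> quadruples N A" "quad_composable A B g' q'"
    and "(g, g') \<in> kep_equiv N A B" "(q, q') \<in> kep_equiv N A B"
  shows "(quad_prod g q, quad_prod g' q') \<in> kep_equiv N A B"
proof -
  let ?E = "quad_ext A B"
  from assms(7,8) obtain i i' j j' where i: "(?E ^^ i) g = (?E ^^ i') g'"
    and j: "(?E ^^ j) q = (?E ^^ j') q'"
    by (meson kep_equiv_imp_join)
  have fst: "fst (snd (snd g)) = fst q" "fst (snd (snd g')) = fst q'"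
    using assms(3,6) by (auto simp: quad_composable_def split: prod.splits)
  have len: "length (snd (fst q)) + i = length (snd (fst q')) + i'"
    "length (snd (fst q)) + j = length (snd (fst q')) + j'"
    using arg_cong[OF i, of "\<lambda>q. length (snd (fst (snd (snd q))))"]
      arg_cong[OF j, of "\<lambda>q. length (snd (fst q))"]
    by (simp_all add: quad_ext_length fst)
  have "i + j' = j + i'"
    using len by linarith
  then have g: "(?E ^^ (i + j)) g = (?E ^^ (i + j')) g'"
    by (simp only: add.commute[of i j] funpow_add comp_apply i)
  have q: "(?E ^^ (i + j)) q = (?E ^^ (i + j')) q'"
    by (simp only: funpow_add comp_apply j)
  have "(?E ^^ (i + j)) (quad_prod g q) = quad_prod ((?E ^^ (i + j)) g) ((?E ^^ (i + j)) q)"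
    by (rule quad_ext_prod_iter[OF assms(1-3)])
  also have "\<dots> = quad_prod ((?E ^^ (i + j')) g') ((?E ^^ (i + j')) q')"
    unfolding g q ..
  also have "\<dots> = (?E ^^ (i + j')) (quad_prod g' q')"
    by (rule quad_ext_prod_iter[OF assms(4-6), symmetric])
  finally have "(?E ^^ (i + j)) (quad_prod g q) = (?E ^^ (i + j')) (quad_prod g' q')" .
  then show ?thesis
    by (rule kep_equiv_join[OF quad_ext_prod(1)[OF assms(1-3)] quad_ext_prod(1)[OF assms(4-6)]])
qed

lemma kep_prod_class:
  assumes "(\<Lambda>, n, \<mu>, prepend \<mu> (kappa_inf A B m y)) \<in> quadruples N A"
    and "(\<mu>, m, \<nu>, prepend \<nu> y) \<in> quadruples N A" "y \<in> tails_of N A \<nu>"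
  shows "kep_prod N A B (kep_class N A B \<Lambda> n \<mu> (prepend \<mu> (kappa_inf A B m y)))
      (kep_class N A B \<mu> m \<nu> (prepend \<nu> y)) = kep_class N A B \<Lambda> (n + m) \<nu> (prepend \<nu> y)"
  unfolding kep_prod_def
proof (rule the_equality, goal_cases)
  case 1
  show ?case by (intro exI conjI) (rule assms refl)+
next
  case (2 k)
  then obtain \<Lambda>' n' \<mu>' m' \<nu>' y' where
    q': "(\<Lambda>', n', \<mu>', prepend \<mu>' (kappa_inf A B m' y')) \<in> quadruples N A"
      "(\<mu>', m', \<nu>', prepend \<nu>' y') \<in> quadruples N A"
    and eq: "((\<Lambda>, n, \<mu>, prepend \<mu> (kappa_inf A B m y)),
        (\<Lambda>', n', \<mu>', prepend \<mu>' (kappa_inf A B m' y'))) \<in> kep_equiv N A B"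
      "((\<mu>, m, \<nu>, prepend \<nu> y), (\<mu>', m', \<nu>', prepend \<nu>' y')) \<in> kep_equiv N A B"
    and k: "k = kep_class N A B \<Lambda>' (n' + m') \<nu>' (prepend \<nu>' y')"
    unfolding kep_class_eq_iff by (elim exE conjE) (rule that)
  from kep_equiv_prod[OF assms(1,2) _ q' _ eq]
  have "((\<Lambda>, n + m, \<nu>, prepend \<nu> y), (\<Lambda>', n' + m', \<nu>', prepend \<nu>' y')) \<in> kep_equiv N A B"
    by (simp add: quad_composable_def quad_prod_def)
  then show ?case
    unfolding k kep_class_eq_iff by (rule symD[OF sym_kep_equiv])
qed

end

theory Submission
  imports Defs
begin

text \<open>
  An element of the topological full group permutes the infinite paths by finitely many maps
  \<open>\<nu> y \<mapsto> \<mu> \<kappa>\<^sub>m(y)\<close>. Bijections of this form between finite disjoint unions of copies of the spaces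
  \<open>X\<^sub>v\<close> of paths from \<open>v\<close> form a groupoid, in which the topological full group is the automorphism
  group of the union of all \<open>X\<^sub>v\<close>. This groupoid is generated by moves that touch boundedly many
  summands: \<open>\<kappa>\<^sub>1\<close>, the expansion of \<open>X\<^sub>v\<close> along the edges leaving \<open>v\<close>, and relabellings. A product of
  moves may however pass through unions of arbitrarily many summands.

  Call a multiset of vertices reducible if the corresponding union is isomorphic to one with fewer
  summands. By Dickson's lemma there are finitely many reducible multisets such that every reducible
  one contains one of them; fix a reducing isomorphism for each and add it to the moves. If some vertex emits two edges,
  isomorphism classes of nonempty unions form a group, and it follows that a large enough union
  isomorphic to the given one contains a reducible multiset avoiding any bounded set of summands.
  Since moves with disjoint supports commute, a product of moves can then be pushed down, one size at
  a time, to unions of bounded size. Up to relabelling there are only finitely many of these, so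
  the automorphism group is finitely generated. If no vertex emits two edges, there are only finitely
  many infinite paths.
\<close>

section \<open>Preliminaries\<close>

text \<open>The descent is a connectivity argument. Cell sets are the vertices of a graph whose
  edges are single moves, filtered by the number of cells, and a product of moves is a walk in it.
  To turn a walk through sets of at most \<open>R + 1\<close> cells into one through sets of at most
  \<open>R\<close> cells, each visited set of \<open>R + 1\<close> cells is left along an edge to a
  smaller set, its exit, and the new walk runs between the ends of the exits. Two comparisons are
  required: of different exits at one set, and of exits at the two ends of an edge. Each is made by
  a reduction that commutes with the moves in question, of which there are at most two; this is why
  reducible multisets are sought away from a bounded set of cells. There is no circularity in the
  constants: the size of the reductions is bounded first, then the size of all moves, and only then
  the number of cells above which the descent works. Relations serve instead of functions, since a
  partial bijection then carries its own domain, its inverse is its converse, and products read from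
  left to right.\<close>

lemma single_valued_Un:
  "single_valued f \<Longrightarrow> single_valued g \<Longrightarrow> Domain f \<inter> Domain g = {} \<Longrightarrow> single_valued (f \<union> g)"
  unfolding single_valued_def by blast

lemma Un_relcomp_disjoint:
  "Range p \<inter> Domain g = {} \<Longrightarrow> Range r \<inter> Domain f = {} \<Longrightarrow> (p \<union> r) O (f \<union> g) = p O f \<union> r O g"
  by blast

lemma shift_eqD:
  assumes "length p = length q" "p @- x = q @- y"
  shows "p = q" "x = y"
proof -
  show "p = q" using arg_cong[OF assms(2), of "stake (length p)"] assms(1)
    by (simp add: stake_shift)
  show "x = y" using assms sdrop_length_shift by metis
qed

lemma bounded_choice:
  assumes "finite I" "\<And>i. i \<in> I \<Longrightarrow> \<exists>n :: nat. Q i n" "\<And>i n n'. Q i n \<Longrightarrow> n \<le> n' \<Longrightarrow> Q i n'"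
  shows "\<exists>n. \<forall>i \<in> I. Q i n"
proof -
  from assms(2) obtain g where g: "\<And>i. i \<in> I \<Longrightarrow> Q i (g i)" by metis
  have "Q i (Max (g ` I))" if "i \<in> I" for i
    using g[OF that] by (rule assms(3)) (use assms(1) that in simp)
  then show ?thesis by blast
qed

text \<open>If the monotone subsequence that always exists is decreasing, it is constant from the
  index of its minimum on, and this tail is increasing.\<close>

lemma mono_subseq_nat:
  fixes g :: "nat \<Rightarrow> nat"
  obtains r :: "nat \<Rightarrow> nat" where "strict_mono r" "mono (g \<circ> r)"
proof -
  obtain r :: "nat \<Rightarrow> nat" where r: "strict_mono r" "monoseq (\<lambda>n. g (r n))"
    using seq_monosub by blast
  show thesis
  proof (cases "incseq (\<lambda>n. g (r n))")
    case True
    then have "mono (g \<circ> r)" by (simp add: incseq_def mono_def)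
    with r(1) show ?thesis by (rule that)
  next
    case False
    with r(2) have dec: "decseq (\<lambda>n. g (r n))" by (simp add: monoseq_iff)
    define k where "k = (ARG_MIN (\<lambda>n. g (r n)) n. True)"
    have k: "g (r k) \<le> g (r n)" for n
      unfolding k_def by (rule arg_min_nat_le) simp
    have "g (r (k + n)) = g (r k)" for n
      using k[of "k + n"] decseqD[OF dec, of k "k + n"] by simp
    then have "mono (g \<circ> (\<lambda>n. r (k + n)))" by (simp add: mono_def)
    moreover have "strict_mono (\<lambda>n. r (k + n))" using r(1) by (simp add: strict_mono_def)
    ultimately show ?thesis by (intro that)
  qed
qed

text \<open>One coordinate at a time: passing to a further subsequence keeps the coordinates already
  treated monotone. Outside \<open>I\<close> all counts vanish.\<close>

lemma dickson_multiset:
  fixes f :: "nat \<Rightarrow> 'a multiset"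
  assumes "finite I" "\<And>n. set_mset (f n) \<subseteq> I"
  obtains r :: "nat \<Rightarrow> nat" where "strict_mono r" "\<And>m n. m \<le> n \<Longrightarrow> f (r m) \<subseteq># f (r n)"
proof -
  have "\<exists>r :: nat \<Rightarrow> nat. strict_mono r \<and> (\<forall>v \<in> I. mono (\<lambda>n. count (f (r n)) v))"
    using assms(1)
  proof (induction rule: finite_induct)
    case empty
    then show ?case using strict_mono_id by blast
  next
    case (insert v I)
    then obtain r :: "nat \<Rightarrow> nat" where r: "strict_mono r" "\<And>v. v \<in> I \<Longrightarrow> mono (\<lambda>n. count (f (r n)) v)" by blast
    obtain q :: "nat \<Rightarrow> nat" where q: "strict_mono q" "mono ((\<lambda>n. count (f (r n)) v) \<circ> q)"
      by (rule mono_subseq_nat)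
    have "mono (\<lambda>n. count (f (r (q n))) w)" if "w \<in> insert v I" for w
    proof (cases "w = v")
      case True
      then show ?thesis using q(2) by (simp add: comp_def)
    next
      case False
      with that have "mono (\<lambda>n. count (f (r n)) w)" using r(2) by simp
      then show ?thesis using q(1) by (auto simp: mono_def dest: strict_mono_mono)
    qed
    moreover have "strict_mono (r \<circ> q)" using r(1) q(1) by (rule strict_mono_o)
    ultimately show ?case by (intro exI[of _ "r \<circ> q"]) (simp add: comp_def)
  qed
  then obtain r :: "nat \<Rightarrow> nat" where r: "strict_mono r" "\<And>v. v \<in> I \<Longrightarrow> mono (\<lambda>n. count (f (r n)) v)" by blast
  have "f (r m) \<subseteq># f (r n)" if "m \<le> n" for m n
  proof (rule mset_subset_eqI)
    fix v show "count (f (r m)) v \<le> count (f (r n)) v"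
    proof (cases "v \<in> I")
      case True
      then show ?thesis using r(2) that by (auto dest: monoD)
    next
      case False
      then show ?thesis using assms(2) by (metis count_eq_zero_iff le0 subsetD)
    qed
  qed
  with r(1) that show thesis by blast
qed

lemma finite_bounded_multisets:
  assumes "finite I"
  shows "finite {b. set_mset b \<subseteq> I \<and> size b \<le> k}"
proof (rule finite_surj)
  show "finite {xs. set xs \<subseteq> I \<and> length xs \<le> k}" using assms by (rule finite_lists_length_le)
  show "{b. set_mset b \<subseteq> I \<and> size b \<le> k} \<subseteq> mset ` {xs. set xs \<subseteq> I \<and> length xs \<le> k}"
  proof
    fix b assume b: "b \<in> {b. set_mset b \<subseteq> I \<and> size b \<le> k}"
    obtain xs where "mset xs = b" using ex_mset by blast
    with b show "b \<in> mset ` {xs. set xs \<subseteq> I \<and> length xs \<le> k}" by (auto intro!: image_eqI[of _ _ xs])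
  qed
qed

section \<open>Local bijections between unions of path spaces\<close>

text \<open>The first component is the label of a copy, for points as well as for cells. The
  infinite supply of labels makes fresh copies available.\<close>

type_synonym point = "nat \<times> edge stream"
type_synonym point_rel = "(point \<times> point) set"
type_synonym cell_set = "(nat \<times> nat) set"

locale kep =
  fixes N :: nat and A B :: int_matrix
  assumes nonneg: "i \<in> {1..N} \<Longrightarrow> j \<in> {1..N} \<Longrightarrow> A i j \<ge> 0"
    and no_zero_row: "i \<in> {1..N} \<Longrightarrow> \<exists>j \<in> {1..N}. A i j \<noteq> 0"
    and connected: "strongly_connected (matrix_graph N A)"
begin

section \<open>Infinite paths and the action of the integers on them\<close>

abbreviation "V \<equiv> {1..N}"
abbreviation "E \<equiv> arcs (matrix_graph N A)"
abbreviation "hd_of \<equiv> head (matrix_graph N A)"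
abbreviation "tl_of \<equiv> tail (matrix_graph N A)"
abbreviation "X \<equiv> infinite_paths N A"
abbreviation "s \<equiv> ipath_source N A"
abbreviation "K \<equiv> kappa_inf A B"

lemma finite_arcs: "finite E"
proof (rule finite_subset)
  show "E \<subseteq> (SIGMA i:V. SIGMA j:V. {0..<A i j})"
    by (auto simp: matrix_graph_def)
qed auto

lemma arc_ends: "e \<in> E \<Longrightarrow> tl_of e \<in> V" "e \<in> E \<Longrightarrow> hd_of e \<in> V"
  by (auto simp: matrix_graph_def)

lemma arc_out:
  assumes "v \<in> V"
  shows "\<exists>e \<in> E. tl_of e = v"
proof -
  obtain j where "j \<in> V" "A v j \<noteq> 0" using no_zero_row assms by blast
  moreover from this have "0 < A v j" using nonneg[of v j] assms by simp
  ultimately show ?thesis using assms by (intro bexI[of _ "(v, j, 0)"]) (auto simp: matrix_graph_def)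
qed

lemma s_SCons [simp]: "s (e ## z) = tl_of e"
  by (simp add: ipath_source_def)

lemma s_in_V: "x \<in> X \<Longrightarrow> s x \<in> V"
  by (cases x) (auto simp: infinite_paths_SCons dest: arc_ends)

lemma path_from:
  assumes "v \<in> V"
  shows "\<exists>x \<in> X. s x = v"
proof -
  obtain g where g: "\<And>v. v \<in> V \<Longrightarrow> g v \<in> E \<and> tl_of (g v) = v" using arc_out by metis
  define x where "x = smap g (siterate (hd_of \<circ> g) v)"
  have V: "((hd_of \<circ> g) ^^ k) v \<in> V" for k
    by (induction k) (use assms g arc_ends in auto)
  have "x !! k \<in> E \<and> hd_of (x !! k) = tl_of (x !! Suc k)" for k
    using g[OF V[of k]] g[OF V[of "Suc k"]] by (simp add: x_def del: snth.simps)
  then have "x \<in> X" unfolding infinite_paths_def by blast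
  moreover have "s x = v" using g[OF assms] by (simp add: x_def ipath_source_def)
  ultimately show ?thesis by blast
qed

lemma K_in_X [simp]: "y \<in> X \<Longrightarrow> K m y \<in> X"
  by (rule kappa_inf_infinite_paths)

lemma K_0: "y \<in> X \<Longrightarrow> K 0 y = y"
proof (coinduction arbitrary: y)
  case Eq_stream
  obtain e z where y: "y = e ## z" by (cases y)
  then have "e \<in> E" "z \<in> X" using Eq_stream by (auto simp: infinite_paths_SCons)
  then have "kappa A B 0 e = e" "phi A B 0 e = 0"
    by (auto simp: kappa_def phi_def matrix_graph_def)
  with y \<open>z \<in> X\<close> show ?case by auto
qed

text \<open>Edge by edge this is the cocycle identity \<open>kappa_phi_add\<close>. The exponents
  change along the path, so the coinduction generalises over them.\<close>

lemma K_add: "y \<in> X \<Longrightarrow> K n (K m y) = K (n + m) y"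
proof (coinduction arbitrary: y n m)
  case Eq_stream
  obtain e z where y: "y = e ## z" by (cases y)
  then have "e \<in> E" "z \<in> X" using Eq_stream by (auto simp: infinite_paths_SCons)
  with y show ?case by (auto simp: kappa_phi_add[OF \<open>e \<in> E\<close>])
qed

lemma K_minus [simp]: "y \<in> X \<Longrightarrow> K m (K (- m) y) = y" "y \<in> X \<Longrightarrow> K (- m) (K m y) = y"
  by (simp_all add: K_add K_0)

lemma K_shift: "K m (p @- y) = kappa_path A B m p @- K (phi_path A B m p) y"
  by (induction p arbitrary: m) (simp_all add: phi_path_def)

lemma length_kappa_path [simp]: "length (kappa_path A B m p) = length p"
  by (induction p arbitrary: m) auto

lemma shift_in_X:
  assumes "p @- z \<in> X"
  shows "z \<in> X" and "z' \<in> X \<Longrightarrow> s z' = s z \<Longrightarrow> p @- z' \<in> X \<and> s (p @- z') = s (p @- z)"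
proof -
  show "z \<in> X" using assms by (induction p) (auto simp: infinite_paths_SCons)
  show "p @- z' \<in> X \<and> s (p @- z') = s (p @- z)" if "z' \<in> X" "s z' = s z"
    using assms that by (induction p) (auto simp: infinite_paths_SCons)
qed

text \<open>For a vertex \<open>w\<close> this says that \<open>p\<close> is a walk ending in
  \<open>w\<close>, since some infinite path starts there. Testing on infinite paths avoids
  recording a source and treats the empty list like any other.\<close>

definition walk_to :: "nat \<Rightarrow> edge list \<Rightarrow> bool" where
  "walk_to w p \<longleftrightarrow> (\<forall>y \<in> X. s y = w \<longrightarrow> p @- y \<in> X)"

lemma walk_to_Nil [simp]: "walk_to w []"
  by (simp add: walk_to_def)

lemma walk_to_shift: "p @- y \<in> X \<Longrightarrow> walk_to (s y) p"
  using shift_in_X(2) unfolding walk_to_def by blast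

lemma walk_to_append:
  assumes "walk_to w p" "y \<in> X" "s y = w" "y = r @- z"
  shows "walk_to (s z) (p @ r)"
  using assms walk_to_shift[of "p @ r" z] by (simp add: walk_to_def)

text \<open>The map induced by a basic bisection of the groupoid with source prefix \<open>p\<close>
  and range prefix \<open>q\<close>, from copy \<open>i\<close> to copy \<open>j\<close>.\<close>

definition basic_rel :: "nat \<Rightarrow> edge list \<Rightarrow> int \<Rightarrow> nat \<Rightarrow> edge list \<Rightarrow> nat \<Rightarrow> point_rel" where
  "basic_rel i p m j q w = {((i, p @- y), (j, q @- K m y)) | y. y \<in> X \<and> s y = w}"

text \<open>Nothing is said about finitely many basic relations being enough;
  \<open>tabulated_uniform\<close> derives this by compactness. The infinitary form passes directly
  to unions, converses and products.\<close>

definition local_rel :: "point_rel \<Rightarrow> bool" where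
  "local_rel f \<longleftrightarrow> (\<forall>t \<in> f. \<exists>i p m j q w.
     walk_to w p \<and> walk_to w q \<and> t \<in> basic_rel i p m j q w \<and> basic_rel i p m j q w \<subseteq> f)"

lemma basic_rel_local: "walk_to w p \<Longrightarrow> walk_to w q \<Longrightarrow> local_rel (basic_rel i p m j q w)"
  unfolding local_rel_def by blast

lemma local_rel_UN: "(\<And>f. f \<in> F \<Longrightarrow> local_rel f) \<Longrightarrow> local_rel (\<Union> F)"
  unfolding local_rel_def by (meson Union_iff Union_upper subset_trans)

lemma local_rel_Un: "local_rel f \<Longrightarrow> local_rel g \<Longrightarrow> local_rel (f \<union> g)"
  using local_rel_UN[of "{f, g}"] by auto

lemma basic_rel_converse: "(basic_rel i p m j q w)\<inverse> = basic_rel j q (- m) i p w"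
proof -
  have "(basic_rel i p m j q w)\<inverse> \<subseteq> basic_rel j q (- m) i p w" for i p m j q w
  proof
    fix t assume "t \<in> (basic_rel i p m j q w)\<inverse>"
    then obtain y where "y \<in> X" "s y = w" "t = ((j, q @- K m y), (i, p @- y))"
      by (auto simp: basic_rel_def)
    then show "t \<in> basic_rel j q (- m) i p w"
      unfolding basic_rel_def by (intro CollectI exI[of _ "K m y"]) simp
  qed
  from this[of i p m j q w] this[of j q "- m" i p w] show ?thesis by auto
qed

lemma local_rel_converse: "local_rel f \<Longrightarrow> local_rel (f\<inverse>)"
  unfolding local_rel_def
proof
  fix t
  assume f: "\<forall>t \<in> f. \<exists>i p m j q w.
     walk_to w p \<and> walk_to w q \<and> t \<in> basic_rel i p m j q w \<and> basic_rel i p m j q w \<subseteq> f"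
    and "t \<in> f\<inverse>"
  then obtain t' where t': "t' \<in> f" "t = (snd t', fst t')" by auto
  with f obtain i p m j q w where *: "walk_to w p" "walk_to w q" "t' \<in> basic_rel i p m j q w"
     "basic_rel i p m j q w \<subseteq> f" by blast
  then have "t \<in> (basic_rel i p m j q w)\<inverse>" "(basic_rel i p m j q w)\<inverse> \<subseteq> f\<inverse>" using t' by auto
  with * show "\<exists>i p m j q w. walk_to w p \<and> walk_to w q \<and> t \<in> basic_rel i p m j q w \<and>
      basic_rel i p m j q w \<subseteq> f\<inverse>" unfolding basic_rel_converse by blast
qed

text \<open>The counterpart of iterating \<open>quad_ext\<close>: by \<open>K_shift\<close> the
  action on \<open>r @- z\<close> splits into the action on \<open>r\<close> and the action on
  \<open>z\<close> with exponent \<open>phi_path A B m r\<close>, so both prefixes can be prolonged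
  along a given path.\<close>

lemma basic_rel_refine:
  fixes n :: nat
  assumes "walk_to w p" "walk_to w q" "y \<in> X" "s y = w"
  defines "r \<equiv> stake n y"
  shows "basic_rel i (p @ r) (phi_path A B m r) j (q @ kappa_path A B m r) (s (sdrop n y))
      \<subseteq> basic_rel i p m j q w"
    and "((i, p @- y), (j, q @- K m y))
      \<in> basic_rel i (p @ r) (phi_path A B m r) j (q @ kappa_path A B m r) (s (sdrop n y))"
    and "walk_to (s (sdrop n y)) (p @ r)" "walk_to (s (sdrop n y)) (q @ kappa_path A B m r)"
proof -
  have y: "y = r @- sdrop n y" by (simp add: r_def stake_sdrop)
  have Ky: "K m y = kappa_path A B m r @- K (phi_path A B m r) (sdrop n y)"
    by (subst y) (rule K_shift)
  have z: "sdrop n y \<in> X" using assms(3) y shift_in_X(1) by metis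
  show "walk_to (s (sdrop n y)) (p @ r)"
    using walk_to_append[OF assms(1,3,4) y] .
  show "walk_to (s (sdrop n y)) (q @ kappa_path A B m r)"
    using walk_to_append[OF assms(2) _ _ Ky] assms(3,4) by simp
  show "((i, p @- y), (j, q @- K m y))
      \<in> basic_rel i (p @ r) (phi_path A B m r) j (q @ kappa_path A B m r) (s (sdrop n y))"
    unfolding basic_rel_def by (intro CollectI exI[of _ "sdrop n y"])
      (use y z Ky in auto)
  show "basic_rel i (p @ r) (phi_path A B m r) j (q @ kappa_path A B m r) (s (sdrop n y))
      \<subseteq> basic_rel i p m j q w"
  proof
    fix t
    assume "t \<in> basic_rel i (p @ r) (phi_path A B m r) j (q @ kappa_path A B m r) (s (sdrop n y))"
    then obtain z' where z': "z' \<in> X" "s z' = s (sdrop n y)"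
      "t = ((i, (p @ r) @- z'), (j, (q @ kappa_path A B m r) @- K (phi_path A B m r) z'))"
      by (auto simp: basic_rel_def)
    have "r @- z' \<in> X \<and> s (r @- z') = s (r @- sdrop n y)"
      using shift_in_X(2)[of r "sdrop n y" z'] y assms(3) z' by simp
    then show "t \<in> basic_rel i p m j q w" using z' y assms(4)
      unfolding basic_rel_def by (intro CollectI exI[of _ "r @- z'"]) (simp add: K_shift)
  qed
qed

lemma basic_rel_comp:
  "basic_rel i p m j q w O basic_rel j q n k r w = basic_rel i p (n + m) k r w"
proof -
  have "((i, p @- y), (k, r @- K (n + m) y)) \<in> basic_rel i p m j q w O basic_rel j q n k r w"
    if "y \<in> X" "s y = w" for y
    using that by (intro relcompI[of _ "(j, q @- K m y)"]) (auto simp: basic_rel_def K_add)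
  moreover have "t \<in> basic_rel i p (n + m) k r w"
    if "t \<in> basic_rel i p m j q w O basic_rel j q n k r w" for t
    using that by (auto simp: basic_rel_def K_add)
  ultimately show ?thesis
    unfolding basic_rel_def[of i p "n + m"] set_eq_iff mem_Collect_eq by blast
qed

text \<open>Prolonging by \<open>n\<close> edges adds \<open>n\<close> to both prefix lengths.
  Having all \<open>n\<close> at hand allows matching the middle prefixes in a product.\<close>

lemma local_rel_obtain:
  assumes "local_rel f" "((i, x), (j, y)) \<in> f"
  obtains c d where "\<And>n. \<exists>p m q w. walk_to w p \<and> walk_to w q \<and>
    ((i, x), (j, y)) \<in> basic_rel i p m j q w \<and> basic_rel i p m j q w \<subseteq> f \<and>
    length p = c + n \<and> length q = d + n"
proof -
  from assms obtain i' p m j' q w where *: "walk_to w p" "walk_to w q"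
    "((i, x), (j, y)) \<in> basic_rel i' p m j' q w" "basic_rel i' p m j' q w \<subseteq> f"
    unfolding local_rel_def by blast
  then have ij: "i' = i" "j' = j" by (auto simp: basic_rel_def)
  from * obtain z where z: "z \<in> X" "s z = w" "x = p @- z" "y = q @- K m z"
    by (auto simp: basic_rel_def)
  show thesis
  proof (rule that[of "length p" "length q"])
    fix n
    note r = basic_rel_refine[OF *(1,2) z(1,2), where n = n]
    show "\<exists>p' m q' w. walk_to w p' \<and> walk_to w q' \<and>
      ((i, x), (j, y)) \<in> basic_rel i p' m j q' w \<and> basic_rel i p' m j q' w \<subseteq> f \<and>
      length p' = length p + n \<and> length q' = length q + n"
      by (intro exI conjI, rule r(3), rule r(4), unfold z, rule r(2), rule subset_trans[OF r(1)])
        (use * ij in auto)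
  qed
qed

lemma local_rel_comp:
  assumes "local_rel f" "local_rel g"
  shows "local_rel (f O g)"
  unfolding local_rel_def
proof
  fix t assume "t \<in> f O g"
  then obtain i x j y k z where t: "t = ((i, x), (k, z))" "((i, x), (j, y)) \<in> f" "((j, y), (k, z)) \<in> g"
    by auto
  from local_rel_obtain[OF assms(1) t(2)] obtain d
    where d: "\<And>n. \<exists>p m q w. walk_to w p \<and> walk_to w q \<and>
    ((i, x), (j, y)) \<in> basic_rel i p m j q w \<and> basic_rel i p m j q w \<subseteq> f \<and> length q = d + n" by metis
  from local_rel_obtain[OF assms(2) t(3)] obtain c
    where c: "\<And>n. \<exists>p m q w. walk_to w p \<and> walk_to w q \<and>
    ((j, y), (k, z)) \<in> basic_rel j p m k q w \<and> basic_rel j p m k q w \<subseteq> g \<and> length p = c + n" by metis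
  \<comment> \<open>With these two choices both middle prefixes have length \<open>c + d\<close>. As
    prefixes of the same path \<open>y\<close> they then coincide, and \<open>basic_rel_comp\<close>
    applies.\<close>
  from d[of c] obtain p m q w where f: "walk_to w p" "walk_to w q" "basic_rel i p m j q w \<subseteq> f"
    "((i, x), (j, y)) \<in> basic_rel i p m j q w" "length q = d + c" by blast
  from c[of d] obtain q' n r w' where g: "walk_to w' q'" "walk_to w' r" "basic_rel j q' n k r w' \<subseteq> g"
    "((j, y), (k, z)) \<in> basic_rel j q' n k r w'" "length q' = c + d" by blast
  from f(4) g(4) obtain u u' where u: "u \<in> X" "s u = w" "y = q @- K m u" "u' \<in> X" "s u' = w'" "y = q' @- u'"
    by (auto simp: basic_rel_def)
  have "q = q'" "K m u = u'" using shift_eqD[of q q' "K m u" u'] u f(5) g(5) by auto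
  with u have "w' = w" by auto
  with f g \<open>q = q'\<close> have "basic_rel i p m j q w O basic_rel j q n k r w \<subseteq> f O g"
    "t \<in> basic_rel i p m j q w O basic_rel j q n k r w" unfolding t(1) by auto
  then show "\<exists>i p m j q w. walk_to w p \<and> walk_to w q \<and> t \<in> basic_rel i p m j q w \<and>
       basic_rel i p m j q w \<subseteq> f O g"
    unfolding basic_rel_comp using f(1) g(2) \<open>w' = w\<close> by blast
qed


section \<open>Cell sets and the isomorphisms between them\<close>

text \<open>
  A finite set \<open>a\<close> of pairs \<open>(i, v)\<close> stands for the disjoint union of the copies \<open>{i} \<times> X\<^sub>v\<close>.
\<close>

definition cells :: "cell_set \<Rightarrow> point set" where
  "cells a = {(i, x). x \<in> X \<and> (i, s x) \<in> a}"

definition obj :: "cell_set \<Rightarrow> bool" where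
  "obj a \<longleftrightarrow> finite a \<and> snd ` a \<subseteq> V"

text \<open>Every morphism is invertible: single-valuedness in both directions makes
  \<open>f\<close> a bijection, and \<open>local_rel\<close> is inherited by the converse.\<close>

definition mor :: "cell_set \<Rightarrow> point_rel \<Rightarrow> cell_set \<Rightarrow> bool" where
  "mor a f b \<longleftrightarrow> obj a \<and> obj b \<and> Domain f = cells a \<and> Range f = cells b \<and>
     single_valued f \<and> single_valued (f\<inverse>) \<and> local_rel f"

lemma cells_Un [simp]: "cells (a \<union> b) = cells a \<union> cells b"
  by (auto simp: cells_def)

lemma cells_disjoint: "a \<inter> b = {} \<Longrightarrow> cells a \<inter> cells b = {}"
  by (auto simp: cells_def)

lemma obj_Un [simp]: "obj (a \<union> b) \<longleftrightarrow> obj a \<and> obj b"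
  by (auto simp: obj_def)

lemma obj_subset: "obj a \<Longrightarrow> b \<subseteq> a \<Longrightarrow> obj b"
  by (auto simp: obj_def intro: finite_subset)

lemma mor_objD: "mor a f b \<Longrightarrow> obj a" "mor a f b \<Longrightarrow> obj b"
  by (auto simp: mor_def)

lemma local_rel_Id: "local_rel (Id_on (cells a))"
proof -
  have "\<exists>i p m j q w. walk_to w p \<and> walk_to w q \<and> ((k, x), (k, x)) \<in> basic_rel i p m j q w \<and>
     basic_rel i p m j q w \<subseteq> Id_on (cells a)" if "(k, x) \<in> cells a" for k x
    by (rule exI[of _ k], rule exI[of _ "[]"], rule exI[of _ 0], rule exI[of _ k],
        rule exI[of _ "[]"], rule exI[of _ "s x"])
      (use that in \<open>auto simp: basic_rel_def cells_def K_0\<close>)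
  then show ?thesis unfolding local_rel_def by (auto simp: Id_on_iff)
qed

lemma mor_Id: "obj a \<Longrightarrow> mor a (Id_on (cells a)) a"
  by (auto simp: mor_def single_valued_def local_rel_Id)

lemma mor_converse: "mor a f b \<Longrightarrow> mor b (f\<inverse>) a"
  by (auto simp: mor_def local_rel_converse)

lemma mor_comp:
  assumes "mor a f b" "mor b g c"
  shows "mor a (f O g) c"
proof -
  have "Domain (f O g) = cells a" "Range (f O g) = cells c"
    using assms unfolding mor_def by blast+
  moreover have "single_valued (f O g)" "single_valued ((f O g)\<inverse>)"
    using assms unfolding mor_def by (auto intro: single_valued_relcomp simp: converse_relcomp)
  ultimately show ?thesis using assms local_rel_comp by (auto simp: mor_def)
qed

lemma mor_Un:
  assumes "mor a f b" "mor c g d" "a \<inter> c = {}" "b \<inter> d = {}"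
  shows "mor (a \<union> c) (f \<union> g) (b \<union> d)"
  using assms cells_disjoint[OF assms(3)] cells_disjoint[OF assms(4)] unfolding mor_def
  by (simp add: local_rel_Un Domain_Un_eq Range_Un_eq converse_Un single_valued_Un)

lemma mor_Id_comp:
  assumes "mor a f b"
  shows "Id_on (cells a) O f = f" "f O Id_on (cells b) = f"
    "f O f\<inverse> = Id_on (cells a)" "f\<inverse> O f = Id_on (cells b)"
proof -
  have D: "Domain f = cells a" "Range f = cells b"
    and S: "single_valued f" "single_valued (f\<inverse>)" using assms by (auto simp: mor_def)
  show "Id_on (cells a) O f = f" "f O Id_on (cells b) = f" using D by auto
  have *: "g O g\<inverse> = Id_on (Domain g)" if "single_valued (g\<inverse>)" for g :: point_rel
    using that unfolding single_valued_def Id_on_def by blast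
  show "f O f\<inverse> = Id_on (cells a)" "f\<inverse> O f = Id_on (cells b)"
    using *[OF S(2)] *[of "f\<inverse>"] S(1) D by simp_all
qed

text \<open>The trailing \<open>g\<close> is there because \<open>O\<close> associates to the right:
  in this form the cancellation rewrites inside longer products.\<close>

lemma mor_cancel:
  assumes "mor a f b"
  shows "f O f\<inverse> O g = Id_on (cells a) O g" "f\<inverse> O f O g = Id_on (cells b) O g"
  using mor_Id_comp(3,4)[OF assms] by (metis O_assoc)+

section \<open>Relabellings of cells\<close>

definition relabel_rel :: "(nat \<times> nat \<Rightarrow> nat \<times> nat) \<Rightarrow> cell_set \<Rightarrow> point_rel" where
  "relabel_rel h a = {((i, x), (fst (h (i, s x)), x)) | i x. (i, x) \<in> cells a}"

text \<open>Cells with different vertices may share a label, so \<open>h\<close> has to act on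
  pairs. It keeps the vertex, and therefore only its first component enters
  \<open>relabel_rel\<close>.\<close>

definition relabelling :: "cell_set \<Rightarrow> point_rel \<Rightarrow> cell_set \<Rightarrow> bool" where
  "relabelling a f b \<longleftrightarrow>
     (\<exists>h. bij_betw h a b \<and> (\<forall>p \<in> a. snd (h p) = snd p) \<and> f = relabel_rel h a)"

lemma relabel_rel_cong: "(\<And>p. p \<in> a \<Longrightarrow> h p = h' p) \<Longrightarrow> relabel_rel h a = relabel_rel h' a"
  by (force simp: relabel_rel_def cells_def)

lemma relabelling_converse:
  assumes "relabelling a f b" shows "relabelling b (f\<inverse>) a"
proof -
  from assms obtain h where h: "bij_betw h a b" "\<And>p. p \<in> a \<Longrightarrow> snd (h p) = snd p" "f = relabel_rel h a"
    by (auto simp: relabelling_def)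
  let ?g = "the_inv_into a h"
  have g: "bij_betw ?g b a" using h(1) by (rule bij_betw_the_inv_into)
  have inj: "inj_on h a" and im: "h ` a = b" using h(1) by (auto simp: bij_betw_def)
  have gh: "?g (h p) = p" if "p \<in> a" for p using the_inv_into_f_f[OF inj that] .
  have snd: "\<forall>p \<in> b. snd (?g p) = snd p" using im gh h(2) by auto
  have "f\<inverse> = relabel_rel ?g b"
  proof (intro equalityI subsetI)
    fix t assume "t \<in> f\<inverse>"
    then obtain i x where t: "t = ((fst (h (i, s x)), x), (i, x))" "x \<in> X" "(i, s x) \<in> a"
      by (auto simp: h(3) relabel_rel_def cells_def)
    have "(fst (h (i, s x)), s x) = h (i, s x)" using h(2)[OF t(3)] by (simp add: prod_eq_iff)
    then have "(fst (h (i, s x)), s x) \<in> b" "?g (fst (h (i, s x)), s x) = (i, s x)"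
      using im gh[OF t(3)] t(3) by auto
    with t show "t \<in> relabel_rel ?g b" by (force simp: relabel_rel_def cells_def)
  next
    fix t assume "t \<in> relabel_rel ?g b"
    then obtain i x where t: "t = ((i, x), (fst (?g (i, s x)), x))" "x \<in> X" "(i, s x) \<in> b"
      by (auto simp: relabel_rel_def cells_def)
    from t(3) obtain p where p: "p \<in> a" "h p = (i, s x)" using im by auto
    with h(2)[OF p(1)] have "p = (fst p, s x)" by (simp add: prod_eq_iff)
    with p t gh[OF p(1)] show "t \<in> f\<inverse>"
      by (auto simp: h(3) relabel_rel_def cells_def intro!: exI[of _ "fst p"])
  qed
  with g snd show ?thesis unfolding relabelling_def by blast
qed

lemma relabelling_comp:
  assumes "relabelling a f b" "relabelling b g c" shows "relabelling a (f O g) c"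
proof -
  from assms(1) obtain h where h: "bij_betw h a b" "\<And>p. p \<in> a \<Longrightarrow> snd (h p) = snd p" "f = relabel_rel h a"
    by (auto simp: relabelling_def)
  from assms(2) obtain k where k: "bij_betw k b c" "\<And>p. p \<in> b \<Longrightarrow> snd (k p) = snd p" "g = relabel_rel k b"
    by (auto simp: relabelling_def)
  have hb: "h p \<in> b" if "p \<in> a" for p using h(1) that by (auto simp: bij_betw_def)
  have pair: "(fst (h (i, v)), v) = h (i, v)" if "(i, v) \<in> a" for i v
    using h(2)[OF that] by (simp add: prod_eq_iff)
  have "f O g = relabel_rel (k \<circ> h) a"
  proof (intro equalityI subsetI)
    fix t assume "t \<in> f O g"
    then show "t \<in> relabel_rel (k \<circ> h) a"
      by (auto simp: h(3) k(3) relabel_rel_def cells_def pair)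
  next
    fix t assume "t \<in> relabel_rel (k \<circ> h) a"
    then obtain i x where t: "t = ((i, x), (fst (k (h (i, s x))), x))" "x \<in> X" "(i, s x) \<in> a"
      by (auto simp: relabel_rel_def cells_def)
    then have "((i, x), (fst (h (i, s x)), x)) \<in> f"
      "((fst (h (i, s x)), x), (fst (k (h (i, s x))), x)) \<in> g"
      using hb[OF t(3)] pair[OF t(3)] by (auto simp: h(3) k(3) relabel_rel_def cells_def)
    with t(1) show "t \<in> f O g" by auto
  qed
  moreover have "bij_betw (k \<circ> h) a c" using bij_betw_trans[OF h(1) k(1)] .
  moreover have "\<forall>p \<in> a. snd ((k \<circ> h) p) = snd p" using h(2) k(2) hb by simp
  ultimately show ?thesis unfolding relabelling_def by blast
qed

lemma relabelling_Id: "relabelling a (Id_on (cells a)) a"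
  unfolding relabelling_def
  by (rule exI[of _ id]) (auto simp: relabel_rel_def cells_def Id_on_def)

lemma relabelling_Un:
  assumes "relabelling a f b" "relabelling c g d" "a \<inter> c = {}" "b \<inter> d = {}"
  shows "relabelling (a \<union> c) (f \<union> g) (b \<union> d)"
proof -
  from assms(1) obtain h where h: "bij_betw h a b" "\<And>p. p \<in> a \<Longrightarrow> snd (h p) = snd p" "f = relabel_rel h a"
    by (auto simp: relabelling_def)
  from assms(2) obtain k where k: "bij_betw k c d" "\<And>p. p \<in> c \<Longrightarrow> snd (k p) = snd p" "g = relabel_rel k c"
    by (auto simp: relabelling_def)
  let ?l = "\<lambda>p. if p \<in> a then h p else k p"
  have c: "p \<notin> a" if "p \<in> c" for p using assms(3) that by blast
  have "bij_betw ?l a b" using h(1) by (rule bij_betw_cong[THEN iffD1, rotated]) simp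
  moreover have "bij_betw ?l c d" using k(1) by (rule bij_betw_cong[THEN iffD1, rotated]) (simp add: c)
  ultimately have "bij_betw ?l (a \<union> c) (b \<union> d)" using assms(4) by (rule bij_betw_combine)
  moreover have "\<forall>p \<in> a \<union> c. snd (?l p) = snd p" using h(2) k(2) by auto
  moreover have "relabel_rel ?l (a \<union> c) = relabel_rel ?l a \<union> relabel_rel ?l c"
    by (auto simp: relabel_rel_def)
  moreover have "relabel_rel ?l a = f" unfolding h(3) by (rule relabel_rel_cong) simp
  moreover have "relabel_rel ?l c = g" unfolding k(3) by (rule relabel_rel_cong) (simp add: c)
  ultimately show ?thesis unfolding relabelling_def by (intro exI[of _ ?l]) simp
qed

lemma relabelling_split:
  assumes "relabelling (a \<union> c) f e" "a \<inter> c = {}"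
  obtains b d g h where "relabelling a g b" "relabelling c h d" "b \<inter> d = {}" "e = b \<union> d" "f = g \<union> h"
proof -
  from assms(1) obtain h where h: "bij_betw h (a \<union> c) e" "\<And>p. p \<in> a \<union> c \<Longrightarrow> snd (h p) = snd p"
    "f = relabel_rel h (a \<union> c)" by (auto simp: relabelling_def)
  have inj: "inj_on h (a \<union> c)" and im: "h ` (a \<union> c) = e" using h(1) by (auto simp: bij_betw_def)
  show thesis
  proof (rule that)
    show "relabelling a (relabel_rel h a) (h ` a)" "relabelling c (relabel_rel h c) (h ` c)"
      using h(2) inj_on_subset[OF inj] unfolding relabelling_def by (auto simp: bij_betw_def intro!: exI[of _ h])
    show "h ` a \<inter> h ` c = {}" using inj_on_image_Int[OF inj, of a c] assms(2) by simp
    show "e = h ` a \<union> h ` c" using im by auto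
    show "f = relabel_rel h a \<union> relabel_rel h c" unfolding h(3) by (auto simp: relabel_rel_def)
  qed
qed

lemma relabelling_mor:
  assumes "relabelling a f b" "obj a" shows "mor a f b"
proof -
  \<comment> \<open>These properties involve one direction only; applied to the converse as well,
    they yield the range and the injectivity of \<open>f\<close>.\<close>
  have *: "Domain f = cells a \<and> single_valued f \<and> local_rel f \<and> snd ` b = snd ` a \<and> (finite a \<longrightarrow> finite b)"
    if "relabelling a f b" for a f b
  proof -
    from that obtain h where h: "bij_betw h a b" "\<And>p. p \<in> a \<Longrightarrow> snd (h p) = snd p"
      "f = relabel_rel h a" by (auto simp: relabelling_def)
    have "Domain f = cells a" "single_valued f"
      unfolding h(3) by (auto simp: relabel_rel_def single_valued_def)
    moreover have "\<exists>i p m j q w. walk_to w p \<and> walk_to w q \<and> t \<in> basic_rel i p m j q w \<and>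
     basic_rel i p m j q w \<subseteq> f" if "t \<in> f" for t
    proof -
      from that obtain i x where "(i, x) \<in> cells a" "t = ((i, x), (fst (h (i, s x)), x))"
        by (auto simp: h(3) relabel_rel_def)
      then have "t \<in> basic_rel i [] 0 (fst (h (i, s x))) [] (s x)"
        "basic_rel i [] 0 (fst (h (i, s x))) [] (s x) \<subseteq> f"
        unfolding h(3) by (auto simp: basic_rel_def relabel_rel_def cells_def K_0)
      then show ?thesis by (metis walk_to_Nil)
    qed
    then have "local_rel f" unfolding local_rel_def by blast
    moreover have "snd ` b = snd ` a"
    proof -
      have "snd ` b = (\<lambda>p. snd (h p)) ` a" using h(1) by (auto simp: bij_betw_def image_image)
      also have "\<dots> = snd ` a" using h(2) by (rule image_cong[OF refl])
      finally show ?thesis .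
    qed
    moreover have "finite a \<longrightarrow> finite b" using h(1) by (auto simp: bij_betw_def)
    ultimately show ?thesis by blast
  qed
  from *[OF assms(1)] *[OF relabelling_converse[OF assms(1)]] assms(2) show ?thesis
    by (auto simp: mor_def obj_def)
qed

lemma relabelling_obj: "relabelling a f b \<Longrightarrow> obj b \<longleftrightarrow> obj a"
  using relabelling_mor relabelling_converse by (metis mor_objD(2))

lemma relabelling_card: "relabelling a f b \<Longrightarrow> card b = card a"
  unfolding relabelling_def by (metis bij_betw_same_card)

lemma finite_relabellings:
  assumes "finite a" "finite b"
  shows "finite {f. relabelling a f b}"
proof (rule finite_subset)
  show "{f. relabelling a f b} \<subseteq> (\<lambda>h. relabel_rel h a) ` (a \<rightarrow>\<^sub>E b)"
  proof
    fix f assume "f \<in> {f. relabelling a f b}"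
    then obtain h where h: "bij_betw h a b" "f = relabel_rel h a" by (auto simp: relabelling_def)
    then have "f = relabel_rel (restrict h a) a" "restrict h a \<in> a \<rightarrow>\<^sub>E b"
      by (auto intro!: relabel_rel_cong simp: bij_betw_def)
    then show "f \<in> (\<lambda>h. relabel_rel h a) ` (a \<rightarrow>\<^sub>E b)" by blast
  qed
qed (use assms in \<open>auto intro: finite_PiE\<close>)

section \<open>Types: cell sets up to relabelling\<close>

definition type :: "cell_set \<Rightarrow> nat multiset" where
  "type a = image_mset snd (mset_set a)"

lemma type_Un: "finite a \<Longrightarrow> finite b \<Longrightarrow> a \<inter> b = {} \<Longrightarrow> type (a \<union> b) = type a + type b"
  by (simp add: type_def mset_set_Union)

lemma size_type [simp]: "size (type a) = card a"
  by (simp add: type_def)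

lemma set_type: "finite a \<Longrightarrow> set_mset (type a) = snd ` a"
  by (simp add: type_def)

lemma type_empty [simp]: "type {} = {#}"
  by (simp add: type_def)

lemma type_insert: "finite a \<Longrightarrow> p \<notin> a \<Longrightarrow> type (insert p a) = add_mset (snd p) (type a)"
  by (simp add: type_def)

lemma relabelling_type:
  assumes "relabelling a f b" shows "type b = type a"
proof -
  from assms obtain h where h: "bij_betw h a b" "\<And>p. p \<in> a \<Longrightarrow> snd (h p) = snd p"
    by (auto simp: relabelling_def)
  then have "mset_set b = image_mset h (mset_set a)"
    by (auto simp: bij_betw_def image_mset_mset_set)
  then have "type b = image_mset (snd \<circ> h) (mset_set a)"
    by (simp add: type_def multiset.map_comp)
  also have "\<dots> = type a" unfolding type_def
  proof (rule image_mset_cong)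
    fix p assume "p \<in># mset_set a"
    then have "p \<in> a" by (cases "finite a") auto
    then show "(snd \<circ> h) p = snd p" using h(2) by simp
  qed
  finally show ?thesis .
qed

text \<open>The cells are matched one by one. With \<open>relabelling_type\<close> this makes the
  type a complete invariant of finite cell sets up to relabelling.\<close>

lemma relabelling_exists:
  assumes "finite a" "finite b" "type a = type b"
  shows "\<exists>f. relabelling a f b"
  using assms
proof (induction arbitrary: b rule: finite_induct)
  case empty
  then have "b = {}" by (metis size_type card_0_eq card.empty)
  then show ?case using relabelling_Id by metis
next
  case (insert p a)
  have "snd p \<in> snd ` b" using insert.prems insert.hyps
    by (metis set_type type_insert union_single_eq_member)
  then obtain q where q: "q \<in> b" "snd q = snd p" by auto
  then have b: "b = insert q (b - {q})" by auto
  have "type a = type (b - {q})"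
    using insert.prems insert.hyps type_insert[of "b - {q}" q] q b by (simp add: type_insert)
  with insert obtain f where f: "relabelling a f (b - {q})" by blast
  have "relabelling {p} (relabel_rel (\<lambda>_. q) {p}) {q}" unfolding relabelling_def
    by (rule exI[of _ "\<lambda>_. q"]) (auto simp: q bij_betw_def)
  from relabelling_Un[OF this f] insert.hyps b show ?case by auto
qed

lemma fresh_copy:
  assumes "finite a" "finite F"
  obtains b f where "relabelling a f b" "b \<inter> F = {}"
proof -
  \<comment> \<open>Shifting all labels beyond the largest label in \<open>F\<close> avoids
    \<open>F\<close>; \<open>insert 0\<close> keeps the maximum defined when \<open>F\<close> is
    empty.\<close>
  define n where "n = Suc (Max (insert 0 (fst ` F)))"
  define h where "h = (\<lambda>p::nat \<times> nat. (fst p + n, snd p))"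
  have "inj_on h a" by (auto simp: h_def inj_on_def prod_eq_iff)
  then have "relabelling a (relabel_rel h a) (h ` a)" unfolding relabelling_def
    by (intro exI[of _ h]) (auto simp: bij_betw_def h_def)
  moreover have "fst p < n" if "p \<in> F" for p
    using that assms(2) by (auto simp: n_def less_Suc_eq_le intro!: Max_ge)
  then have "h ` a \<inter> F = {}" by (fastforce simp: h_def)
  ultimately show thesis using that by blast
qed

lemma realize_type:
  assumes "finite F"
  obtains a where "finite a" "type a = t" "a \<inter> F = {}"
proof -
  have "\<exists>a. finite a \<and> type a = t"
  proof (induction t)
    case empty then show ?case by (metis finite.emptyI type_empty)
  next
    case (add v t)
    then obtain a where a: "finite a" "type a = t" by blast
    obtain i where "i \<notin> fst ` a" using a(1) ex_new_if_finite[of "fst ` a"] infinite_UNIV_nat by blast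
    then have "type (insert (i, v) a) = add_mset v t"
      using a type_insert[of a "(i, v)"] by force
    with a show ?case by (metis finite_insert)
  qed
  then obtain a where a: "finite a" "type a = t" by blast
  from fresh_copy[OF this(1) assms] obtain b f where "relabelling a f b" "b \<inter> F = {}" .
  with a show thesis using that relabelling_type
    by (metis relabelling_def bij_betw_finite)
qed

text \<open>One pair of representatives is enough, because \<open>iso_mor\<close> passes to any
  other pair by relabelling.\<close>

definition type_iso :: "nat multiset \<Rightarrow> nat multiset \<Rightarrow> bool" where
  "type_iso t u \<longleftrightarrow> (\<exists>a f b. mor a f b \<and> type a = t \<and> type b = u)"

lemma iso_mor:
  assumes "type_iso (type a) (type b)" "obj a" "obj b"
  obtains f where "mor a f b"
proof -
  from assms(1) obtain a' f b' where f: "mor a' f b'" "type a' = type a" "type b' = type b"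
    unfolding type_iso_def by blast
  have "finite a'" "finite b'" "finite a" "finite b" using assms f by (auto simp: mor_def obj_def)
  with f obtain g h where "relabelling a g a'" "relabelling b' h b"
    using relabelling_exists by metis
  then show thesis using that relabelling_mor mor_comp f(1) assms(2) mor_objD by metis
qed

lemma iso_set: "type_iso t u \<Longrightarrow> set_mset t \<subseteq> V" "type_iso t u \<Longrightarrow> set_mset u \<subseteq> V"
  by (auto simp: type_iso_def mor_def obj_def set_type)

lemma obj_iff_type: "finite a \<Longrightarrow> obj a \<longleftrightarrow> set_mset (type a) \<subseteq> V"
  by (simp add: obj_def set_type)

lemma iso_refl:
  assumes "set_mset t \<subseteq> V" shows "type_iso t t"
proof -
  obtain a where "finite a" "type a = t" "a \<inter> {} = {}" using realize_type by blast
  with assms show ?thesis unfolding type_iso_def using mor_Id obj_iff_type by blast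
qed

lemma iso_sym: "type_iso t u \<Longrightarrow> type_iso u t"
  unfolding type_iso_def using mor_converse by blast

lemma iso_trans:
  assumes "type_iso t u" "type_iso u v" shows "type_iso t v"
proof -
  from assms obtain a f b c where f: "mor a f b" "type a = t" "type b = u" "type c = v" "obj c"
    unfolding type_iso_def by (metis mor_objD(2))
  with assms(2) iso_mor obtain g where "mor b g c" by (metis mor_objD(2))
  with f show ?thesis unfolding type_iso_def using mor_comp by blast
qed

text \<open>The second isomorphism is realised on cells disjoint from those of the first. Hence sums
  of types descend to a commutative monoid of isomorphism classes.\<close>

lemma iso_add:
  assumes "type_iso t u" "type_iso t' u'" shows "type_iso (t + t') (u + u')"
proof -
  from assms(1) obtain a f b where f: "mor a f b" "type a = t" "type b = u" by (auto simp: type_iso_def)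
  then have fin: "finite a" "finite b" by (auto simp: mor_def obj_def)
  obtain c where c: "finite c" "type c = t'" "c \<inter> a = {}" using realize_type[OF fin(1)] by blast
  obtain d where d: "finite d" "type d = u'" "d \<inter> b = {}" using realize_type[OF fin(2)] by blast
  have "obj c" "obj d" using iso_set[OF assms(2)] c d obj_iff_type by auto
  with assms(2) iso_mor c d obtain g where "mor c g d" by metis
  then have "mor (a \<union> c) (f \<union> g) (b \<union> d)" using f c d by (intro mor_Un) auto
  moreover have "type (a \<union> c) = t + t'" "type (b \<union> d) = u + u'"
    using f c d fin type_Un by (simp_all add: Int_commute)
  ultimately show ?thesis unfolding type_iso_def by blast
qed


section \<open>Isomorphism types and reducibility\<close>

definition out_arcs_of :: "nat \<Rightarrow> edge set" where
  "out_arcs_of v = {e \<in> E. tl_of e = v}"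

text \<open>Labelling by the code \<open>to_nat e\<close> keeps parallel edges apart, whose heads
  are the same vertex.\<close>

definition expand_rel :: "nat \<Rightarrow> point_rel" where
  "expand_rel v = {((0, e ## y), (to_nat e, y)) | e y. e ## y \<in> X \<and> tl_of e = v}"

definition expand_cells :: "nat \<Rightarrow> cell_set" where
  "expand_cells v = (\<lambda>e. (to_nat e, hd_of e)) ` out_arcs_of v"

lemma finite_out_arcs [simp]: "finite (out_arcs_of v)"
  using finite_arcs by (simp add: out_arcs_of_def)

lemma expand_cells_iff: "(k, w) \<in> expand_cells v \<longleftrightarrow> (\<exists>e \<in> E. tl_of e = v \<and> k = to_nat e \<and> w = hd_of e)"
  unfolding expand_cells_def out_arcs_of_def by blast

lemma expand_relE:
  assumes "t \<in> expand_rel v"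
  obtains e y where "t = ((0, e ## y), (to_nat e, y))" "e ## y \<in> X" "tl_of e = v"
    "e \<in> E" "y \<in> X" "s y = hd_of e"
proof -
  from assms obtain e y where "t = ((0, e ## y), (to_nat e, y))" "e ## y \<in> X" "tl_of e = v"
    unfolding expand_rel_def by blast
  moreover from this have "e \<in> E" "y \<in> X" "s y = hd_of e"
    unfolding infinite_paths_SCons by simp_all
  ultimately show thesis by (rule that)
qed

lemma expand_mor:
  assumes "v \<in> V" shows "mor {(0, v)} (expand_rel v) (expand_cells v)"
proof -
  have in_rel: "((0, e ## y), (to_nat e, y)) \<in> expand_rel v" if "e ## y \<in> X" "tl_of e = v" for e y
    using that unfolding expand_rel_def by blast
  have "finite (expand_cells v)" unfolding expand_cells_def by simp
  moreover have "snd ` expand_cells v \<subseteq> V"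
    using arc_ends(2) by (force simp only: expand_cells_iff image_iff snd_conv)
  ultimately have "obj (expand_cells v)" by (simp add: obj_def)
  moreover have "Domain (expand_rel v) = cells {(0, v)}"
  proof (intro equalityI subsetI)
    fix t assume "t \<in> cells {(0, v)}"
    then obtain x where x: "t = (0, x)" "x \<in> X" "s x = v" by (auto simp: cells_def)
    moreover obtain e y where "x = e ## y" by (cases x)
    ultimately show "t \<in> Domain (expand_rel v)" using in_rel[of e y] by auto
  next
    fix t assume "t \<in> Domain (expand_rel v)"
    then obtain u where "(t, u) \<in> expand_rel v" by blast
    then show "t \<in> cells {(0, v)}" by (rule expand_relE) (simp add: cells_def)
  qed
  moreover have "Range (expand_rel v) = cells (expand_cells v)"
  proof (intro equalityI subsetI)
    fix t assume "t \<in> cells (expand_cells v)"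
    then obtain k y where y: "t = (k, y)" "y \<in> X" "(k, s y) \<in> expand_cells v" by (auto simp: cells_def)
    then obtain e where e: "e \<in> E" "tl_of e = v" "k = to_nat e" "s y = hd_of e"
      unfolding expand_cells_iff by blast
    with y have "((0, e ## y), t) \<in> expand_rel v" using in_rel by (simp add: infinite_paths_SCons)
    then show "t \<in> Range (expand_rel v)" by blast
  next
    fix t assume "t \<in> Range (expand_rel v)"
    then obtain u where "(u, t) \<in> expand_rel v" by blast
    then show "t \<in> cells (expand_cells v)"
    proof (rule expand_relE)
      fix e y assume "(u, t) = ((0, e ## y), to_nat e, y)" "tl_of e = v" "e \<in> E" "y \<in> X" "s y = hd_of e"
      then show ?thesis by (auto simp only: cells_def expand_cells_iff mem_Collect_eq prod.case Pair_inject)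
    qed
  qed
  moreover have "single_valued (expand_rel v)" "single_valued ((expand_rel v)\<inverse>)"
    unfolding single_valued_def converse_iff by (intro allI impI; elim expand_relE; simp)+
  moreover have "local_rel (expand_rel v)"
    unfolding local_rel_def
  proof
    fix t assume "t \<in> expand_rel v"
    then obtain e y where e: "t = ((0, e ## y), (to_nat e, y))" "tl_of e = v" "e \<in> E" "y \<in> X" "s y = hd_of e"
      by (rule expand_relE)
    then have "walk_to (hd_of e) [e]" by (simp add: walk_to_def infinite_paths_SCons)
    moreover have "t \<in> basic_rel 0 [e] 0 (to_nat e) [] (hd_of e)"
      unfolding e(1) basic_rel_def using e K_0[OF e(4)] by simp
    moreover have "basic_rel 0 [e] 0 (to_nat e) [] (hd_of e) \<subseteq> expand_rel v"
    proof
      fix u assume "u \<in> basic_rel 0 [e] 0 (to_nat e) [] (hd_of e)"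
      then obtain z where z: "u = ((0, e ## z), (to_nat e, K 0 z))" "z \<in> X" "s z = hd_of e"
        unfolding basic_rel_def by auto
      then show "u \<in> expand_rel v" using in_rel[of e z] e by (simp add: infinite_paths_SCons K_0)
    qed
    ultimately show "\<exists>i p m j q w. walk_to w p \<and> walk_to w q \<and> t \<in> basic_rel i p m j q w \<and>
       basic_rel i p m j q w \<subseteq> expand_rel v" using walk_to_Nil by blast
  qed
  ultimately show ?thesis using assms by (simp add: mor_def) (simp add: obj_def)
qed

definition out_type :: "nat \<Rightarrow> nat multiset" where
  "out_type v = image_mset hd_of (mset_set (out_arcs_of v))"

lemma type_expand_cells: "type (expand_cells v) = out_type v"
proof -
  have "inj_on (\<lambda>e. (to_nat e, hd_of e)) (out_arcs_of v)" by (auto simp: inj_on_def)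
  then have "mset_set (expand_cells v) = image_mset (\<lambda>e. (to_nat e, hd_of e)) (mset_set (out_arcs_of v))"
    unfolding expand_cells_def by (rule image_mset_mset_set[symmetric])
  then show ?thesis by (simp add: type_def out_type_def multiset.map_comp comp_def)
qed

lemma iso_out_type: "v \<in> V \<Longrightarrow> type_iso {#v#} (out_type v)"
  unfolding type_iso_def using expand_mor[of v] type_expand_cells[of v]
  by (intro exI[of _ "{(0, v)}"]) (auto simp: type_def)

text \<open>The algebraic preorder of the monoid of types modulo isomorphism.\<close>

definition covers :: "nat multiset \<Rightarrow> nat multiset \<Rightarrow> bool" where
  "covers t u \<longleftrightarrow> (\<exists>x. type_iso t (u + x))"

lemma covers_refl: "set_mset t \<subseteq> V \<Longrightarrow> covers t t"
  unfolding covers_def using iso_refl by (metis add.right_neutral)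

lemma covers_add:
  assumes "covers t u" "covers t' u'" shows "covers (t + t') (u + u')"
proof -
  from assms obtain x x' where "type_iso t (u + x)" "type_iso t' (u' + x')" by (auto simp: covers_def)
  from iso_add[OF this] show ?thesis unfolding covers_def
    by (intro exI[of _ "x + x'"]) (simp add: ac_simps)
qed

lemma covers_trans:
  assumes "covers t u" "covers u v" shows "covers t v"
proof -
  from assms obtain x y where xy: "type_iso t (u + x)" "type_iso u (v + y)" by (auto simp: covers_def)
  moreover have "type_iso (u + x) (v + y + x)"
    using iso_add[OF xy(2) iso_refl[of x]] iso_set(2)[OF xy(1)] by simp
  ultimately have "type_iso t (v + (y + x))" using iso_trans[of t "u + x" "v + y + x"] by (simp add: add.assoc)
  then show ?thesis unfolding covers_def by blast
qed

lemma covers_arc: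
  assumes "e \<in> E" shows "covers {#tl_of e#} {#hd_of e#}"
proof -
  have "hd_of e \<in># out_type (tl_of e)"
    using assms by (auto simp: out_type_def out_arcs_of_def finite_arcs)
  then have "{#hd_of e#} + (out_type (tl_of e) - {#hd_of e#}) = out_type (tl_of e)" by simp
  then show ?thesis unfolding covers_def using iso_out_type arc_ends(1)[OF assms] by metis
qed

sublocale wf_digraph "matrix_graph N A"
  by unfold_locales (auto simp: matrix_graph_def)

text \<open>Strong connectivity supplies a walk from \<open>u\<close> to \<open>v\<close>, and
  expanding at each of its edges splits off the head as a summand.\<close>

lemma covers_vertex:
  assumes "u \<in> V" "v \<in> V" shows "covers {#u#} {#v#}"
proof -
  have "u \<rightarrow>\<^sup>*\<^bsub>matrix_graph N A\<^esub> v" using connected assms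
    by (auto simp: strongly_connected_def matrix_graph_def)
  then obtain p where "awalk u p v" using reachable_awalk by blast
  then show ?thesis
  proof (induction p arbitrary: u)
    case Nil
    then have "u = v \<and> u \<in> verts (matrix_graph N A)" unfolding awalk_Nil_iff .
    then have "u = v" "u \<in> V" by (simp_all add: matrix_graph_def)
    then show ?case using covers_refl[of "{#v#}"] by simp
  next
    case (Cons e p)
    then have e: "e \<in> E" "u = tl_of e" "awalk (hd_of e) p v" by (auto simp: awalk_Cons_iff)
    show ?case unfolding e(2) by (rule covers_trans[OF covers_arc[OF e(1)] Cons.IH[OF e(3)]])
  qed
qed

section \<open>Reducible types and the size of the minimal ones\<close>

definition reducible :: "nat multiset \<Rightarrow> bool" where
  "reducible t \<longleftrightarrow> (\<exists>u. type_iso t u \<and> size u < size t)"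

lemma reducible_set: "reducible t \<Longrightarrow> set_mset t \<subseteq> V"
  unfolding reducible_def using iso_set by blast

lemma reducible_bound:
  obtains L where "\<And>t. reducible t \<Longrightarrow> \<exists>c. c \<subseteq># t \<and> reducible c \<and> size c \<le> L"
proof -
  have "\<exists>L. \<forall>t. reducible t \<longrightarrow> (\<exists>c. c \<subseteq># t \<and> reducible c \<and> size c \<le> L)"
  proof (rule ccontr)
    assume "\<not> ?thesis"
    \<comment> \<open>\<open>f n\<close> is reducible, but none of its reducible sub-multisets has
      at most \<open>n\<close> elements.\<close>
    then obtain f where f: "\<And>n. reducible (f n)" "\<And>n c. c \<subseteq># f n \<Longrightarrow> reducible c \<Longrightarrow> n < size c"
      by (metis not_le)
    have "set_mset (f n) \<subseteq> V" for n using reducible_set f(1) .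
    then obtain r :: "nat \<Rightarrow> nat" where r: "strict_mono r" "\<And>m n. m \<le> n \<Longrightarrow> f (r m) \<subseteq># f (r n)"
      using dickson_multiset[of V f] by blast
    \<comment> \<open>Along the subsequence \<open>f (r 0)\<close> itself is a reducible
      sub-multiset of every \<open>f (r n)\<close>. For \<open>n\<close> equal to its size this
      forces \<open>r n < n\<close>, which a strictly increasing \<open>r\<close> excludes.\<close>
    let ?n = "size (f (r 0))"
    have "r ?n < ?n" by (rule f(2)[OF r(2) f(1)]) simp
    with strict_mono_imp_increasing[OF r(1), of ?n] show False by simp
  qed
  with that show thesis by blast
qed

section \<open>Absorption and cancellation in the branching case\<close>

definition branching :: bool where
  "branching \<longleftrightarrow> (\<exists>e \<in> E. \<exists>e' \<in> E. e \<noteq> e' \<and> tl_of e = tl_of e')"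

text \<open>A branching vertex splits off two vertices. By connectivity one of them covers the next
  vertex wanted for \<open>b\<close> and the other covers the branching vertex again, so the process
  can be repeated until \<open>b\<close> is exhausted.\<close>

lemma covers_all:
  assumes "branching" "v \<in> V" "set_mset b \<subseteq> V"
  shows "covers {#v#} b"
proof -
  from assms(1) obtain e e' where e: "e \<in> E" "e' \<in> E" "e \<noteq> e'" "tl_of e = tl_of e'"
    unfolding branching_def by blast
  let ?u = "tl_of e"
  have u: "?u \<in> V" using arc_ends e by blast
  \<comment> \<open>The two edges must be counted in the multiset, since their heads may
    coincide.\<close>
  have "mset_set {e, e'} \<subseteq># mset_set (out_arcs_of ?u)"
    using e by (intro subset_imp_msubset_mset_set) (simp_all add: out_arcs_of_def finite_arcs)
  then have "{#e, e'#} \<subseteq># mset_set (out_arcs_of ?u)" using e(3) by simp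
  then have "{#hd_of e#} + {#hd_of e'#} \<subseteq># out_type ?u"
    using image_mset_subseteq_mono[of "{#e, e'#}" _ hd_of] by (simp add: out_type_def add_mset_commute)
  then obtain x where "out_type ?u = {#hd_of e#} + {#hd_of e'#} + x"
    by (metis subset_mset.le_iff_add)
  then have two: "covers {#?u#} ({#hd_of e#} + {#hd_of e'#})"
    using iso_out_type[OF u] unfolding covers_def by metis
  have "covers {#?u#} b" using assms(3)
  proof (induction b)
    case empty
    then show ?case using iso_refl[of "{#?u#}"] u unfolding covers_def by auto
  next
    case (add w b)
    then have "covers ({#hd_of e#} + {#hd_of e'#}) ({#w#} + {#?u#})"
      using arc_ends e u by (intro covers_add covers_vertex) auto
    moreover have "covers ({#w#} + {#?u#}) ({#w#} + b)"
      using add by (intro covers_add covers_refl) auto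
    ultimately have "covers {#?u#} ({#w#} + b)" using two covers_trans by blast
    then show ?case by simp
  qed
  then show ?thesis by (rule covers_trans[OF covers_vertex[OF assms(2) u]])
qed

text \<open>A single vertex \<open>v\<close> of \<open>d\<close> does it: \<open>v\<close> covers
  itself together with all of \<open>b\<close>, while the other vertices of \<open>d\<close>
  stay.\<close>

lemma iso_absorb:
  assumes "branching" "v \<in># d" "set_mset d \<subseteq> V" "set_mset b \<subseteq> V"
  obtains y where "type_iso d (d + b + y)"
proof -
  have "covers {#v#} ({#v#} + b)" using assms by (intro covers_all) auto
  moreover have "covers (d - {#v#}) (d - {#v#})"
    using assms(3) by (intro covers_refl) (meson in_diffD subset_iff)
  ultimately have "covers ({#v#} + (d - {#v#})) ({#v#} + b + (d - {#v#}))" by (rule covers_add)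
  moreover have "{#v#} + (d - {#v#}) = d" "{#v#} + b + (d - {#v#}) = d + b"
    using assms(2) by (simp_all add: multiset_eq_iff not_in_iff)
  ultimately show thesis using that unfolding covers_def by metis
qed

text \<open>Behind this is that the nonempty types modulo isomorphism form a group.\<close>

lemma iso_cancel:
  assumes "branching" "type_iso t (d + b)" "type_iso t (d' + b)" "d \<noteq> {#}" "d' \<noteq> {#}"
  shows "type_iso d d'"
proof -
  have V: "set_mset d \<subseteq> V" "set_mset d' \<subseteq> V" "set_mset b \<subseteq> V"
    using iso_set(2)[OF assms(2)] iso_set(2)[OF assms(3)] by auto
  obtain v v' where v: "v \<in># d" "v' \<in># d'" using assms(4,5) by blast
  \<comment> \<open>Adding \<open>b + y\<close> does not change the class of \<open>d\<close>. Since
    \<open>d'\<close> absorbs \<open>d\<close> by the choice of \<open>z\<close>, it does not change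
    the class of \<open>d'\<close> either. So adding \<open>y\<close> undoes adding \<open>b\<close>
    on both sides.\<close>
  obtain y where y: "type_iso d (d + b + y)"
    by (rule iso_absorb[OF assms(1) v(1) V(1) V(3)])
  obtain z where z: "type_iso d' (d' + d + z)"
    by (rule iso_absorb[OF assms(1) v(2) V(2) V(1)])
  have "type_iso (d' + d + z) ((d' + z) + (d + b + y))"
    using iso_add[OF iso_refl[of "d' + z"] y] iso_set(2)[OF z] by (simp add: ac_simps)
  moreover have "type_iso ((d' + d + z) + (b + y)) (d' + (b + y))"
    using iso_add[OF iso_sym[OF z] iso_refl[of "b + y"]] iso_set(2)[OF y] by simp
  moreover have "(d' + z) + (d + b + y) = (d' + d + z) + (b + y)" by (simp add: ac_simps)
  ultimately have "type_iso (d' + d + z) (d' + (b + y))" using iso_trans by metis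
  with z have "type_iso d' (d' + (b + y))" using iso_trans by blast
  then have d': "type_iso d' (d' + b + y)" by (simp add: ac_simps)
  have "type_iso (d + b) (d' + b)" using assms(2,3) iso_sym iso_trans by blast
  then have "type_iso (d + b + y) (d' + b + y)"
    using iso_add[OF _ iso_refl[of y]] iso_set(2)[OF y] by simp
  with y d' show ?thesis using iso_sym iso_trans by blast
qed

text \<open>For fixed \<open>b\<close>, cancellation makes all nonempty complements \<open>d\<close>
  of \<open>b\<close> in types isomorphic to \<open>t\<close> isomorphic to each other. Any of them
  larger than a fixed one is therefore reducible.\<close>

lemma reducible_avoiding:
  assumes "branching"
  obtains R where
    "\<And>u b. type_iso t u \<Longrightarrow> size u > R \<Longrightarrow> b \<subseteq># u \<Longrightarrow> size b \<le> k \<Longrightarrow> reducible (u - b)"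
proof -
  have "\<exists>R. \<forall>d. type_iso t (d + b) \<longrightarrow> R < size d \<longrightarrow> reducible d" for b
  proof (cases "\<exists>d. type_iso t (d + b) \<and> d \<noteq> {#}")
    case True
    then obtain d where d: "type_iso t (d + b)" "d \<noteq> {#}" by blast
    have "reducible d'" if "type_iso t (d' + b)" "size d < size d'" for d'
    proof -
      have "d' \<noteq> {#}" using that by auto
      with iso_cancel[OF assms that(1) d(1)] d(2) that(2) show ?thesis
        unfolding reducible_def by blast
    qed
    then show ?thesis by blast
  next
    case False
    then show ?thesis by (metis less_nat_zero_code size_empty)
  qed
  then obtain R where R: "\<And>b d. type_iso t (d + b) \<Longrightarrow> R b < size d \<Longrightarrow> reducible d" by metis
  \<comment> \<open>Only finitely many \<open>b\<close> over \<open>V\<close> have at most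
    \<open>k\<close> elements. The bound is then taken as \<open>M + k\<close>, to make up for the
    elements removed with \<open>b\<close>.\<close>
  define M where "M = Max (insert 0 (R ` {b. set_mset b \<subseteq> V \<and> size b \<le> k}))"
  show thesis
  proof (rule that[of "M + k"])
    fix u b assume *: "type_iso t u" "size u > M + k" "b \<subseteq># u" "size b \<le> k"
    then have u: "u - b + b = u" by simp
    have "R b \<le> M" unfolding M_def
      by (rule Max_ge) (use * iso_set(2)[OF *(1)] finite_bounded_multisets[of V k] set_mset_mono[OF *(3)] in auto)
    then have "R b < size (u - b)" using * by (simp add: size_Diff_submset)
    then show "reducible (u - b)" using R[of "u - b" b] *(1) u by simp
  qed
qed


section \<open>Moves\<close>

text \<open>All cells receive different labels from an interval whose length depends on the
  cardinality alone. This leaves finitely many sets for each size, and the offset \<open>m\<close>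
  keeps them away from labels in use.\<close>

lemma standard_copy:
  fixes m :: nat
  assumes "finite a"
  obtains b f where "relabelling a f b" "b \<subseteq> {m..<m + card a} \<times> snd ` a"
proof -
  obtain h where h: "bij_betw h a {0..<card a}" using assms ex_bij_betw_finite_nat by blast
  define g where "g = (\<lambda>p. (m + h p, snd p))"
  have "inj_on g a" using h by (auto simp: g_def bij_betw_def inj_on_def)
  then have "relabelling a (relabel_rel g a) (g ` a)" unfolding relabelling_def
    by (intro exI[of _ g]) (auto simp: bij_betw_def g_def)
  moreover have "h p < card a" if "p \<in> a" for p
    using h that by (auto simp: bij_betw_def)
  then have "g ` a \<subseteq> {m..<m + card a} \<times> snd ` a" by (auto simp: g_def)
  ultimately show thesis by (rule that)
qed

lemma subset_of_type:
  assumes "finite a" "c \<subseteq># type a"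
  obtains l where "l \<subseteq> a" "type l = c"
proof -
  have "\<exists>l \<subseteq> a. type l = c" using assms(2)
  proof (induction c)
    case empty
    then show ?case by (intro exI[of _ "{}"]) simp
  next
    case (add v c)
    then have "c \<subseteq># type a" by (metis mset_subset_eq_insertD subset_mset.less_imp_le)
    with add obtain l where l: "l \<subseteq> a" "type l = c" by blast
    have fl: "finite l" using l(1) assms(1) by (rule finite_subset)
    have "type a = type l + type (a - l)"
      using type_Un[of l "a - l"] l(1) fl assms(1) by (simp add: Un_absorb1)
    then have "v \<in># type (a - l)" using add.prems l(2)
      by (metis add_mset_add_single subset_mset.add_le_cancel_left single_subset_iff)
    then obtain p where "p \<in> a - l" "snd p = v" using assms(1) by (auto simp: set_type)
    with l fl have "insert p l \<subseteq> a" "type (insert p l) = add_mset v c" by (simp_all add: type_insert)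
    then show ?case by blast
  qed
  with that show thesis by blast
qed

lemma type_diff:
  assumes "finite a" "b \<subseteq> a" shows "type (a - b) = type a - type b" "type b \<subseteq># type a"
proof -
  have "type a = type b + type (a - b)"
    using type_Un[of b "a - b"] assms finite_subset[OF assms(2,1)] by (simp add: Un_absorb1)
  then show "type (a - b) = type a - type b" "type b \<subseteq># type a" by simp_all
qed

text \<open>Fixed before the moves are defined: the reductions become moves, and
  \<open>move_bound\<close> depends on this constant.\<close>

definition reduction_bound :: nat where
  "reduction_bound = (SOME L. \<forall>t. reducible t \<longrightarrow> (\<exists>c. c \<subseteq># t \<and> reducible c \<and> size c \<le> L))"

lemma reducible_subset:
  assumes "reducible t"
  obtains c where "c \<subseteq># t" "reducible c" "size c \<le> reduction_bound"
proof -
  have "\<exists>L. \<forall>t. reducible t \<longrightarrow> (\<exists>c. c \<subseteq># t \<and> reducible c \<and> size c \<le> L)"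
    using reducible_bound by metis
  from someI_ex[OF this] show thesis using assms that unfolding reduction_bound_def by blast
qed

definition reduction :: "cell_set \<Rightarrow> point_rel \<times> cell_set" where
  "reduction c = (SOME r. mor c (fst r) (snd r) \<and> card (snd r) < card c)"

lemma reduction:
  assumes "reducible (type c)" "finite c"
  shows "mor c (fst (reduction c)) (snd (reduction c)) \<and> card (snd (reduction c)) < card c"
proof -
  from assms(1) obtain u where u: "type_iso (type c) u" "size u < card c" unfolding reducible_def by auto
  obtain c' where c': "finite c'" "type c' = u" "c' \<inter> {} = {}" using realize_type by blast
  with u iso_set[OF u(1)] assms(2) have "obj c" "obj c'" by (simp_all add: obj_iff_type)
  with u(1) c' iso_mor obtain f where "mor c f c'" by metis
  moreover have "card c' < card c" using u(2) c' by (metis size_type)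
  ultimately have "\<exists>r. mor c (fst r) (snd r) \<and> card (snd r) < card c" by auto
  from someI_ex[OF this] show ?thesis unfolding reduction_def .
qed

lemma basic_rel_mor:
  assumes "v \<in> V" shows "mor {(i, v)} (basic_rel i [] m j [] v) {(j, v)}"
proof -
  have "Domain (basic_rel i [] m j [] v) = cells {(i, v)} \<and> single_valued (basic_rel i [] m j [] v)"
    for i m j
    by (auto simp: basic_rel_def cells_def single_valued_def)
  from this[of i m j] this[of j "- m" i] show ?thesis
    using assms basic_rel_local[of v "[]" "[]" i m j]
    by (auto simp: mor_def obj_def basic_rel_converse simp flip: Domain_converse)
qed

text \<open>A finite stock of concrete cell sets that realises every reducible type of size at most
  \<open>reduction_bound\<close>, because that many cells over \<open>V\<close> can be given
  distinct labels in this range.\<close>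

definition small_sets :: "cell_set set" where
  "small_sets = {c. c \<subseteq> {..<reduction_bound} \<times> V \<and> reducible (type c)}"

text \<open>The identity of a single cell is included because moves are closed under composition
  with relabellings: through it the relabelling of one cell is itself a move.\<close>

definition base_moves :: "(cell_set \<times> point_rel \<times> cell_set) set" where
  "base_moves =
     (\<lambda>v. ({(0, v)}, basic_rel 0 [] 0 0 [] v, {(0, v)})) ` V \<union>
     (\<lambda>v. ({(0, v)}, basic_rel 0 [] 1 0 [] v, {(0, v)})) ` V \<union>
     (\<lambda>v. ({(0, v)}, expand_rel v, expand_cells v)) ` V \<union>
     (\<lambda>c. (c, reduction c)) ` small_sets"

definition sym_moves :: "(cell_set \<times> point_rel \<times> cell_set) set" where
  "sym_moves = base_moves \<union> (\<lambda>(c, f, c'). (c', f\<inverse>, c)) ` base_moves"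

lemma finite_sym_moves: "finite sym_moves"
proof -
  have "finite small_sets" by (rule finite_subset[of _ "Pow ({..<reduction_bound} \<times> V)"])
    (auto simp: small_sets_def)
  then show ?thesis by (simp add: sym_moves_def base_moves_def)
qed

lemma base_moves_mor: "(c, f, c') \<in> base_moves \<Longrightarrow> mor c f c'"
proof -
  have "mor c (fst (reduction c)) (snd (reduction c))" if "c \<in> small_sets" for c
    using that reduction[of c] by (auto simp: small_sets_def intro: finite_subset)
  then show "(c, f, c') \<in> base_moves \<Longrightarrow> mor c f c'"
    unfolding base_moves_def using expand_mor basic_rel_mor by (auto simp: prod_eq_iff)
qed

lemma sym_moves_mor: "(c, f, c') \<in> sym_moves \<Longrightarrow> mor c f c'"
  unfolding sym_moves_def using base_moves_mor mor_converse by auto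

lemma sym_moves_sym: "(c, f, c') \<in> sym_moves \<Longrightarrow> (c', f\<inverse>, c) \<in> sym_moves"
  unfolding sym_moves_def by force

text \<open>Free relabelling on both sides lets a finite list of base moves act on any cells of the
  right type; \<open>k\<close> is the whole support.\<close>

definition move :: "cell_set \<Rightarrow> point_rel \<Rightarrow> cell_set \<Rightarrow> bool" where
  "move k g k' \<longleftrightarrow> (\<exists>c f c' p q. (c, f, c') \<in> sym_moves \<and> relabelling k p c \<and>
     relabelling c' q k' \<and> g = p O f O q)"

lemma move_mor: "move k g k' \<Longrightarrow> mor k g k'"
  unfolding move_def using sym_moves_mor relabelling_mor mor_comp relabelling_obj mor_objD by meson

lemma move_sym:
  assumes "move k g k'" shows "move k' (g\<inverse>) k"
proof -
  from assms obtain c f c' p q where *: "(c, f, c') \<in> sym_moves" "relabelling k p c"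
     "relabelling c' q k'" "g = p O f O q" unfolding move_def by blast
  then have "(c', f\<inverse>, c) \<in> sym_moves" "relabelling k' (q\<inverse>) c'" "relabelling c (p\<inverse>) k"
    "g\<inverse> = q\<inverse> O f\<inverse> O p\<inverse>"
    by (simp_all add: sym_moves_sym relabelling_converse converse_relcomp O_assoc)
  then show ?thesis unfolding move_def by blast
qed

lemma move_relabel:
  assumes "move k g k'" "relabelling l p k" "relabelling k' q l'"
  shows "move l (p O g O q) l'"
proof -
  from assms(1) obtain c f c' p' q' where *: "(c, f, c') \<in> sym_moves" "relabelling k p' c"
     "relabelling c' q' k'" "g = p' O f O q'" unfolding move_def by blast
  then have "relabelling l (p O p') c" "relabelling c' (q' O q) l'" "p O g O q = (p O p') O f O (q' O q)"
    using assms relabelling_comp by (blast, blast, simp add: O_assoc)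
  with *(1) show ?thesis unfolding move_def by blast
qed

lemma move_base: "(c, f, c') \<in> base_moves \<Longrightarrow> move c f c'"
proof -
  assume *: "(c, f, c') \<in> base_moves"
  then have "f = Id_on (cells c) O f O Id_on (cells c')"
    using mor_Id_comp[OF base_moves_mor[OF *]] by simp
  with * show "move c f c'" unfolding move_def sym_moves_def using relabelling_Id by blast
qed

text \<open>Since \<open>sym_moves\<close> is closed under inverses, bounding the sources bounds the
  targets too.\<close>

definition move_bound :: nat where
  "move_bound = Max (insert 0 ((\<lambda>(c, f, c'). card c) ` sym_moves))"

lemma move_card: "move k g k' \<Longrightarrow> card k \<le> move_bound"
proof -
  assume "move k g k'"
  then obtain c f c' p where *: "(c, f, c') \<in> sym_moves" "relabelling k p c" unfolding move_def by blast
  have "card c \<le> move_bound" unfolding move_bound_def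
    by (rule Max_ge) (use finite_sym_moves *(1) in \<open>force+\<close>)
  then show ?thesis using relabelling_card[OF *(2)] by simp
qed

text \<open>A reducible type contains a reducible one of size at most
  \<open>reduction_bound\<close>. The cells of \<open>a\<close> realising it have a standard copy in
  \<open>small_sets\<close>, whose reduction is a base move. The target is then relabelled away from
  \<open>F\<close>.\<close>

lemma move_reduction:
  assumes "finite a" "reducible (type a)" "finite F"
  obtains l h l' where "l \<subseteq> a" "move l h l'" "card l' < card l" "l' \<inter> F = {}"
proof -
  obtain c where c: "c \<subseteq># type a" "reducible c" "size c \<le> reduction_bound"
    using reducible_subset[OF assms(2)] .
  obtain l where l: "l \<subseteq> a" "type l = c" using subset_of_type[OF assms(1) c(1)] .
  have fl: "finite l" using l(1) assms(1) by (rule finite_subset)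
  obtain k p where k: "relabelling l p k" "k \<subseteq> {0..<0 + card l} \<times> snd ` l" using standard_copy[OF fl] .
  have "type k = c" using relabelling_type[OF k(1)] l by simp
  moreover have "card l \<le> reduction_bound" using c l by (metis size_type)
  moreover have "snd ` l \<subseteq> V" using reducible_set[OF c(2)] l fl by (simp add: set_type[symmetric])
  ultimately have "k \<in> small_sets" unfolding small_sets_def using k(2) c(2) by fastforce
  then have m: "move k (fst (reduction k)) (snd (reduction k))"
    by (intro move_base) (simp add: base_moves_def)
  have fk: "finite k" using k(2) fl by (auto intro: finite_subset)
  have r: "mor k (fst (reduction k)) (snd (reduction k))" "card (snd (reduction k)) < card k"
    using reduction[of k] c(2) \<open>type k = c\<close> fk by auto
  have "finite (snd (reduction k))" using mor_objD(2)[OF r(1)] by (simp add: obj_def)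
  then obtain l' q where l': "relabelling (snd (reduction k)) q l'" "l' \<inter> F = {}"
    using fresh_copy assms(3) by metis
  have "card l' < card l" using r(2) relabelling_card[OF l'(1)] relabelling_card[OF k(1)] by simp
  with that l(1) l'(2) move_relabel[OF m k(1) l'(1)] show thesis by blast
qed

text \<open>An edge of the graph of cell sets. The bystanders \<open>d\<close> must be disjoint from
  the support before and after the move, whereas \<open>k\<close> and \<open>k'\<close> may
  overlap.\<close>

definition edge_rel :: "cell_set \<Rightarrow> point_rel \<Rightarrow> cell_set \<Rightarrow> bool" where
  "edge_rel a g b \<longleftrightarrow> (\<exists>k h k' d. move k h k' \<and> obj d \<and> k \<inter> d = {} \<and> k' \<inter> d = {} \<and>
     a = k \<union> d \<and> b = k' \<union> d \<and> g = h \<union> Id_on (cells d))"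

lemma edge_relI:
  "move k h k' \<Longrightarrow> obj d \<Longrightarrow> k \<inter> d = {} \<Longrightarrow> k' \<inter> d = {} \<Longrightarrow>
    edge_rel (k \<union> d) (h \<union> Id_on (cells d)) (k' \<union> d)"
  unfolding edge_rel_def by blast

lemma edge_rel_mor: "edge_rel a g b \<Longrightarrow> mor a g b"
  unfolding edge_rel_def using move_mor mor_Id mor_Un by metis

lemma edge_rel_sym: "edge_rel a g b \<Longrightarrow> edge_rel b (g\<inverse>) a"
  unfolding edge_rel_def using move_sym by (metis converse_Un converse_Id_on)

text \<open>\<open>R\<close> bounds every set visited on the way, not only the two ends. This is the
  filtration along which products are pushed down.\<close>

inductive gen :: "nat \<Rightarrow> cell_set \<Rightarrow> point_rel \<Rightarrow> cell_set \<Rightarrow> bool" for R a where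
  gen_Id: "obj a \<Longrightarrow> card a \<le> R \<Longrightarrow> gen R a (Id_on (cells a)) a"
| gen_step: "gen R a f b \<Longrightarrow> edge_rel b g c \<Longrightarrow> card c \<le> R \<Longrightarrow> gen R a (f O g) c"

lemma gen_mor: "gen R a f b \<Longrightarrow> mor a f b"
  by (induction rule: gen.induct) (auto intro: mor_Id mor_comp dest: edge_rel_mor)

lemma gen_card: "gen R a f b \<Longrightarrow> card a \<le> R" "gen R a f b \<Longrightarrow> card b \<le> R"
  by (induction rule: gen.induct) auto

lemma gen_mono: "gen R a f b \<Longrightarrow> R \<le> R' \<Longrightarrow> gen R' a f b"
  by (induction rule: gen.induct) (auto intro: gen.intros)

lemma gen_trans:
  assumes "gen R a f b" "gen R b g c" shows "gen R a (f O g) c"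
  using assms(2)
proof (induction rule: gen.induct)
  case gen_Id
  then show ?case using mor_Id_comp(2)[OF gen_mor[OF assms(1)]] assms(1) by simp
next
  case (gen_step g c h d)
  have "gen R a ((f O g) O h) d" by (rule gen.gen_step[OF gen_step.IH gen_step.hyps(2,3)])
  then show ?case by (simp add: O_assoc)
qed

lemma gen_edge:
  assumes "edge_rel a g b" "card a \<le> R" "card b \<le> R" shows "gen R a g b"
proof -
  have "gen R a (Id_on (cells a) O g) b"
    by (rule gen_step[OF gen_Id assms(1,3)]) (use assms(2) mor_objD(1)[OF edge_rel_mor[OF assms(1)]] in auto)
  then show ?thesis using mor_Id_comp(1)[OF edge_rel_mor[OF assms(1)]] by simp
qed

lemma gen_sym: "gen R a f b \<Longrightarrow> gen R b (f\<inverse>) a"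
proof (induction rule: gen.induct)
  case gen_Id
  then show ?case by (simp add: gen.gen_Id)
next
  case (gen_step f b g c)
  have "gen R c (g\<inverse>) b"
    using edge_rel_sym[OF gen_step(2)] gen_step(3) gen_card(2)[OF gen_step(1)] by (rule gen_edge)
  from gen_trans[OF this gen_step.IH] show ?case by (simp add: converse_relcomp)
qed

text \<open>Moves with disjoint supports commute; both composites have this normal form.\<close>

lemma disjoint_moves_comp:
  assumes "mor k g k'" "mor l h l'" "k' \<inter> l = {}" "k' \<inter> d = {}" "l \<inter> d = {}"
  shows "(g \<union> Id_on (cells (l \<union> d))) O (h \<union> Id_on (cells (k' \<union> d))) = g \<union> h \<union> Id_on (cells d)"
proof -
  have D: "Range g = cells k'" "Domain h = cells l" using assms by (auto simp: mor_def)
  have "cells k' \<inter> cells l = {}" "cells k' \<inter> cells d = {}" "cells l \<inter> cells d = {}"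
    using assms cells_disjoint by blast+
  then have "g O h = {}" "g O Id_on (cells d) = {}" "Id_on (cells l) O Id_on (cells k') = {}"
     "Id_on (cells l) O Id_on (cells d) = {}" "Id_on (cells d) O h = {}"
     "Id_on (cells d) O Id_on (cells k') = {}"
    unfolding D(1)[symmetric] D(2)[symmetric] by blast+
  moreover have "g O Id_on (cells k') = g" "Id_on (cells l) O h = h"
    using mor_Id_comp assms by blast+
  moreover have "Id_on (cells (a \<union> b)) = Id_on (cells a) \<union> Id_on (cells b)" for a b
    by auto
  moreover have "Id_on (cells d) O Id_on (cells d) = Id_on (cells d)" by auto
  ultimately show ?thesis by (simp add: relcomp_distrib relcomp_distrib2 Un_ac del: cells_Un)
qed


section \<open>Bounding the number of cells\<close>

text \<open>A commuting square of edges with \<open>g0\<close>, \<open>g1\<close> along one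
  direction and \<open>h0\<close>, \<open>h1\<close> along the other. Its last two equations are the
  forms needed later: the first transports an edge through a reduction, the second leads from the
  end of an exit to the end of a reduction.\<close>

lemma commuting_edges:
  assumes "move k g k'" "move l h l'" "obj d"
    and "k \<inter> l = {}" "k \<inter> d = {}" "l \<inter> d = {}"
    and "k' \<inter> l = {}" "k' \<inter> d = {}" "l' \<inter> d = {}" "l' \<inter> k = {}" "l' \<inter> k' = {}"
  defines "g0 \<equiv> g \<union> Id_on (cells (l \<union> d))" and "g1 \<equiv> g \<union> Id_on (cells (l' \<union> d))"
    and "h0 \<equiv> h \<union> Id_on (cells (k \<union> d))" and "h1 \<equiv> h \<union> Id_on (cells (k' \<union> d))"
  shows "edge_rel (k \<union> l \<union> d) g0 (k' \<union> l \<union> d)" "edge_rel (k \<union> l' \<union> d) g1 (k' \<union> l' \<union> d)"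
    "edge_rel (k \<union> l \<union> d) h0 (k \<union> l' \<union> d)" "edge_rel (k' \<union> l \<union> d) h1 (k' \<union> l' \<union> d)"
    "h0\<inverse> O g0 O h1 = g1" "g0\<inverse> O h0 = h1 O g1\<inverse>"
proof -
  note m = move_mor[OF assms(1)] move_mor[OF assms(2)]
  note o = mor_objD[OF m(1)] mor_objD[OF m(2)]
  have "edge_rel (k \<union> (l \<union> d)) g0 (k' \<union> (l \<union> d))" "edge_rel (k \<union> (l' \<union> d)) g1 (k' \<union> (l' \<union> d))"
    unfolding g0_def g1_def by (rule edge_relI[OF assms(1)]; use o assms in auto)+
  then show e: "edge_rel (k \<union> l \<union> d) g0 (k' \<union> l \<union> d)" "edge_rel (k \<union> l' \<union> d) g1 (k' \<union> l' \<union> d)"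
    by (simp_all add: Un_assoc)
  have "edge_rel (l \<union> (k \<union> d)) h0 (l' \<union> (k \<union> d))" "edge_rel (l \<union> (k' \<union> d)) h1 (l' \<union> (k' \<union> d))"
    unfolding h0_def h1_def by (rule edge_relI[OF assms(2)]; use o assms in auto)+
  then show e': "edge_rel (k \<union> l \<union> d) h0 (k \<union> l' \<union> d)" "edge_rel (k' \<union> l \<union> d) h1 (k' \<union> l' \<union> d)"
    by (simp_all add: Un_ac)
  have "g0 O h1 = g \<union> h \<union> Id_on (cells d)" unfolding g0_def h1_def
    by (rule disjoint_moves_comp[OF m]) (use assms in auto)
  moreover have "h0 O g1 = h \<union> g \<union> Id_on (cells d)" unfolding h0_def g1_def
    by (rule disjoint_moves_comp[OF m(2,1)]) (use assms in auto)
  ultimately have comm: "g0 O h1 = h0 O g1" by (simp add: Un_ac)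
  note M = edge_rel_mor[OF e(1)] edge_rel_mor[OF e(2)] edge_rel_mor[OF e'(1)] edge_rel_mor[OF e'(2)]
  show "h0\<inverse> O g0 O h1 = g1"
    unfolding comm mor_cancel(2)[OF M(3)] mor_Id_comp(1)[OF M(2)] ..
  have "h0 = h0 O g1 O g1\<inverse>"
    using mor_Id_comp(2)[OF M(3)] mor_Id_comp(3)[OF M(2)] by simp
  also have "\<dots> = g0 O h1 O g1\<inverse>" using comm by (metis O_assoc)
  finally have "h0 = g0 O h1 O g1\<inverse>" .
  then have "g0\<inverse> O h0 = g0\<inverse> O g0 O h1 O g1\<inverse>" by metis
  also have "\<dots> = Id_on (cells (k' \<union> l \<union> d)) O h1 O g1\<inverse>" by (rule mor_cancel(2)[OF M(1)])
  also have "\<dots> = h1 O g1\<inverse>" using mor_Id_comp(1)[OF M(4)] by (metis O_assoc)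
  finally show "g0\<inverse> O h0 = h1 O g1\<inverse>" .
qed

text \<open>The trivial exit for small sets allows a uniform treatment of walks that visit sets of
  both kinds.\<close>

definition exit_edge :: "nat \<Rightarrow> cell_set \<Rightarrow> point_rel \<Rightarrow> cell_set \<Rightarrow> bool" where
  "exit_edge R a p b \<longleftrightarrow>
     (if card a \<le> R then b = a \<and> p = Id_on (cells a) else edge_rel a p b \<and> card b \<le> R)"

lemma exit_edge_mor: "obj a \<Longrightarrow> exit_edge R a p b \<Longrightarrow> mor a p b"
  unfolding exit_edge_def using mor_Id edge_rel_mor by (auto split: if_splits)

text \<open>The factor 2 is due to the comparison of two exits, whose supports must be avoided
  simultaneously. Only sets isomorphic to \<open>a0\<close> matter, as these are the ones a walk
  from \<open>a0\<close> can visit.\<close>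

definition reduces_above :: "nat \<Rightarrow> cell_set \<Rightarrow> bool" where
  "reduces_above R a0 \<longleftrightarrow> (\<forall>a b. type_iso (type a0) (type a) \<longrightarrow> finite a \<longrightarrow> R < card a \<longrightarrow> b \<subseteq> a \<longrightarrow>
     card b \<le> 2 * move_bound \<longrightarrow> reducible (type (a - b)))"

lemma reduces_above_exists:
  assumes "branching" shows "\<exists>R. reduces_above R a0"
proof -
  obtain R where R: "\<And>u b. type_iso (type a0) u \<Longrightarrow> size u > R \<Longrightarrow> b \<subseteq># u \<Longrightarrow>
      size b \<le> 2 * move_bound \<Longrightarrow> reducible (u - b)"
    using reducible_avoiding[OF assms] by metis
  have "reducible (type (a - b))"
    if "type_iso (type a0) (type a)" "finite a" "R < card a" "b \<subseteq> a" "card b \<le> 2 * move_bound" for a b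
    using R[of "type a" "type b"] type_diff[OF that(2,4)] that by simp
  then show ?thesis unfolding reduces_above_def by blast
qed

text \<open>A reduction of cells \<open>l\<close> among the bystanders commutes with the edge from
  \<open>a\<close> to \<open>b\<close> and produces a parallel edge from \<open>e\<close> to
  \<open>f\<close> between smaller sets. The formula for \<open>h0\<close> is part of the result,
  since two different decompositions of \<open>a\<close> have to share the same
  \<open>h0\<close>.\<close>

lemma gen_across_exit:
  assumes "move k g k'" "obj d" "k \<inter> d = {}" "k' \<inter> d = {}"
    and "move l h l'" "l \<subseteq> d" "card l' < card l" "l' \<inter> (k \<union> d \<union> k') = {}"
  defines "a \<equiv> k \<union> d" and "b \<equiv> k' \<union> d" and "e \<equiv> k \<union> l' \<union> (d - l)" and "f \<equiv> k' \<union> l' \<union> (d - l)"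
  obtains h0 h1 g1 where "edge_rel a h0 e" "edge_rel b h1 f" "edge_rel e g1 f"
    "h0 = h \<union> Id_on (cells (k \<union> (d - l)))"
    "h0\<inverse> O (g \<union> Id_on (cells d)) O h1 = g1" "(g \<union> Id_on (cells d))\<inverse> O h0 = h1 O g1\<inverse>"
    "card e < card a" "card f < card b"
proof -
  have d: "l \<union> (d - l) = d" using assms(6) by blast
  have ab: "a = k \<union> l \<union> (d - l)" "b = k' \<union> l \<union> (d - l)" unfolding a_def b_def using d by auto
  have o: "obj (d - l)" using assms(2) by (rule obj_subset) blast
  note c = commuting_edges[OF assms(1,5) o, unfolded d, folded ab e_def f_def]
  have "finite k" "finite k'" "finite l" "finite l'" "finite d"
    using mor_objD[OF move_mor[OF assms(1)]] mor_objD[OF move_mor[OF assms(5)]] assms(2)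
    by (auto simp: obj_def)
  then have "card (c \<union> l' \<union> (d - l)) < card (c \<union> d)" if "c \<inter> d = {}" "c \<inter> l' = {}" "finite c" for c
  proof -
    have "card (c \<union> l' \<union> (d - l)) = card c + card l' + card (d - l)"
      using \<open>finite d\<close> \<open>finite l'\<close> that assms(8) by (subst card_Un_disjoint, auto)+
    moreover have "card (c \<union> d) = card c + card d" using that \<open>finite d\<close> by (intro card_Un_disjoint)
    moreover have "card d = card l + card (d - l)"
      using \<open>finite l\<close> \<open>finite d\<close> assms(6) by (metis card_Diff_subset card_mono le_add_diff_inverse)
    ultimately show ?thesis using assms(7) by linarith
  qed
  from this[of k] this[of k'] have "card e < card a" "card f < card b"
    unfolding a_def b_def e_def f_def using assms(3,4,8) \<open>finite k\<close> \<open>finite k'\<close> by auto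
  moreover have "k \<inter> l = {}" "k \<inter> (d - l) = {}" "l \<inter> (d - l) = {}" "k' \<inter> l = {}" "k' \<inter> (d - l) = {}"
    "l' \<inter> (d - l) = {}" "l' \<inter> k = {}" "l' \<inter> k' = {}" using assms by blast+
  note c[OF this]
  ultimately show thesis using that by blast
qed

context
  fixes R R0 a0
  assumes R0: "reduces_above R0 a0" "R0 \<le> R"
begin

text \<open>At a set of more than \<open>R\<close> cells two exits are compared through a third one, whose support
  is disjoint from both.\<close>

lemma exits_connected:
  assumes a: "type_iso (type a0) (type a)" "obj a" "card a \<le> Suc R"
    and p: "exit_edge R a p b" and q: "exit_edge R a q c"
  shows "gen R b (p\<inverse> O q) c"
proof (cases "card a \<le> R")
  case True
  then have "p\<inverse> O q = Id_on (cells a)" "b = a" "c = a" using p q by (auto simp: exit_edge_def)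
  with gen_Id[OF a(2) True] show ?thesis by simp
next
  case False
  have fa: "finite a" using a(2) by (simp add: obj_def)
  from False p q have pq: "edge_rel a p b" "card b \<le> R" "edge_rel a q c" "card c \<le> R"
    by (auto simp: exit_edge_def)
  from pq(1) obtain k1 g1 k1' d1 where 1: "move k1 g1 k1'" "obj d1" "k1 \<inter> d1 = {}" "k1' \<inter> d1 = {}"
     "a = k1 \<union> d1" "b = k1' \<union> d1" "p = g1 \<union> Id_on (cells d1)" unfolding edge_rel_def by blast
  from pq(3) obtain k2 g2 k2' d2 where 2: "move k2 g2 k2'" "obj d2" "k2 \<inter> d2 = {}" "k2' \<inter> d2 = {}"
     "a = k2 \<union> d2" "c = k2' \<union> d2" "q = g2 \<union> Id_on (cells d2)" unfolding edge_rel_def by blast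
  have "card (k1 \<union> k2) \<le> card k1 + card k2" by (rule card_Un_le)
  also have "\<dots> \<le> 2 * move_bound" using move_card[OF 1(1)] move_card[OF 2(1)] by simp
  finally have "card (k1 \<union> k2) \<le> 2 * move_bound" .
  moreover have "k1 \<union> k2 \<subseteq> a" using 1(5) 2(5) by blast
  moreover have "R0 < card a" using R0(2) False by simp
  ultimately have "reducible (type (a - (k1 \<union> k2)))"
    using R0(1) a(1) fa unfolding reduces_above_def by blast
  moreover have "finite (a - (k1 \<union> k2))" "finite (a \<union> k1' \<union> k2')"
    using fa mor_objD(2)[OF move_mor[OF 1(1)]] mor_objD(2)[OF move_mor[OF 2(1)]] by (auto simp: obj_def)
  ultimately obtain l h l' where l: "l \<subseteq> a - (k1 \<union> k2)" "move l h l'" "card l' < card l"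
      "l' \<inter> (a \<union> k1' \<union> k2') = {}" using move_reduction by metis
  \<comment> \<open>Both are expressed by \<open>a\<close> and \<open>l\<close> alone, so
    \<open>half\<close> compares either exit with the very same third exit.\<close>
  define e where "e = l' \<union> (a - l)"
  define h0 where "h0 = h \<union> Id_on (cells (a - l))"
  have half: "gen R (k' \<union> d) ((g \<union> Id_on (cells d))\<inverse> O h0) e \<and> mor a h0 e"
    if hyp: "move k g k'" "obj d" "k \<inter> d = {}" "k' \<inter> d = {}" "a = k \<union> d" "k \<inter> l = {}" "k' \<inter> l' = {}"
      "card (k' \<union> d) \<le> R" for k g k' d
  proof -
    have ld: "l \<subseteq> d" "l' \<inter> (k \<union> d \<union> k') = {}" using l hyp by blast+
    have ed: "e = k \<union> l' \<union> (d - l)" "a - l = k \<union> (d - l)" using hyp ld by (auto simp: e_def)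
    from gen_across_exit[OF hyp(1-4) l(2) ld(1) l(3) ld(2), folded ed(1)]
    obtain h1 g1 where E: "edge_rel (k \<union> d) h0 e" "edge_rel (k' \<union> d) h1 (k' \<union> l' \<union> (d - l))"
      "edge_rel e g1 (k' \<union> l' \<union> (d - l))" "(g \<union> Id_on (cells d))\<inverse> O h0 = h1 O g1\<inverse>"
      "card e < card a" "card (k' \<union> l' \<union> (d - l)) < card (k' \<union> d)"
      unfolding h0_def ed(2) hyp(5)[symmetric] by metis
    \<comment> \<open>The reduction only shrinks the end of the given exit, which has at most
      \<open>R\<close> cells; \<open>e\<close> is smaller than \<open>a\<close>, hence also has at
      most \<open>R\<close>.\<close>
    have "gen R (k' \<union> d) h1 (k' \<union> l' \<union> (d - l))" using E hyp(8) by (intro gen_edge) auto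
    moreover have "gen R (k' \<union> l' \<union> (d - l)) (g1\<inverse>) e"
      using E(5,6) hyp(8) a(3) by (intro gen_edge edge_rel_sym[OF E(3)]) auto
    ultimately show ?thesis using gen_trans E(4) edge_rel_mor[OF E(1)] hyp(5) by metis
  qed
  have "k1 \<inter> l = {}" "k2 \<inter> l = {}" "k1' \<inter> l' = {}" "k2' \<inter> l' = {}" using l by blast+
  with half[OF 1(1-5)] half[OF 2(1-5)] pq
  have *: "gen R b (p\<inverse> O h0) e" "gen R c (q\<inverse> O h0) e" "mor a h0 e"
    by (simp_all add: 1(6,7) 2(6,7))
  have "(p\<inverse> O h0) O (q\<inverse> O h0)\<inverse> = p\<inverse> O (h0 O h0\<inverse> O q)" by (simp add: converse_relcomp O_assoc)
  also have "\<dots> = p\<inverse> O q" unfolding mor_cancel(1)[OF *(3)] mor_Id_comp(1)[OF edge_rel_mor[OF pq(3)]] ..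
  finally show ?thesis using gen_trans[OF *(1) gen_sym[OF *(2)]] by simp
qed

text \<open>When one end is too large, the bystanders of the edge contain a reducible set. Reducing
  it carries the edge to one between small sets, and the reduction itself serves as the exit
  wherever an exit is needed.\<close>

lemma exits_natural:
  assumes a: "type_iso (type a0) (type a)" "edge_rel a g b" "card a \<le> Suc R" "card b \<le> Suc R"
  obtains p a' q b' where "exit_edge R a p a'" "exit_edge R b q b'" "gen R a' (p\<inverse> O g O q) b'"
proof (cases "card a \<le> R \<and> card b \<le> R")
  case True
  have "exit_edge R a (Id_on (cells a)) a" "exit_edge R b (Id_on (cells b)) b"
    using True by (simp_all add: exit_edge_def)
  moreover have "(Id_on (cells a))\<inverse> O g O Id_on (cells b) = g"
    using mor_Id_comp(1,2)[OF edge_rel_mor[OF a(2)]] by simp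
  ultimately show thesis using gen_edge[OF a(2)] True that by metis
next
  case False
  from a(2) obtain k g0 k' d where k: "move k g0 k'" "obj d" "k \<inter> d = {}" "k' \<inter> d = {}"
     "a = k \<union> d" "b = k' \<union> d" "g = g0 \<union> Id_on (cells d)" unfolding edge_rel_def by blast
  have ob: "obj a" "obj b" using mor_objD[OF edge_rel_mor[OF a(2)]] by auto
  then have fin: "finite a" "finite b" "finite d" using k(2) by (auto simp: obj_def)
  have "type_iso (type a) (type b)" using edge_rel_mor[OF a(2)] by (auto simp: type_iso_def)
  with a(1) have b1: "type_iso (type a0) (type b)" using iso_trans by blast
  have red: "reducible (type (c - l))"
    if "type_iso (type a0) (type c)" "finite c" "R < card c" "l \<subseteq> c" "card l \<le> move_bound" for c l
  proof -
    have "R0 < card c" "card l \<le> 2 * move_bound" using R0(2) that by simp_all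
    with that R0(1) show ?thesis unfolding reduces_above_def by blast
  qed
  have "card k \<le> move_bound" "card k' \<le> move_bound" using move_card k(1) move_sym by blast+
  moreover have "d = a - k" "d = b - k'" using k by auto
  \<comment> \<open>\<open>d\<close> is the complement of the support in \<open>a\<close> and of the
    moved support in \<open>b\<close>. Whichever of the two sets has more than \<open>R\<close>
    cells gives the claim.\<close>
  ultimately have "reducible (type d)"
    using False red[OF a(1) fin(1), of k] red[OF b1 fin(2), of k'] k(5,6) by (metis Un_upper1 not_le)
  then obtain l h l' where l: "l \<subseteq> d" "move l h l'" "card l' < card l" "l' \<inter> (a \<union> b) = {}"
    using move_reduction[OF fin(3)] fin by (metis finite_UnI)
  then have l': "l' \<inter> (k \<union> d \<union> k') = {}" using k by blast
  define e f where "e = k \<union> l' \<union> (d - l)" and "f = k' \<union> l' \<union> (d - l)"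
  from gen_across_exit[OF k(1-4) l(2,1,3) l', folded k(5-7) e_def f_def]
  obtain h0 h1 g1 where E: "edge_rel a h0 e" "edge_rel b h1 f" "edge_rel e g1 f"
    "h0\<inverse> O g O h1 = g1" "card e < card a" "card f < card b" by metis
  then have card: "card e \<le> R" "card f \<le> R" using a by simp_all
  \<comment> \<open>At a small end the exit is trivial and the reduction edge joins the bounded
    walk; at a large end the reduction is the exit and the bounded walk is trivial.\<close>
  have ex: "\<exists>p c'. exit_edge R c p c' \<and> gen R c' (p\<inverse> O h) c''"
    if "edge_rel c h c''" "card c'' \<le> R" for c h c''
  proof (cases "card c \<le> R")
    case True
    then have "exit_edge R c (Id_on (cells c)) c" by (simp add: exit_edge_def)
    moreover have "(Id_on (cells c))\<inverse> O h = h" using mor_Id_comp(1)[OF edge_rel_mor[OF that(1)]] by simp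
    ultimately show ?thesis using gen_edge[OF that(1) True that(2)] by metis
  next
    case False
    then have "exit_edge R c h c''" using that by (simp add: exit_edge_def)
    moreover have "h\<inverse> O h = Id_on (cells c'')" using mor_Id_comp(4)[OF edge_rel_mor[OF that(1)]] .
    moreover have "obj c''" using mor_objD(2)[OF edge_rel_mor[OF that(1)]] .
    ultimately show ?thesis using gen_Id that(2) by metis
  qed
  from ex[OF E(1) card(1)] obtain p a' where p: "exit_edge R a p a'" "gen R a' (p\<inverse> O h0) e" by blast
  from ex[OF E(2) card(2)] obtain q b' where q: "exit_edge R b q b'" "gen R b' (q\<inverse> O h1) f" by blast
  note M = edge_rel_mor[OF E(1)] edge_rel_mor[OF E(2)] edge_rel_mor[OF a(2)]
  have mq: "mor b q b'" using exit_edge_mor ob(2) q(1) by blast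
  have "(p\<inverse> O h0) O g1 O (q\<inverse> O h1)\<inverse> = p\<inverse> O (h0 O h0\<inverse> O (g O (h1 O h1\<inverse> O q)))"
    unfolding E(4)[symmetric] by (simp add: converse_relcomp O_assoc)
  also have "h1 O h1\<inverse> O q = q" unfolding mor_cancel(1)[OF M(2)] by (rule mor_Id_comp(1)[OF mq])
  also have "h0 O h0\<inverse> O (g O q) = g O q"
    unfolding mor_cancel(1)[OF M(1)] by (rule mor_Id_comp(1)[OF mor_comp[OF M(3) mq]])
  finally have "gen R a' (p\<inverse> O g O q) b'"
    using gen_trans[OF p(2) gen_trans[OF gen_edge[OF E(3) card] gen_sym[OF q(2)]]] by simp
  with p(1) q(1) that show thesis by blast
qed

text \<open>Induction along the walk, for all exits at its current end. Each step is replaced by its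
  transported version, followed by a change of exit.\<close>

lemma gen_descend:
  assumes "gen (Suc R) a0 f b" "card a0 \<le> R" "exit_edge R b p b'"
  shows "gen R a0 (f O p) b'"
  using assms(1,3)
proof (induction arbitrary: p b' rule: gen.induct)
  case gen_Id
  then have "p = Id_on (cells a0)" "b' = a0" using assms(2) by (simp_all add: exit_edge_def)
  moreover have "gen R a0 (Id_on (cells a0)) a0" using gen_Id(1) assms(2) by (rule gen.gen_Id)
  ultimately show ?case using mor_Id_comp(1)[OF mor_Id[OF gen_Id(1)]] by simp
next
  case (gen_step f b g c)
  have f: "mor a0 f b" using gen_step(1) by (rule gen_mor)
  then have b: "type_iso (type a0) (type b)" by (auto simp: type_iso_def)
  have g: "mor b g c" using gen_step(2) by (rule edge_rel_mor)
  then have "type_iso (type b) (type c)" by (auto simp: type_iso_def)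
  with b have c: "type_iso (type a0) (type c)" using iso_trans by blast
  obtain p0 b0 q0 c0 where n: "exit_edge R b p0 b0" "exit_edge R c q0 c0" "gen R b0 (p0\<inverse> O g O q0) c0"
    by (rule exits_natural[OF b gen_step(2) gen_card(2)[OF gen_step(1)] gen_step(3)])
  \<comment> \<open>\<open>exits_natural\<close> picks the exit \<open>q0\<close> at
    \<open>c\<close> by itself; this passes from it to the prescribed exit \<open>p\<close>.\<close>
  have conn: "gen R c0 (q0\<inverse> O p) b'"
    by (rule exits_connected[OF c mor_objD(2)[OF g] gen_step(3) n(2) gen_step.prems])
  have "mor b p0 b0" "mor c q0 c0" "mor c p b'"
    using exit_edge_mor mor_objD g n gen_step.prems by blast+
  note m = this
  have "(f O p0) O (p0\<inverse> O g O q0) O (q0\<inverse> O p) = f O (p0 O p0\<inverse> O (g O (q0 O q0\<inverse> O p)))"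
    by (simp add: O_assoc)
  also have "q0 O q0\<inverse> O p = p"
    unfolding mor_cancel(1)[OF m(2)] by (rule mor_Id_comp(1)[OF m(3)])
  also have "p0 O p0\<inverse> O (g O p) = g O p"
    unfolding mor_cancel(1)[OF m(1)] by (rule mor_Id_comp(1)[OF mor_comp[OF g m(3)]])
  finally show ?case using gen_trans[OF gen_step.IH[OF n(1)] gen_trans[OF n(3) conn]]
    by (simp add: O_assoc)
qed

end

text \<open>The bound drops by one at a time. A loop at \<open>a0\<close> stays a loop because
  \<open>a0\<close> has at most \<open>R\<close> cells, so that its own exit is trivial.\<close>

lemma gen_bounded:
  assumes "reduces_above R0 a0" "R0 \<le> R" "card a0 \<le> R" "gen R' a0 f a0"
  shows "gen R a0 f a0"
proof -
  have "gen (R + k) a0 f a0 \<Longrightarrow> gen R a0 f a0" for k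
  proof (induction k)
    case (Suc k)
    have "exit_edge (R + k) a0 (Id_on (cells a0)) a0" using assms(3) by (simp add: exit_edge_def)
    then have "gen (R + k) a0 (f O Id_on (cells a0)) a0"
      using gen_descend[OF assms(1), of "R + k" f a0] assms Suc.prems by simp
    then show ?case using Suc.IH mor_Id_comp(2)[OF gen_mor[OF Suc.prems]] by simp
  qed simp
  from this[of "R'"] show ?thesis using gen_mono[OF assms(4), of "R + R'"] by simp
qed


section \<open>Generation by moves\<close>

definition generated :: "cell_set \<Rightarrow> point_rel \<Rightarrow> cell_set \<Rightarrow> bool" where
  "generated a f b \<longleftrightarrow> (\<exists>R. gen R a f b)"

lemma generated_trans: "generated a f b \<Longrightarrow> generated b g c \<Longrightarrow> generated a (f O g) c"
  unfolding generated_def using gen_trans gen_mono by (metis max.cobounded1 max.cobounded2)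

lemma generated_sym: "generated a f b \<Longrightarrow> generated b (f\<inverse>) a"
  unfolding generated_def using gen_sym by blast

lemma generated_Id: "obj a \<Longrightarrow> generated a (Id_on (cells a)) a"
  unfolding generated_def using gen_Id by blast

lemma generated_edge: "edge_rel a g b \<Longrightarrow> generated a g b"
  unfolding generated_def by (rule exI[of _ "max (card a) (card b)"]) (auto intro: gen_edge)

section \<open>Relabellings and the integer action as products of moves\<close>

lemma basic_rel_Id: "basic_rel i [] 0 i [] v = Id_on (cells {(i, v)})"
  by (auto simp: basic_rel_def cells_def K_0)

lemma basic_rel_relabelling: "relabelling {(i, v)} (basic_rel i [] 0 j [] v) {(j, v)}"
  unfolding relabelling_def
  by (rule exI[of _ "\<lambda>_. (j, v)"]) (auto simp: basic_rel_def relabel_rel_def cells_def K_0)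

lemma move_kappa:
  assumes "v \<in> V" "\<bar>m\<bar> = 1" shows "move {(i, v)} (basic_rel i [] m i [] v) {(i, v)}"
proof -
  have "({(0, v)}, basic_rel 0 [] 1 0 [] v, {(0, v)}) \<in> base_moves"
    using assms by (simp add: base_moves_def)
  from move_relabel[OF move_base[OF this] basic_rel_relabelling basic_rel_relabelling]
  have *: "move {(i, v)} (basic_rel i [] 1 i [] v) {(i, v)}" by (simp add: basic_rel_comp)
  from assms(2) consider "m = 1" | "m = - 1" by linarith
  then show ?thesis
    using * move_sym[OF *] by cases (simp_all add: basic_rel_converse)
qed

lemma move_relabel_single:
  assumes "relabelling {p} g b" "snd p \<in> V" shows "move {p} g b"
proof -
  obtain i v where p: "p = (i, v)" by fastforce
  let ?q = "basic_rel i [] 0 0 [] v"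
  have q: "relabelling {p} ?q {(0, v)}" unfolding p by (rule basic_rel_relabelling)
  have "({(0, v)}, basic_rel 0 [] 0 0 [] v, {(0, v)}) \<in> base_moves"
    using assms by (simp add: base_moves_def p)
  from move_relabel[OF move_base[OF this] q relabelling_comp[OF relabelling_converse[OF q] assms(1)]]
  have m: "move {p} (?q O basic_rel 0 [] 0 0 [] v O ?q\<inverse> O g) b" .
  have "?q O basic_rel 0 [] 0 0 [] v O ?q\<inverse> O g = (?q O basic_rel 0 [] 0 0 [] v O ?q\<inverse>) O g"
    by (simp only: O_assoc)
  also have "?q O basic_rel 0 [] 0 0 [] v O ?q\<inverse> = Id_on (cells {p})"
    unfolding basic_rel_converse unfolding basic_rel_comp by (simp add: basic_rel_Id p)
  also have "Id_on (cells {p}) O g = g"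
    by (rule mor_Id_comp(1)[OF relabelling_mor[OF assms(1)]]) (use assms(2) in \<open>simp add: obj_def\<close>)
  finally show ?thesis using m by simp
qed

text \<open>The cells are moved one at a time. Disjointness of \<open>a\<close> and \<open>b\<close>
  prevents a moved cell from colliding with one still waiting.\<close>

lemma generated_relabelling_disjoint:
  assumes "finite a" "relabelling a f b" "obj a" "a \<inter> b = {}" "obj d" "d \<inter> (a \<union> b) = {}"
  shows "generated (a \<union> d) (f \<union> Id_on (cells d)) (b \<union> d)"
  using assms
proof (induction a arbitrary: f b d rule: finite_induct)
  case empty
  then have "b = {}" "f = {}" using relabelling_mor[of "{}" f b]
    by (auto simp: relabelling_def relabel_rel_def cells_def bij_betw_def)
  then show ?case using generated_Id[OF empty(4)] by simp
next
  case (insert p a)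
  have "relabelling ({p} \<union> a) f b" "{p} \<inter> a = {}" using insert by simp_all
  then obtain b1 b2 g h where s: "relabelling {p} g b1" "relabelling a h b2" "b1 \<inter> b2 = {}"
     "b = b1 \<union> b2" "f = g \<union> h" by (rule relabelling_split)
  have o: "obj {p}" "obj a" using insert.prems(2) by (auto simp: obj_def)
  have ob: "obj b1" "obj b2" using s o relabelling_obj by blast+
  have m: "move {p} g b1" using move_relabel_single[OF s(1)] o by (simp add: obj_def)
  have "edge_rel ({p} \<union> (a \<union> d)) (g \<union> Id_on (cells (a \<union> d))) (b1 \<union> (a \<union> d))"
    by (rule edge_relI[OF m]) (use o insert s in auto)
  then have e: "generated ({p} \<union> (a \<union> d)) (g \<union> Id_on (cells (a \<union> d))) (b1 \<union> (a \<union> d))"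
    by (rule generated_edge)
  have i: "generated (a \<union> (b1 \<union> d)) (h \<union> Id_on (cells (b1 \<union> d))) (b2 \<union> (b1 \<union> d))"
    by (rule insert.IH[OF s(2)]) (use o ob insert s in auto)
  have c: "(g \<union> Id_on (cells (a \<union> d))) O (h \<union> Id_on (cells (b1 \<union> d))) = f \<union> Id_on (cells d)"
    unfolding s(5) using s insert
    by (intro disjoint_moves_comp[OF move_mor[OF m] relabelling_mor[OF s(2) o(2)]]) auto
  have "b1 \<union> (a \<union> d) = a \<union> (b1 \<union> d)" "{p} \<union> (a \<union> d) = insert p a \<union> d"
    "b2 \<union> (b1 \<union> d) = b \<union> d" using s(4) by auto
  with generated_trans[OF e[unfolded this(1)] i] c show ?case by simp
qed

text \<open>Source and target may overlap, as in an exchange of two labels, so the relabelling is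
  factored through a fresh copy disjoint from both.\<close>

lemma generated_relabelling:
  assumes "relabelling a f b" "obj a" shows "generated a f b"
proof -
  have o: "obj b" "finite a" "finite b" using assms relabelling_obj by (auto simp: obj_def)
  then have "finite (a \<union> b)" by simp
  then obtain c q where c: "relabelling a q c" "c \<inter> (a \<union> b) = {}" using fresh_copy[OF o(2)] by blast
  have oc: "obj c" "finite c" using c assms relabelling_obj by (auto simp: obj_def)
  have "generated (a \<union> {}) (q \<union> Id_on (cells {})) (c \<union> {})"
    by (rule generated_relabelling_disjoint) (use c o assms in \<open>auto simp: obj_def\<close>)
  then have "generated a q c" by (simp add: cells_def)
  moreover have "generated (c \<union> {}) ((q\<inverse> O f) \<union> Id_on (cells {})) (b \<union> {})"
    by (rule generated_relabelling_disjoint)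
      (use c oc o assms relabelling_comp[OF relabelling_converse[OF c(1)] assms(1)] in \<open>auto simp: obj_def\<close>)
  then have "generated c (q\<inverse> O f) b" by (simp add: cells_def)
  ultimately have "generated a (q O q\<inverse> O f) b" using generated_trans by blast
  then show ?thesis
    unfolding mor_cancel(1)[OF relabelling_mor[OF c(1) assms(2)]]
      mor_Id_comp(1)[OF relabelling_mor[OF assms]] .
qed

text \<open>An expansion with prescribed labels, so that its target can be made to consist of cells
  already present in a given set.\<close>

definition expand_to :: "nat \<Rightarrow> nat \<Rightarrow> (edge \<Rightarrow> nat) \<Rightarrow> point_rel" where
  "expand_to l u c = {((l, e ## y), (c e, y)) | e y. e ## y \<in> X \<and> tl_of e = u}"

lemma move_expand_to:
  assumes "u \<in> V" "inj_on (\<lambda>e. (c e, hd_of e)) (out_arcs_of u)"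
  shows "move {(l, u)} (expand_to l u c) ((\<lambda>e. (c e, hd_of e)) ` out_arcs_of u)"
proof -
  \<comment> \<open>The label given by \<open>expand_rel\<close> is decoded to its edge, and
    \<open>c\<close> then assigns the wanted label.\<close>
  define h where "h = (\<lambda>(t, w). (c (from_nat t), w) :: nat \<times> nat)"
  have h: "h (to_nat e, w) = (c e, w)" for e w by (simp add: h_def)
  have "bij_betw h (expand_cells u) ((\<lambda>e. (c e, hd_of e)) ` out_arcs_of u)"
    using assms(2) by (auto simp: bij_betw_def expand_cells_def inj_on_def image_image h)
  then have "relabelling (expand_cells u) (relabel_rel h (expand_cells u))
      ((\<lambda>e. (c e, hd_of e)) ` out_arcs_of u)"
    unfolding relabelling_def by (intro exI[of _ h]) (auto simp: h_def)
  moreover have "({(0, u)}, expand_rel u, expand_cells u) \<in> base_moves"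
    using assms(1) by (simp add: base_moves_def)
  ultimately have "move {(l, u)} (basic_rel l [] 0 0 [] u O expand_rel u O relabel_rel h (expand_cells u))
     ((\<lambda>e. (c e, hd_of e)) ` out_arcs_of u)"
    by (intro move_relabel[OF move_base basic_rel_relabelling])
  moreover have "basic_rel l [] 0 0 [] u O expand_rel u O relabel_rel h (expand_cells u) = expand_to l u c"
  proof (intro equalityI subsetI)
    fix t assume "t \<in> expand_to l u c"
    then obtain e y where e: "t = ((l, e ## y), (c e, y))" "e ## y \<in> X" "tl_of e = u"
      unfolding expand_to_def by blast
    then have "e \<in> E" "y \<in> X" "s y = hd_of e" by (simp_all add: infinite_paths_SCons)
    then have "(to_nat e, y) \<in> cells (expand_cells u)"
      using e(3) unfolding cells_def expand_cells_iff mem_Collect_eq prod.case by blast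
    then have "((to_nat e, y), (c e, y)) \<in> relabel_rel h (expand_cells u)"
      unfolding relabel_rel_def using h[of e "s y"] by force
    moreover have "((0, e ## y), (to_nat e, y)) \<in> expand_rel u"
      using e unfolding expand_rel_def by blast
    moreover have "((l, e ## y), (0, e ## y)) \<in> basic_rel l [] 0 0 [] u"
      unfolding basic_rel_def
      by (intro CollectI exI[of _ "e ## y"]) (use e K_0[OF e(2)] in simp)
    ultimately show "t \<in> basic_rel l [] 0 0 [] u O expand_rel u O relabel_rel h (expand_cells u)"
      unfolding e(1) by blast
  next
    fix t assume "t \<in> basic_rel l [] 0 0 [] u O expand_rel u O relabel_rel h (expand_cells u)"
    then obtain t1 t2 t3 t4 where t: "t = (t1, t4)" "(t1, t2) \<in> basic_rel l [] 0 0 [] u"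
      "(t2, t3) \<in> expand_rel u" "(t3, t4) \<in> relabel_rel h (expand_cells u)" by blast
    from t(3) obtain e y where e: "t2 = (0, e ## y)" "t3 = (to_nat e, y)" "e ## y \<in> X" "tl_of e = u"
      unfolding expand_rel_def by blast
    from t(4) have "t4 = (c e, y)" unfolding relabel_rel_def e(2) by (auto simp: h)
    moreover from t(2) have "t1 = (l, e ## y)" unfolding basic_rel_def e(1) by (auto simp: K_0)
    ultimately show "t \<in> expand_to l u c" using e t(1) unfolding expand_to_def by blast
  qed
  ultimately show ?thesis by simp
qed

definition kappa_rel :: "(nat \<times> nat \<Rightarrow> int) \<Rightarrow> cell_set \<Rightarrow> point_rel" where
  "kappa_rel m a = {((i, x), (i, K (m (i, s x)) x)) | i x. (i, x) \<in> cells a}"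

text \<open>Moves provide the exponents 1 and -1 on one cell. Induction on the sum of the absolute
  values splits off one such unit, in the direction of \<open>sgn\<close>.\<close>

lemma generated_kappa_rel:
  assumes "obj a" shows "generated a (kappa_rel m a) a"
proof (induction "\<Sum>p\<in>a. nat \<bar>m p\<bar>" arbitrary: m rule: less_induct)
  case less
  have fin: "finite a" using assms by (simp add: obj_def)
  show ?case
  proof (cases "\<exists>p \<in> a. m p \<noteq> 0")
    case False
    then have "kappa_rel m a = Id_on (cells a)"
      by (auto simp: kappa_rel_def cells_def K_0)
    then show ?thesis using generated_Id[OF assms] by simp
  next
    case True
    then obtain i v where p: "(i, v) \<in> a" "m (i, v) \<noteq> 0" by auto
    define m' where "m' = m((i, v) := m (i, v) - sgn (m (i, v)))"
    define g where "g = basic_rel i [] (sgn (m (i, v))) i [] v \<union> Id_on (cells (a - {(i, v)}))"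
    have "v \<in> V" using p(1) assms by (auto simp: obj_def)
    have "(\<Sum>p\<in>a. nat \<bar>m' p\<bar>) < (\<Sum>p\<in>a. nat \<bar>m p\<bar>)"
      by (rule sum_strict_mono_ex1[OF fin]) (use p in \<open>auto simp: m'_def sgn_if intro!: bexI[of _ "(i, v)"]\<close>)
    then have 1: "generated a (kappa_rel m' a) a" by (rule less)
    have "move {(i, v)} (basic_rel i [] (sgn (m (i, v))) i [] v) {(i, v)}"
      by (rule move_kappa[OF \<open>v \<in> V\<close>]) (use p in \<open>auto simp: sgn_if\<close>)
    then have "edge_rel ({(i, v)} \<union> (a - {(i, v)})) g ({(i, v)} \<union> (a - {(i, v)}))"
      unfolding g_def by (rule edge_relI) (use assms in \<open>auto intro: obj_subset\<close>)
    moreover have "{(i, v)} \<union> (a - {(i, v)}) = a" using p by auto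
    ultimately have "edge_rel a g a" by metis
    with 1 have "generated a (kappa_rel m' a O g) a" by (metis generated_trans generated_edge)
    moreover have "kappa_rel m' a O g = kappa_rel m a"
    proof (intro equalityI subsetI)
      fix t assume "t \<in> kappa_rel m a"
      then obtain k x where t: "t = ((k, x), (k, K (m (k, s x)) x))" "x \<in> X" "(k, s x) \<in> a"
        by (auto simp: kappa_rel_def cells_def)
      then have "((k, x), (k, K (m' (k, s x)) x)) \<in> kappa_rel m' a"
        by (auto simp: kappa_rel_def cells_def)
      moreover have "((k, K (m' (k, s x)) x), (k, K (m (k, s x)) x)) \<in> g"
      proof (cases "(k, s x) = (i, v)")
        case True
        then have "((k, K (m' (k, s x)) x), (k, K (m (k, s x)) x)) \<in> basic_rel i [] (sgn (m (i, v))) i [] v"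
          unfolding basic_rel_def using t(2)
          by (intro CollectI exI[of _ "K (m' (k, s x)) x"]) (auto simp: K_add m'_def)
        then show ?thesis by (simp add: g_def)
      next
        case False
        then show ?thesis using t by (auto simp: g_def m'_def cells_def)
      qed
      ultimately show "t \<in> kappa_rel m' a O g" using t(1) by blast
    next
      fix t assume "t \<in> kappa_rel m' a O g"
      then obtain k x y where t: "t = ((k, x), y)" "x \<in> X" "(k, s x) \<in> a" "((k, K (m' (k, s x)) x), y) \<in> g"
        by (auto simp: kappa_rel_def cells_def)
      have "y = (k, K (m (k, s x)) x)"
      proof (cases "(k, s x) = (i, v)")
        case True
        then have "((k, K (m' (k, s x)) x), y) \<in> basic_rel i [] (sgn (m (i, v))) i [] v"
          using t(4) by (auto simp: g_def cells_def)
        then have "y = (i, K (sgn (m (i, v))) (K (m' (k, s x)) x))"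
          unfolding basic_rel_def by auto
        also have "\<dots> = (k, K (m (k, s x)) x)"
          unfolding K_add[OF t(2)] using True by (simp add: m'_def)
        finally show ?thesis .
      next
        case False
        then have "((k, K (m' (k, s x)) x), y) \<notin> basic_rel i [] (sgn (m (i, v))) i [] v"
          unfolding basic_rel_def by auto
        with t(4) have "y = (k, K (m' (k, s x)) x)" by (simp add: g_def Id_on_iff)
        then show ?thesis using False by (auto simp: m'_def)
      qed
      then show "t \<in> kappa_rel m a" using t by (auto simp: kappa_rel_def cells_def)
    qed
    ultimately show ?thesis by simp
  qed
qed


section \<open>Prefix maps as products of inverse expansions\<close>

definition prefix_rel :: "(nat \<times> nat \<Rightarrow> nat \<times> edge list) \<Rightarrow> cell_set \<Rightarrow> point_rel" where
  "prefix_rel F a = {((i, x), (fst (F (i, s x)), snd (F (i, s x)) @- x)) | i x. (i, x) \<in> cells a}"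

lemma prefix_relI:
  "x \<in> X \<Longrightarrow> (i, s x) \<in> a \<Longrightarrow> F (i, s x) = (j, p) \<Longrightarrow> ((i, x), (j, p @- x)) \<in> prefix_rel F a"
  unfolding prefix_rel_def by (auto simp: cells_def intro!: exI[of _ i] exI[of _ x])

lemma prefix_relE:
  assumes "t \<in> prefix_rel F a"
  obtains i x j p where "t = ((i, x), (j, p @- x))" "x \<in> X" "(i, s x) \<in> a" "F (i, s x) = (j, p)"
  using assms unfolding prefix_rel_def by (auto simp: cells_def) (metis prod.collapse)

text \<open>A prefix map onto the cells \<open>b\<close> undoes a sequence of expansions of \<open>b\<close>: the cells with a longest
  prefix \<open>q e\<close> come together with all \<open>q e'\<close>, \<open>e'\<close> starting where \<open>e\<close> does.\<close>

lemma longest_prefix_siblings: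
  assumes f: "mor a (prefix_rel F a) b" and p: "(i0, v0) \<in> a" "F (i0, v0) = (j0, q @ [e0])"
    and max: "\<And>p. p \<in> a \<Longrightarrow> length (snd (F p)) \<le> Suc (length q)"
    and e: "e \<in> E" "tl_of e = tl_of e0"
  shows "\<exists>i. (i, hd_of e) \<in> a \<and> F (i, hd_of e) = (j0, q @ [e])"
proof -
  have D: "Range (prefix_rel F a) = cells b" and S: "single_valued ((prefix_rel F a)\<inverse>)"
    and V: "v0 \<in> V" using f p by (auto simp: mor_def obj_def)
  obtain x0 where x0: "x0 \<in> X" "s x0 = v0" using path_from[OF V] by blast
  have m0: "((i0, x0), (j0, q @- (e0 ## x0))) \<in> prefix_rel F a"
    using prefix_relI[of x0 i0 a F j0 "q @ [e0]"] x0 p by simp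
  then have c0: "(j0, q @- (e0 ## x0)) \<in> cells b" unfolding D[symmetric] by blast
  then have q0: "q @- (e0 ## x0) \<in> X" by (simp add: cells_def)
  then have e0x0: "e0 ## x0 \<in> X" by (rule shift_in_X(1))
  obtain y where y: "y \<in> X" "s y = hd_of e" using path_from[OF arc_ends(2)[OF e(1)]] by blast
  then have ey: "e ## y \<in> X" using e by (simp add: infinite_paths_SCons)
  have "q @- (e ## y) \<in> X \<and> s (q @- (e ## y)) = s (q @- (e0 ## x0))"
    by (rule shift_in_X(2)[OF q0 ey]) (simp add: e)
  then have "(j0, q @- (e ## y)) \<in> cells b" using c0 by (simp add: cells_def)
  then obtain u where "(u, (j0, q @- (e ## y))) \<in> prefix_rel F a" unfolding D[symmetric] by blast
  then obtain i x r where x: "x \<in> X" "(i, s x) \<in> a" "F (i, s x) = (j0, r)" "q @- (e ## y) = r @- x"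
    by (elim prefix_relE) simp
  have r: "length r \<le> Suc (length q)" using max[OF x(2)] x(3) by simp
  have "length r = Suc (length q)"
  proof (rule ccontr)
    assume "length r \<noteq> Suc (length q)"
    with r have "length r \<le> length q" by simp
    \<comment> \<open>If the prefix \<open>r\<close> through which \<open>q @- (e ## y)\<close> is
      reached were no longer than \<open>q\<close>, its cell would reach
      \<open>q @- (e0 ## x0)\<close> as well. That point already comes from \<open>(i0, x0)\<close>,
      so injectivity would give \<open>r = q @ [e0]\<close>.\<close>
    define r2 where "r2 = drop (length r) q"
    have "take (length r) q @- (r2 @- (e ## y)) = r @- x"
      unfolding r2_def using x(4) by (metis append_take_drop_id shift_append)
    from shift_eqD[OF _ this] \<open>length r \<le> length q\<close>
    have r2: "take (length r) q = r" "x = r2 @- (e ## y)" by simp_all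
    have x': "r2 @- (e0 ## x0) \<in> X \<and> s (r2 @- (e0 ## x0)) = s (r2 @- (e ## y))"
      by (rule shift_in_X(2)[OF _ e0x0]) (use x(1) e in \<open>simp_all add: r2(2)\<close>)
    have "r @- r2 @- (e0 ## x0) = q @- (e0 ## x0)"
      using r2(1) unfolding r2_def by (metis append_take_drop_id shift_append)
    moreover have "((i, r2 @- (e0 ## x0)), (j0, r @- r2 @- (e0 ## x0))) \<in> prefix_rel F a"
      using x' x(2,3) by (intro prefix_relI) (simp_all add: r2(2))
    ultimately have "(i, r2 @- (e0 ## x0)) = (i0, x0)"
      using m0 S unfolding single_valued_def converse_iff by metis
    then have "(i, s x) = (i0, v0)" using x' x0 by (simp add: r2(2))
    with x(3) p(2) have "r = q @ [e0]" by simp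
    then have "length r = Suc (length q)" by simp
    with \<open>length r \<noteq> Suc (length q)\<close> show False ..
  qed
  then have "length (q @ [e]) = length r" by simp
  moreover have "(q @ [e]) @- y = r @- x" using x(4) by simp
  ultimately have qy: "q @ [e] = r" "y = x" by (rule shift_eqD)+
  have "(i, hd_of e) \<in> a" "F (i, hd_of e) = (j0, q @ [e])"
    using x(2,3) y(2) unfolding qy by simp_all
  then show ?thesis by blast
qed

text \<open>Without prefixes only labels change. As every vertex emits a path, bijectivity on points
  can be tested on one path per cell and becomes bijectivity on cells.\<close>

lemma prefix_rel_relabelling:
  assumes f: "mor a (prefix_rel F a) b" and Nil: "\<And>p. p \<in> a \<Longrightarrow> snd (F p) = []"
  shows "relabelling a (prefix_rel F a) b"
proof -
  have D: "Range (prefix_rel F a) = cells b" and S: "single_valued ((prefix_rel F a)\<inverse>)"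
    and V: "snd ` a \<subseteq> V" "snd ` b \<subseteq> V" using f by (auto simp: mor_def obj_def)
  define H where "H = (\<lambda>p. (fst (F p), snd p))"
  have F: "F p = (fst (F p), [])" if "p \<in> a" for p using Nil[OF that] by (simp add: prod_eq_iff)
  have "prefix_rel F a = relabel_rel H a"
    unfolding prefix_rel_def relabel_rel_def H_def using Nil by (force simp: cells_def)
  moreover have "inj_on H a"
  proof (rule inj_onI)
    fix p p' assume p: "p \<in> a" "p' \<in> a" "H p = H p'"
    then have v: "snd p' = snd p" "fst (F p') = fst (F p)" by (simp_all add: H_def)
    obtain x where x: "x \<in> X" "s x = snd p" using path_from V p by blast
    have e: "(fst p, s x) = p" "(fst p', s x) = p'" using x(2) v(1) by (simp_all add: prod_eq_iff)
    have Fp': "F p' = (fst (F p), [])" using F[OF p(2)] v(2) by simp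
    have "((fst p, x), (fst (F p), [] @- x)) \<in> prefix_rel F a"
      by (rule prefix_relI[OF x(1)], unfold e(1), rule p(1), rule F[OF p(1)])
    moreover have "((fst p', x), (fst (F p), [] @- x)) \<in> prefix_rel F a"
      by (rule prefix_relI[OF x(1)], unfold e(2), rule p(2), rule Fp')
    ultimately have "(fst p, x) = (fst p', x)" using S unfolding single_valued_def converse_iff by blast
    with v show "p = p'" by (simp add: prod_eq_iff)
  qed
  moreover have "H ` a = b"
  proof (intro equalityI subsetI)
    fix t assume "t \<in> H ` a"
    then obtain p where p: "p \<in> a" "t = H p" by blast
    obtain x where x: "x \<in> X" "s x = snd p" using path_from V p by blast
    have "((fst p, x), (fst (F p), [] @- x)) \<in> prefix_rel F a"
      by (rule prefix_relI; use x p F[OF p(1)] in simp)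
    then have "(fst (F p), x) \<in> cells b" unfolding D[symmetric] by auto
    then show "t \<in> b" using p x by (simp add: cells_def H_def)
  next
    fix t assume t: "t \<in> b"
    obtain x where x: "x \<in> X" "s x = snd t" using path_from V t by blast
    then have "(fst t, x) \<in> cells b" using t by (simp add: cells_def)
    then obtain u where "(u, (fst t, x)) \<in> prefix_rel F a" unfolding D[symmetric] by blast
    then obtain i z p where z: "(i, s z) \<in> a" "F (i, s z) = (fst t, p)" "x = p @- z"
      by (elim prefix_relE) simp
    have "p = []" using Nil[OF z(1)] z(2) by simp
    then have "z = x" using z(3) by simp
    have "H (i, s z) = t" using z(2) x(2) \<open>z = x\<close> by (simp add: H_def)
    with z(1) show "t \<in> H ` a" by (intro image_eqI[OF sym])
  qed
  ultimately show ?thesis unfolding relabelling_def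
    by (intro exI[of _ H]) (simp add: bij_betw_def H_def)
qed

text \<open>Induction on the total length of the prefixes: all cells whose prefixes extend
  \<open>q\<close> by one edge from \<open>u\<close> are the expansion of a single cell with prefix
  \<open>q\<close>, and undoing this expansion shortens the total.\<close>

lemma generated_prefix_rel: "mor a (prefix_rel F a) b \<Longrightarrow> generated a (prefix_rel F a) b"
proof (induction "\<Sum>p\<in>a. length (snd (F p))" arbitrary: a F rule: less_induct)
  case less
  note f = less.prems
  have oa: "obj a" "finite a" "snd ` a \<subseteq> V" using f by (auto simp: mor_def obj_def)
  show ?case
  proof (cases "\<exists>p \<in> a. snd (F p) \<noteq> []")
    case False
    then show ?thesis using generated_relabelling[OF prefix_rel_relabelling[OF f] oa(1)] by blast
  next
    case True
    then have "a \<noteq> {}" by blast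
    let ?len = "\<lambda>p. length (snd (F p))"
    define M where "M = Max (?len ` a)"
    have "M \<in> ?len ` a" unfolding M_def using oa(2) \<open>a \<noteq> {}\<close> by (intro Max_in) auto
    moreover have M: "?len p \<le> M" if "p \<in> a" for p unfolding M_def using oa(2) that by simp
    moreover have "M \<noteq> 0"
    proof -
      from True obtain p where "p \<in> a" "snd (F p) \<noteq> []" by blast
      then have "0 < ?len p" "?len p \<le> M" using M by simp_all
      then show ?thesis by linarith
    qed
    ultimately obtain p0 where p0: "p0 \<in> a" "?len p0 = M" "snd (F p0) \<noteq> []" by auto
    obtain i0 v0 where iv: "p0 = (i0, v0)" by fastforce
    obtain j0 q e0 where F0: "F p0 = (j0, q @ [e0])"
      using p0(3) by (metis prod.collapse rev_exhaust)
    have Mq: "M = Suc (length q)" using p0(2) F0 by simp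
    define u where "u = tl_of e0"
    have sib: "\<exists>i. (i, hd_of e) \<in> a \<and> F (i, hd_of e) = (j0, q @ [e])"
      if "e \<in> E" "tl_of e = u" for e
      by (rule longest_prefix_siblings[OF f, of i0 v0]) (use p0 F0 M Mq iv that u_def in auto)
    have "e0 \<in> E"
    proof -
      have "v0 \<in> V" using oa(3) p0(1) iv by auto
      then obtain x where x: "x \<in> X" "s x = v0" using path_from by blast
      have "((i0, x), (j0, (q @ [e0]) @- x)) \<in> prefix_rel F a"
        by (rule prefix_relI) (use x p0 F0 iv in auto)
      then have "(q @ [e0]) @- x \<in> X" using f by (auto simp: mor_def cells_def)
      then have "e0 ## x \<in> X" using shift_in_X(1)[of q "e0 ## x"] by simp
      then show ?thesis by (simp add: infinite_paths_SCons)
    qed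
    then have uV: "u \<in> V" unfolding u_def by (rule arc_ends)
    define c where "c e = (SOME i. (i, hd_of e) \<in> a \<and> F (i, hd_of e) = (j0, q @ [e]))" for e
    have c: "(c e, hd_of e) \<in> a" "F (c e, hd_of e) = (j0, q @ [e])" if "e \<in> E" "tl_of e = u" for e
      using someI_ex[OF sib[OF that]] unfolding c_def by blast+
    define k where "k = (\<lambda>e. (c e, hd_of e)) ` out_arcs_of u"
    have inj: "inj_on (\<lambda>e. (c e, hd_of e)) (out_arcs_of u)"
    proof (rule inj_onI)
      fix e e' assume "e \<in> out_arcs_of u" "e' \<in> out_arcs_of u" "(c e, hd_of e) = (c e', hd_of e')"
      then have e: "e \<in> E" "tl_of e = u" "e' \<in> E" "tl_of e' = u" "c e = c e'" "hd_of e = hd_of e'"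
        unfolding out_arcs_of_def by blast+
      from c(2)[OF e(1,2)] have "F (c e', hd_of e') = (j0, q @ [e])" unfolding e(5,6) .
      with c(2)[OF e(3,4)] show "e = e'" by simp
    qed
    have ka: "k \<subseteq> a" unfolding k_def out_arcs_of_def using c(1) by blast
    define d where "d = a - k"
    have kd: "a = k \<union> d" "k \<inter> d = {}" "d \<subseteq> a" using ka by (auto simp: d_def)
    obtain l where l: "l \<notin> fst ` a" using oa(2) ex_new_if_finite[of "fst ` a"] infinite_UNIV_nat by blast
    then have la: "(l, w) \<notin> a" for w by (metis fst_conv imageI)
    define a' where "a' = {(l, u)} \<union> d"
    define g where "g = expand_to l u c \<union> Id_on (cells d)"
    define F' where "F' = F((l, u) := (j0, q))"
    have mv: "move {(l, u)} (expand_to l u c) k" unfolding k_def by (rule move_expand_to[OF uV inj])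
    have edge: "edge_rel a' g a" unfolding a'_def g_def kd(1)
      by (rule edge_relI[OF mv obj_subset[OF oa(1) kd(3)]]) (use kd la in auto)
    have F'd: "F' p = F p" if "p \<in> d" for p using that la kd(3) by (auto simp: F'_def)
    \<comment> \<open>Expanding the merged cell and then attaching \<open>q @ [e]\<close> is the
      same as attaching \<open>q\<close>. This also shows that the shorter prefix map is an
      isomorphism, as the induction hypothesis demands.\<close>
    have eq: "prefix_rel F' a' = g O prefix_rel F a"
    proof (intro equalityI subsetI)
      fix t assume "t \<in> prefix_rel F' a'"
      then obtain i x j p where t: "t = ((i, x), (j, p @- x))" "x \<in> X" "(i, s x) \<in> a'" "F' (i, s x) = (j, p)"
        by (rule prefix_relE)
      show "t \<in> g O prefix_rel F a"
      proof (cases "(i, s x) = (l, u)")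
        case True
        then have jp: "j = j0" "p = q" using t(4) by (simp_all add: F'_def)
        obtain e y where x: "x = e ## y" by (cases x)
        then have e: "e \<in> E" "y \<in> X" "s y = hd_of e" "tl_of e = u"
          using t(2) True by (simp_all add: infinite_paths_SCons)
        have "((i, x), (c e, y)) \<in> g" using True t(2) e x unfolding g_def expand_to_def by blast
        moreover have "((c e, y), (j0, (q @ [e]) @- y)) \<in> prefix_rel F a"
          by (rule prefix_relI) (use c[OF e(1,4)] e in simp_all)
        ultimately show ?thesis unfolding t(1) jp x by auto
      next
        case False
        then have "(i, s x) \<in> d" using t(3) by (auto simp: a'_def)
        then have "((i, x), (i, x)) \<in> g" "((i, x), (j, p @- x)) \<in> prefix_rel F a"
          using t F'd kd(3) by (auto simp: g_def cells_def intro!: prefix_relI)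
        then show ?thesis unfolding t(1) by blast
      qed
    next
      fix t assume "t \<in> g O prefix_rel F a"
      then obtain t1 t2 t3 where t: "t = (t1, t3)" "(t1, t2) \<in> g" "(t2, t3) \<in> prefix_rel F a" by blast
      from t(3) obtain i x j p where x: "(t2, t3) = ((i, x), (j, p @- x))" "x \<in> X" "(i, s x) \<in> a" "F (i, s x) = (j, p)"
        by (rule prefix_relE)
      from t(2) consider "(t1, t2) \<in> expand_to l u c" | "t1 = t2" "t2 \<in> cells d" by (auto simp: g_def)
      then show "t \<in> prefix_rel F' a'"
      proof cases
        case 1
        then obtain e y where e: "t1 = (l, e ## y)" "t2 = (c e, y)" "e ## y \<in> X" "tl_of e = u"
          unfolding expand_to_def by blast
        then have "e \<in> E" "s y = hd_of e" by (simp_all add: infinite_paths_SCons)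
        then have "j = j0" "p = q @ [e]" "i = c e" "x = y" using x e c(2)[of e] by auto
        then have "t = ((l, e ## y), (j0, q @- (e ## y)))" using t(1) e(1) x(1) by simp
        moreover have "((l, e ## y), (j0, q @- (e ## y))) \<in> prefix_rel F' a'"
          by (rule prefix_relI) (use e in \<open>simp_all add: a'_def F'_def\<close>)
        ultimately show ?thesis by simp
      next
        case 2
        then have "(i, s x) \<in> d" using x(1) by (simp add: cells_def)
        then show ?thesis using 2 x t(1) F'd by (auto simp: a'_def intro!: prefix_relI)
      qed
    qed
    have gm: "mor a' g a" using edge by (rule edge_rel_mor)
    have f': "mor a' (prefix_rel F' a') b" unfolding eq using gm f by (rule mor_comp)
    have fin: "finite d" "finite k" using oa(2) kd(1) by auto
    have "(l, u) \<notin> d" using la kd(3) by blast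
    then have "(\<Sum>p\<in>a'. length (snd (F' p))) = length q + (\<Sum>p\<in>d. length (snd (F p)))"
      using fin F'd by (simp add: a'_def F'_def)
    moreover have "(\<Sum>p\<in>a. ?len p) = (\<Sum>p\<in>k. ?len p) + (\<Sum>p\<in>d. ?len p)"
      unfolding kd(1) by (rule sum.union_disjoint[OF fin(2,1) kd(2)])
    moreover have "(c e0, hd_of e0) \<in> k" "?len (c e0, hd_of e0) = Suc (length q)"
      using \<open>e0 \<in> E\<close> c(2)[OF \<open>e0 \<in> E\<close>] unfolding k_def out_arcs_of_def u_def by auto
    then have "Suc (length q) \<le> (\<Sum>p\<in>k. ?len p)"
      using member_le_sum[of "(c e0, hd_of e0)" k ?len] fin by simp
    \<comment> \<open>The one prefix \<open>q\<close> replaces the prefixes of all siblings; among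
      these \<open>q @ [e0]\<close> alone is already longer.\<close>
    ultimately have "(\<Sum>p\<in>a'. length (snd (F' p))) < (\<Sum>p\<in>a. ?len p)" by simp
    from less.hyps[OF this f'] generated_sym[OF generated_edge[OF edge]]
    have "generated a (g\<inverse> O prefix_rel F' a') b" using generated_trans by blast
    then show ?thesis
      unfolding eq mor_cancel(2)[OF gm] mor_Id_comp(1)[OF f] .
  qed
qed


section \<open>A uniform depth at which a morphism is given by formulas\<close>

definition tabulated :: "point_rel \<Rightarrow> nat \<Rightarrow> edge list \<Rightarrow> nat \<Rightarrow> bool" where
  "tabulated f i p w \<longleftrightarrow> (\<exists>m j q. walk_to w p \<and> walk_to w q \<and> basic_rel i p m j q w \<subseteq> f)"

lemma tabulated_refine:
  assumes "tabulated f i (stake n x) (s (sdrop n x))" "x \<in> X" "n \<le> n'"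
  shows "tabulated f i (stake n' x) (s (sdrop n' x))"
proof -
  from assms(1) obtain m j q where *: "walk_to (s (sdrop n x)) (stake n x)" "walk_to (s (sdrop n x)) q"
    "basic_rel i (stake n x) m j q (s (sdrop n x)) \<subseteq> f" unfolding tabulated_def by blast
  have "sdrop n x \<in> X" by (rule shift_in_X(1)[of "stake n x"]) (simp add: assms(2) stake_sdrop)
  note r = basic_rel_refine[OF *(1,2) this refl, where n = "n' - n"]
  have e: "stake n x @ stake (n' - n) (sdrop n x) = stake n' x" "sdrop (n' - n) (sdrop n x) = sdrop n' x"
    using assms(3) by (simp_all add: stake_add sdrop_add)
  show ?thesis
    using r(3,4) subset_trans[OF r(1) *(3)] unfolding e tabulated_def by blast
qed

lemma s_sdrop: "z \<in> X \<Longrightarrow> s (sdrop (Suc n) z) = hd_of (z !! n)"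
proof -
  assume "z \<in> X"
  then have "hd_of (z !! n) = tl_of (z !! Suc n)" unfolding infinite_paths_def by blast
  moreover have "shd (sdrop (Suc n) z) = z !! Suc n" using sdrop_simps(1) .
  ultimately show ?thesis by (simp only: ipath_source_def)
qed

lemma tabulated_exists:
  assumes "mor a f b" "(i, x) \<in> cells a"
  shows "\<exists>n. tabulated f i (stake n x) (s (sdrop n x))"
proof -
  from assms obtain t where "((i, x), t) \<in> f" unfolding mor_def by blast
  moreover have "local_rel f" using assms(1) by (simp add: mor_def)
  ultimately obtain i' p m j q w where *: "walk_to w p" "walk_to w q" "((i, x), t) \<in> basic_rel i' p m j q w"
     "basic_rel i' p m j q w \<subseteq> f" unfolding local_rel_def by blast
  then obtain y where "i' = i" "x = p @- y" "s y = w" by (auto simp: basic_rel_def)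
  with * show ?thesis
    by (intro exI[of _ "length p"]) (auto simp: tabulated_def stake_shift)
qed

text \<open>Koenig's lemma for the tree of those finite paths on whose cylinders no depth is sufficient.\<close>

lemma tabulated_uniform:
  assumes f: "mor a f b"
  obtains n where "\<And>i x. (i, x) \<in> cells a \<Longrightarrow> tabulated f i (stake n x) (s (sdrop n x))"
proof -
  define Q where "Q i p n \<longleftrightarrow> (\<forall>y. p @- y \<in> X \<longrightarrow> (i, s (p @- y)) \<in> a \<longrightarrow>
      tabulated f i (stake n (p @- y)) (s (sdrop n (p @- y))))" for i p n
  have mono: "Q i p n'" if "Q i p n" "n \<le> n'" for i p n n'
    using that tabulated_refine unfolding Q_def by blast
  define bad where "bad i p \<longleftrightarrow> (\<forall>n. \<not> Q i p n)" for i p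
  have ext: "\<exists>e. bad i (p @ [e])" if "bad i p" for i p
  proof (rule ccontr)
    assume "\<nexists>e. bad i (p @ [e])"
    \<comment> \<open>Finitely many edges and monotonicity give one depth for all extensions of
      \<open>p\<close> by an edge, and it is sufficient for \<open>p\<close> itself.\<close>
    then have "\<exists>n. \<forall>e \<in> E. Q i (p @ [e]) n"
      by (intro bounded_choice[OF finite_arcs]) (use mono in \<open>auto simp: bad_def\<close>)
    then obtain n where n: "\<And>e. e \<in> E \<Longrightarrow> Q i (p @ [e]) n" by blast
    have "Q i p n" unfolding Q_def
    proof (intro allI impI)
      fix y assume y: "p @- y \<in> X" "(i, s (p @- y)) \<in> a"
      obtain e z where e: "y = e ## z" by (cases y)
      have "e ## z \<in> X" using shift_in_X(1)[OF y(1)] unfolding e .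
      then have eE: "e \<in> E" by (simp add: infinite_paths_SCons)
      have eq: "(p @ [e]) @- z = p @- y" by (simp add: e)
      show "tabulated f i (stake n (p @- y)) (s (sdrop n (p @- y)))"
        using n[OF eE, unfolded Q_def, rule_format, of z] y unfolding eq by blast
    qed
    with that show False by (simp add: bad_def)
  qed
  have "\<not> bad i []" for i
  proof
    assume "bad i []"
    then have "\<exists>P. \<forall>n. (bad i (P n) \<and> length (P n) = n) \<and> (\<exists>e. P (Suc n) = P n @ [e])"
      by (intro dependent_nat_choice) (use ext in \<open>force+\<close>)
    then obtain P where P: "\<And>n. bad i (P n)" "\<And>n. length (P n) = n" "\<And>n. \<exists>e. P (Suc n) = P n @ [e]"
      by blast
    define x where "x = smap (\<lambda>n. last (P (Suc n))) nats"
    have Px: "stake n x = P n" for n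
    proof (induction n)
      case (Suc n)
      obtain e where "P (Suc n) = P n @ [e]" using P(3) by blast
      then have "P (Suc n) = P n @ [x !! n]" by (simp add: x_def del: snth.simps)
      with Suc show ?case by (simp add: stake_Suc del: stake.simps)
    qed (use P(2)[of 0] in simp)
    have wit: "\<exists>y. P k @- y \<in> X \<and> (i, s (P k @- y)) \<in> a \<and>
        \<not> tabulated f i (stake n (P k @- y)) (s (sdrop n (P k @- y)))" for k n
      using P(1)[of k] unfolding bad_def Q_def by blast
    have nth: "(P k @- y) !! n = x !! n" if "n < k" for k n y
      using that by (simp add: Px[symmetric] shift_snth_less stake_nth del: snth.simps)
    have "x !! n \<in> E \<and> hd_of (x !! n) = tl_of (x !! Suc n)" for n
    proof -
      obtain y where "P (Suc (Suc n)) @- y \<in> X" using wit by blast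
      then have "(P (Suc (Suc n)) @- y) !! n \<in> E \<and>
          hd_of ((P (Suc (Suc n)) @- y) !! n) = tl_of ((P (Suc (Suc n)) @- y) !! Suc n)"
        unfolding infinite_paths_def by blast
      then show ?thesis by (simp add: nth del: snth.simps)
    qed
    then have x: "x \<in> X" unfolding infinite_paths_def by blast
    have "s (P (Suc k) @- y) = s x" for k y
      using nth[of 0 "Suc k" y] by (simp add: ipath_source_def)
    moreover obtain y where "(i, s (P (Suc 0) @- y)) \<in> a" using wit by blast
    ultimately have "(i, x) \<in> cells a" using x by (simp add: cells_def)
    then obtain n where n: "tabulated f i (stake n x) (s (sdrop n x))" using tabulated_exists[OF f] by blast
    \<comment> \<open>The depth is raised to \<open>Suc n\<close> because the source of the
      remaining path is then the head of the last edge cut off, which \<open>x\<close> shares with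
      the witness below.\<close>
    have "tabulated f i (stake (Suc n) x) (s (sdrop (Suc n) x))"
      by (rule tabulated_refine[OF n x]) simp
    moreover obtain y where y: "P (Suc n) @- y \<in> X"
       "\<not> tabulated f i (stake (Suc n) (P (Suc n) @- y)) (s (sdrop (Suc n) (P (Suc n) @- y)))"
      using wit by blast
    moreover have "s (sdrop (Suc n) (P (Suc n) @- y)) = s (sdrop (Suc n) x)"
      unfolding s_sdrop[OF y(1)] s_sdrop[OF x] nth[OF lessI] ..
    moreover have "stake (Suc n) (P (Suc n) @- y) = stake (Suc n) x"
      unfolding Px using P(2)[of "Suc n"] by (simp add: stake_shift del: stake.simps)
    ultimately show False by simp
  qed
  then have "\<exists>n. \<forall>i \<in> fst ` a. Q i [] n"
    by (intro bounded_choice) (use f mono in \<open>auto simp: bad_def mor_def obj_def\<close>)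
  then obtain n where n: "\<And>i. i \<in> fst ` a \<Longrightarrow> Q i [] n" by blast
  show thesis
  proof (rule that)
    fix i x assume "(i, x) \<in> cells a"
    then have "x \<in> X" "(i, s x) \<in> a" by (auto simp: cells_def)
    moreover from this have "Q i [] n" using n by force
    ultimately show "tabulated f i (stake n x) (s (sdrop n x))" by (simp add: Q_def)
  qed
qed

lemma prefix_rel_local:
  assumes "\<And>l w. (l, w) \<in> a \<Longrightarrow> walk_to w (snd (F (l, w)))"
  shows "local_rel (prefix_rel F a)"
  unfolding local_rel_def
proof
  fix t assume "t \<in> prefix_rel F a"
  then obtain i x j p where t: "t = ((i, x), (j, p @- x))" "x \<in> X" "(i, s x) \<in> a" "F (i, s x) = (j, p)"
    by (rule prefix_relE)
  have "t \<in> basic_rel i [] 0 j p (s x)" unfolding basic_rel_def t(1)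
    by (intro CollectI exI[of _ x]) (simp add: t(2) K_0)
  moreover have "basic_rel i [] 0 j p (s x) \<subseteq> prefix_rel F a"
  proof
    fix u assume "u \<in> basic_rel i [] 0 j p (s x)"
    then obtain y where "u = ((i, y), (j, p @- y))" "y \<in> X" "s y = s x"
      by (auto simp: basic_rel_def K_0)
    then show "u \<in> prefix_rel F a" using t(3,4) by (auto intro!: prefix_relI)
  qed
  moreover have "walk_to (s x) p" using assms[OF t(3)] t(4) by simp
  ultimately show "\<exists>i p m j q w. walk_to w p \<and> walk_to w q \<and> t \<in> basic_rel i p m j q w \<and>
     basic_rel i p m j q w \<subseteq> prefix_rel F a" using walk_to_Nil by blast
qed

text \<open>The label encodes the old label and the prefix cut off, so \<open>cylinder_map\<close>
  can read both back from it.\<close>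

definition cylinders :: "cell_set \<Rightarrow> nat \<Rightarrow> cell_set" where
  "cylinders a n = (\<lambda>(i, x). (to_nat (i, stake n x), s (sdrop n x))) ` cells a"

definition cylinder_map :: "nat \<times> nat \<Rightarrow> nat \<times> edge list" where
  "cylinder_map p = from_nat (fst p)"

lemma cylindersE:
  assumes "(l, w) \<in> cylinders a n"
  obtains i x where "(i, x) \<in> cells a" "l = to_nat (i, stake n x)" "w = s (sdrop n x)"
    "cylinder_map (l, w) = (i, stake n x)"
  using assms unfolding cylinders_def cylinder_map_def by auto

lemma sdrop_in_X: "x \<in> X \<Longrightarrow> sdrop n x \<in> X"
  by (rule shift_in_X(1)[of "stake n x"]) (simp add: stake_sdrop)

text \<open>Injectivity rests on all prefixes having the same length \<open>n\<close>: equal images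
  then have equal prefixes and equal remainders.\<close>

lemma cylinder_mor:
  assumes "obj a" shows "mor (cylinders a n) (prefix_rel cylinder_map (cylinders a n)) a"
proof -
  let ?c = "cylinders a n"
  have fin: "finite (fst ` a)" using assms by (simp add: obj_def)
  have sub: "?c \<subseteq> to_nat ` (fst ` a \<times> {p. set p \<subseteq> E \<and> length p = n}) \<times> V"
  proof
    fix t assume "t \<in> ?c"
    then obtain i x where t: "t = (to_nat (i, stake n x), s (sdrop n x))" "(i, x) \<in> cells a"
      unfolding cylinders_def by auto
    then have x: "x \<in> X" "i \<in> fst ` a" by (force simp: cells_def)+
    have "x !! k \<in> E" for k using x(1) unfolding infinite_paths_def by blast
    then have "set (stake n x) \<subseteq> E"
      unfolding set_conv_nth length_stake by (auto simp only: stake_nth)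
    moreover have "s (sdrop n x) \<in> V" using x(1) by (intro s_in_V sdrop_in_X)
    ultimately show "t \<in> to_nat ` (fst ` a \<times> {p. set p \<subseteq> E \<and> length p = n}) \<times> V"
      using t(1) x(2) by auto
  qed
  have oc: "obj ?c" unfolding obj_def
    using finite_subset[OF sub] sub fin finite_lists_length_eq[OF finite_arcs, of n] by fastforce
  have img: "(i, p @- y) \<in> cells a \<and> length p = n"
    if ly: "(l, y) \<in> cells ?c" "cylinder_map (l, s y) = (i, p)" for l y i p
  proof -
    from ly have "(l, s y) \<in> ?c" "y \<in> X" by (auto simp: cells_def)
    then obtain x where x: "(i, x) \<in> cells a" "p = stake n x" "s y = s (sdrop n x)"
      using ly(2) by (elim cylindersE) simp
    then have "x \<in> X" "x = p @- sdrop n x" by (simp_all add: cells_def stake_sdrop)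
    then have "p @- y \<in> X \<and> s (p @- y) = s x"
      using shift_in_X(2)[of p "sdrop n x" y] \<open>y \<in> X\<close> x(3) by metis
    with x show ?thesis by (simp add: cells_def)
  qed
  have "Domain (prefix_rel cylinder_map ?c) = cells ?c" unfolding prefix_rel_def by auto
  moreover have "Range (prefix_rel cylinder_map ?c) = cells a"
  proof (intro equalityI subsetI)
    fix t assume "t \<in> Range (prefix_rel cylinder_map ?c)"
    then show "t \<in> cells a" unfolding prefix_rel_def using img by auto
  next
    fix t assume "t \<in> cells a"
    obtain i x where t: "t = (i, x)" by fastforce
    then have x: "x \<in> X" using \<open>t \<in> cells a\<close> by (simp add: cells_def)
    have "(to_nat (i, stake n x), s (sdrop n x)) \<in> ?c"
      using \<open>t \<in> cells a\<close> unfolding t cylinders_def by force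
    then have "((to_nat (i, stake n x), sdrop n x), (i, stake n x @- sdrop n x)) \<in> prefix_rel cylinder_map ?c"
      by (intro prefix_relI sdrop_in_X[OF x]) (simp_all add: cylinder_map_def)
    then show "t \<in> Range (prefix_rel cylinder_map ?c)" unfolding t stake_sdrop by blast
  qed
  moreover have "single_valued (prefix_rel cylinder_map ?c)"
    unfolding prefix_rel_def single_valued_def by auto
  moreover have "single_valued ((prefix_rel cylinder_map ?c)\<inverse>)"
  proof (rule single_valuedI, unfold converse_iff)
    fix t u u' assume 1: "(u, t) \<in> prefix_rel cylinder_map ?c" and 2: "(u', t) \<in> prefix_rel cylinder_map ?c"
    from 1 obtain l y i p where u: "(u, t) = ((l, y), (i, p @- y))" "y \<in> X" "(l, s y) \<in> ?c"
      "cylinder_map (l, s y) = (i, p)" by (rule prefix_relE)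
    from 2 obtain l' y' i' p' where u': "(u', t) = ((l', y'), (i', p' @- y'))" "y' \<in> X" "(l', s y') \<in> ?c"
      "cylinder_map (l', s y') = (i', p')" by (rule prefix_relE)
    have eq: "i = i'" "p @- y = p' @- y'" using u(1) u'(1) by auto
    have "length p = n" "length p' = n"
      using img[of l y i p] img[of l' y' i' p'] u u' by (simp_all add: cells_def)
    then have "length p = length p'" by simp
    from shift_eqD[OF this eq(2)] have "p = p'" "y = y'" .
    with u u' eq have "cylinder_map (l, s y) = cylinder_map (l', s y)" "(l, s y) \<in> ?c" "(l', s y) \<in> ?c"
      by simp_all
    then have "l = l'" by (elim cylindersE) simp
    with u(1) u'(1) \<open>y = y'\<close> show "u = u'" by simp
  qed
  moreover have "local_rel (prefix_rel cylinder_map ?c)"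
  proof (rule prefix_rel_local)
    fix l w assume "(l, w) \<in> ?c"
    then obtain i x where *: "(i, x) \<in> cells a" "w = s (sdrop n x)" "cylinder_map (l, w) = (i, stake n x)"
      by (rule cylindersE)
    then have "stake n x @- sdrop n x \<in> X" by (simp add: cells_def stake_sdrop)
    from walk_to_shift[OF this] show "walk_to w (snd (cylinder_map (l, w)))" unfolding *(3) by (simp add: *(2))
  qed
  ultimately show ?thesis using oc assms by (simp add: mor_def)
qed

text \<open>After cutting the source into cylinders of uniform depth, \<open>f\<close> is on each of
  them a power of the integer action followed by attaching a prefix. All three ingredients are
  products of moves.\<close>

lemma mor_generated:
  assumes f: "mor a f b" shows "generated a f b"
proof -
  obtain n where n: "\<And>i x. (i, x) \<in> cells a \<Longrightarrow> tabulated f i (stake n x) (s (sdrop n x))"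
    using tabulated_uniform[OF f] by blast
  define c where "c = cylinders a n"
  define h where "h = prefix_rel cylinder_map c"
  have h: "mor c h a" unfolding c_def h_def using mor_objD(1)[OF f] by (rule cylinder_mor)
  have hf: "mor c (h O f) b" using h f by (rule mor_comp)
  have "\<exists>m r. fst t = l \<longrightarrow> snd t = w \<longrightarrow> (l, w) \<in> c \<longrightarrow>
      basic_rel (fst (cylinder_map t)) (snd (cylinder_map t)) m (fst r) (snd r) w \<subseteq> f" for t l w
  proof (cases "t = (l, w) \<and> (l, w) \<in> c")
    case True
    then obtain i x where *: "(i, x) \<in> cells a" "w = s (sdrop n x)" "cylinder_map (l, w) = (i, stake n x)"
      unfolding c_def by (auto elim: cylindersE)
    with n[OF *(1)] True show ?thesis unfolding tabulated_def by fastforce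
  qed auto
  then obtain m r where mr: "\<And>l w. (l, w) \<in> c \<Longrightarrow>
      basic_rel (fst (cylinder_map (l, w))) (snd (cylinder_map (l, w))) (m (l, w)) (fst (r (l, w))) (snd (r (l, w))) w \<subseteq> f"
    by (metis fst_conv snd_conv)
  have gk: "generated c (kappa_rel m c) c" using mor_objD(1)[OF h] by (rule generated_kappa_rel)
  then have k: "mor c (kappa_rel m c) c" unfolding generated_def using gen_mor by blast
  have pt: "((l, y), (fst (r (l, s y)), snd (r (l, s y)) @- K (m (l, s y)) y)) \<in> h O f"
    if "(l, y) \<in> cells c" for l y
  proof -
    obtain i p where ip: "cylinder_map (l, s y) = (i, p)" by fastforce
    have ly: "y \<in> X" "(l, s y) \<in> c" using that by (auto simp: cells_def)
    have "((l, y), (i, p @- y)) \<in> h" unfolding h_def using ly ip by (intro prefix_relI)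
    moreover have "((i, p @- y), (fst (r (l, s y)), snd (r (l, s y)) @- K (m (l, s y)) y)) \<in> f"
      by (rule subsetD[OF mr[OF ly(2)]]) (use ly ip in \<open>auto simp: basic_rel_def\<close>)
    ultimately show ?thesis by blast
  qed
  have eq: "h O f = kappa_rel m c O prefix_rel r c"
  proof (intro equalityI subsetI)
    fix t assume t: "t \<in> h O f"
    then obtain l y u where ly: "t = ((l, y), u)" "(l, y) \<in> cells c" using hf unfolding mor_def by fastforce
    then have u: "u = (fst (r (l, s y)), snd (r (l, s y)) @- K (m (l, s y)) y)"
      using pt[OF ly(2)] t hf unfolding mor_def single_valued_def by blast
    have "((l, y), (l, K (m (l, s y)) y)) \<in> kappa_rel m c" using ly(2) by (auto simp: kappa_rel_def)
    moreover have "((l, K (m (l, s y)) y), u) \<in> prefix_rel r c"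
      unfolding u by (rule prefix_relI) (use ly(2) in \<open>auto simp: cells_def\<close>)
    ultimately show "t \<in> kappa_rel m c O prefix_rel r c" unfolding ly(1) by blast
  next
    fix t assume "t \<in> kappa_rel m c O prefix_rel r c"
    then obtain l y u where ly: "t = ((l, y), u)" "(l, y) \<in> cells c"
      "((l, K (m (l, s y)) y), u) \<in> prefix_rel r c" by (auto simp: kappa_rel_def)
    then have "u = (fst (r (l, s y)), snd (r (l, s y)) @- K (m (l, s y)) y)"
      by (auto simp: prefix_rel_def)
    with pt[OF ly(2)] ly(1) show "t \<in> h O f" by simp
  qed
  have "prefix_rel r c \<subseteq> cells c \<times> UNIV" by (auto simp: prefix_rel_def)
  then have "Id_on (cells c) O prefix_rel r c = prefix_rel r c" by blast
  \<comment> \<open>Solving for the prefix map exhibits it as a product of isomorphisms, which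
    \<open>generated_prefix_rel\<close> requires.\<close>
  then have r: "prefix_rel r c = (kappa_rel m c)\<inverse> O (h O f)"
    unfolding eq mor_cancel(2)[OF k] by simp
  have "mor c (prefix_rel r c) b" unfolding r using mor_converse[OF k] hf by (rule mor_comp)
  then have "generated c (h O f) b"
    unfolding eq using gk generated_prefix_rel generated_trans by blast
  moreover have "generated c h a" using generated_prefix_rel h unfolding h_def by blast
  ultimately have "generated a (h\<inverse> O h O f) b" using generated_trans generated_sym by blast
  then show ?thesis unfolding mor_cancel(2)[OF h] mor_Id_comp(1)[OF f] .
qed


section \<open>Finite generation of automorphism groups\<close>

text \<open>No inverses are taken: the generators found below generate already as a monoid.\<close>

inductive_set products :: "cell_set \<Rightarrow> point_rel set \<Rightarrow> point_rel set" for a S where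
  products_Id: "Id_on (cells a) \<in> products a S"
| products_step: "f \<in> products a S \<Longrightarrow> g \<in> S \<Longrightarrow> f O g \<in> products a S"

definition standard_sets :: "nat \<Rightarrow> cell_set set" where
  "standard_sets R = {b. b \<subseteq> {..<R} \<times> V}"

lemma finite_standard_sets: "finite (standard_sets R)"
  unfolding standard_sets_def by (rule finite_subset[of _ "Pow ({..<R} \<times> V)"]) auto

text \<open>Representatives of all edges between sets of at most \<open>R\<close> cells. The
  bystanders take labels from a window of length \<open>R\<close> beyond the labels of
  \<open>c\<close> and \<open>c'\<close>, which guarantees disjointness and leaves finitely many
  choices.\<close>

definition standard_edges :: "nat \<Rightarrow> point_rel set" where
  "standard_edges R = (\<Union>(c, f, c') \<in> sym_moves.
     \<Union>d \<in> {d. d \<subseteq> {Suc (Max (insert 0 (fst ` (c \<union> c'))))..<Suc (Max (insert 0 (fst ` (c \<union> c')))) + R} \<times> V}.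
     \<Union>a \<in> standard_sets R. \<Union>b \<in> standard_sets R.
     \<Union>p \<in> {p. relabelling a p (c \<union> d)}. \<Union>q \<in> {q. relabelling (c' \<union> d) q b}.
       {p O (f \<union> Id_on (cells d)) O q})"

lemma finite_standard_edges: "finite (standard_edges R)"
proof -
  have fd: "finite {d. d \<subseteq> {i::nat..<j} \<times> V}" for i j
    by (rule finite_subset[of _ "Pow ({i..<j} \<times> V)"]) auto
  have fs: "finite b" if "b \<in> standard_sets R" for b
    using that by (auto simp: standard_sets_def intro: finite_subset)
  have fm: "finite c" "finite c'" if "(c, f, c') \<in> sym_moves" for c f c'
    using mor_objD[OF sym_moves_mor[OF that]] by (auto simp: obj_def)
  have fdd: "finite d" if "d \<subseteq> {i::nat..<j} \<times> V" for d i j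
    using that by (rule finite_subset) auto
  show ?thesis unfolding standard_edges_def
    using finite_sym_moves finite_standard_sets fd fs fm fdd
    by (auto intro!: finite_UN_I finite_relabellings)
qed

text \<open>The bystanders are moved into the window by \<open>w\<close>, and every relabelling that
  occurs is absorbed into the two outer ones.\<close>

lemma standard_edge:
  assumes "edge_rel a g b" "card a \<le> R"
    and "relabelling a p a'" "a' \<in> standard_sets R" "relabelling b q b'" "b' \<in> standard_sets R"
  shows "p\<inverse> O g O q \<in> standard_edges R"
proof -
  from assms(1) obtain k h k' d where 1: "move k h k'" "obj d" "k \<inter> d = {}" "k' \<inter> d = {}"
     "a = k \<union> d" "b = k' \<union> d" "g = h \<union> Id_on (cells d)" unfolding edge_rel_def by blast
  from 1(1) obtain c f c' r t where 2: "(c, f, c') \<in> sym_moves" "relabelling k r c"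
     "relabelling c' t k'" "h = r O f O t" unfolding move_def by blast
  have ob: "obj k" "obj k'" "obj c" "obj c'"
    using mor_objD[OF move_mor[OF 1(1)]] mor_objD[OF sym_moves_mor[OF 2(1)]] by auto
  define M where "M = Suc (Max (insert 0 (fst ` (c \<union> c'))))"
  have "finite d" using 1(2) by (simp add: obj_def)
  then obtain d' w where d': "relabelling d w d'" "d' \<subseteq> {M..<M + card d} \<times> snd ` d"
    using standard_copy by blast
  have "card d \<le> R" using assms(2) ob(1) 1(2) unfolding 1(5) obj_def
    by (meson card_mono finite_Un le_trans sup_ge2)
  then have d'R: "d' \<subseteq> {M..<M + R} \<times> V" using d'(2) 1(2) unfolding obj_def by fastforce
  have "fst u < M" if "u \<in> c \<union> c'" for u
    unfolding M_def using ob(3,4) that by (auto simp: obj_def less_Suc_eq_le intro!: Max_ge)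
  then have dis: "c \<inter> d' = {}" "c' \<inter> d' = {}" using d'R by fastforce+
  have od': "obj d'" using relabelling_obj[OF d'(1)] 1(2) by simp
  have r: "relabelling a' (p\<inverse> O (r \<union> w)) (c \<union> d')"
    by (rule relabelling_comp[OF relabelling_converse[OF assms(3)]])
      (unfold 1(5), rule relabelling_Un[OF 2(2) d'(1) 1(3) dis(1)])
  have t: "relabelling (c' \<union> d') ((t \<union> w\<inverse>) O q) b'"
    by (rule relabelling_comp[OF _ assms(5)])
      (unfold 1(6), rule relabelling_Un[OF 2(3) relabelling_converse[OF d'(1)] dis(2) 1(4)])
  have w: "mor d w d'" using relabelling_mor[OF d'(1) 1(2)] .
  have "Range r = cells c" "Domain f = cells c" "Range f = cells c'" "Domain t = cells c'"
    "Range w = cells d'"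
    using relabelling_mor[OF 2(2) ob(1)] sym_moves_mor[OF 2(1)] relabelling_mor[OF 2(3) ob(4)] w
    by (auto simp: mor_def)
  note R = this
  have D: "cells c \<inter> cells d' = {}" "cells c' \<inter> cells d' = {}" using cells_disjoint dis by blast+
  have "(f \<union> Id_on (cells d')) O (t \<union> w\<inverse>) = f O t \<union> Id_on (cells d') O w\<inverse>"
    by (rule Un_relcomp_disjoint) (use R D in auto)
  also have "Id_on (cells d') O w\<inverse> = w\<inverse>" by (rule mor_Id_comp(1)[OF mor_converse[OF w]])
  finally have "(r \<union> w) O (f \<union> Id_on (cells d')) O (t \<union> w\<inverse>) = (r \<union> w) O (f O t \<union> w\<inverse>)" by simp
  also have "\<dots> = r O f O t \<union> w O w\<inverse>"
    by (rule Un_relcomp_disjoint) (use R D in auto)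
  also have "w O w\<inverse> = Id_on (cells d)" by (rule mor_Id_comp(3)[OF w])
  finally have "g = (r \<union> w) O (f \<union> Id_on (cells d')) O (t \<union> w\<inverse>)" unfolding 1(7) 2(4) by simp
  then have eq: "p\<inverse> O g O q = (p\<inverse> O (r \<union> w)) O (f \<union> Id_on (cells d')) O ((t \<union> w\<inverse>) O q)"
    by (simp add: O_assoc)
  have dd: "d' \<in> {d. d \<subseteq> {Suc (Max (insert 0 (fst ` (c \<union> c'))))..<Suc (Max (insert 0 (fst ` (c \<union> c')))) + R} \<times> V}"
    using d'R unfolding M_def by simp
  show ?thesis unfolding standard_edges_def eq
    by (rule UN_I[OF 2(1)], unfold prod.case, rule UN_I[OF dd], rule UN_I[OF assms(4)],
        rule UN_I[OF assms(6)], rule UN_I, rule CollectI, rule r, rule UN_I, rule CollectI, rule t,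
        rule singletonI)
qed

text \<open>The usual generation of a vertex group by edge loops. Each visited set \<open>b\<close>
  is joined to \<open>a0\<close> by a fixed \<open>t b\<close>, and an edge from \<open>b\<close> to
  \<open>c\<close> becomes a loop at \<open>a0\<close>. This loop depends only on the standard forms
  of \<open>b\<close>, \<open>c\<close> and of the edge, so there are finitely many.\<close>

lemma gen_finitely_generated:
  assumes "obj a0" "card a0 \<le> R"
  obtains S where "finite S" "S \<subseteq> {f. mor a0 f a0}" "{f. gen R a0 f a0} \<subseteq> products a0 S"
proof -
  have "\<exists>p b. obj a \<longrightarrow> card a \<le> R \<longrightarrow> relabelling a p b \<and> b \<in> standard_sets R" for a
  proof (cases "obj a \<and> card a \<le> R")
    case True
    then have "finite a" by (simp add: obj_def)
    then obtain b p where "relabelling a p b" "b \<subseteq> {0..<0 + card a} \<times> snd ` a"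
      by (rule standard_copy[where m = 0])
    moreover from this(2) have "b \<in> standard_sets R"
      using True by (fastforce simp: standard_sets_def obj_def)
    ultimately show ?thesis by blast
  qed auto
  then obtain p st where p: "\<And>a. obj a \<Longrightarrow> card a \<le> R \<Longrightarrow> relabelling a (p a) (st a)"
    "\<And>a. obj a \<Longrightarrow> card a \<le> R \<Longrightarrow> st a \<in> standard_sets R" by metis
  have pm: "mor a (p a) (st a)" if "obj a" "card a \<le> R" for a
    using relabelling_mor[OF p(1)[OF that] that(1)] .
  \<comment> \<open>The choice is meaningful only if some isomorphism exists; \<open>t\<close> shows
    that it does for every set that is reached.\<close>
  define \<tau> where "\<tau> b = (SOME f. mor a0 f b)" for b
  define t where "t a = \<tau> (st a) O (p a)\<inverse>" for a
  have t: "mor a0 (t a) a" if "mor a0 f a" "card a \<le> R" for f a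
  proof -
    have oa: "obj a" using that(1) by (rule mor_objD)
    have "mor a0 (f O p a) (st a)" using mor_comp[OF that(1) pm[OF oa that(2)]] .
    then have "mor a0 (\<tau> (st a)) (st a)" unfolding \<tau>_def by (rule someI)
    from mor_comp[OF this mor_converse[OF pm[OF oa that(2)]]] show ?thesis unfolding t_def .
  qed
  define S0 where "S0 = (\<lambda>(a, m, b). \<tau> a O m O (\<tau> b)\<inverse>) ` (standard_sets R \<times> standard_edges R \<times> standard_sets R)"
  \<comment> \<open>The intersection discards triples that do not fit together to a loop. As
    \<open>t a0\<close> need not be the identity, it is added together with its inverse to start and
    to close the telescoping product.\<close>
  define S where "S = {t a0, (t a0)\<inverse>} \<union> (S0 \<inter> {f. mor a0 f a0})"
  have t0: "mor a0 (t a0) a0" by (rule t[OF mor_Id[OF assms(1)] assms(2)])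
  \<comment> \<open>Closing the walk by the inverse of \<open>t b\<close> makes the product
    telescope into edge loops.\<close>
  have step: "f O (t b)\<inverse> \<in> products a0 S" if "gen R a0 f b" for f b
    using that
  proof (induction rule: gen.induct)
    case gen_Id
    show ?case by (rule products_step[OF products_Id]) (simp add: S_def)
  next
    case (gen_step f b g c)
    have f: "mor a0 f b" using gen_step(1) by (rule gen_mor)
    have g: "mor b g c" using gen_step(2) by (rule edge_rel_mor)
    have card: "card b \<le> R" "card c \<le> R" using gen_card(2)[OF gen_step(1)] gen_step(3) by auto
    note ob = mor_objD[OF g]
    have tb: "mor a0 (t b) b" "mor a0 (t c) c" using t[OF f card(1)] t[OF mor_comp[OF f g] card(2)] .
    have m: "mor a0 (t b O g O (t c)\<inverse>) a0"
      by (rule mor_comp[OF tb(1) mor_comp[OF g mor_converse[OF tb(2)]]])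
    have se: "(p b)\<inverse> O g O p c \<in> standard_edges R"
      by (rule standard_edge[OF gen_step(2) card(1)]) (use p ob card in auto)
    have eq: "t b O g O (t c)\<inverse> = \<tau> (st b) O ((p b)\<inverse> O g O p c) O (\<tau> (st c))\<inverse>"
      by (simp add: t_def converse_relcomp O_assoc)
    have "t b O g O (t c)\<inverse> \<in> S0"
      unfolding S0_def
      by (rule image_eqI[of _ _ "(st b, (p b)\<inverse> O g O p c, st c)"])
        (simp_all add: eq se p(2) ob card)
    with m have "t b O g O (t c)\<inverse> \<in> S" by (simp add: S_def)
    with gen_step.IH have pr: "(f O (t b)\<inverse>) O (t b O g O (t c)\<inverse>) \<in> products a0 S" by (rule products_step)
    have "(f O (t b)\<inverse>) O (t b O g O (t c)\<inverse>) = f O ((t b)\<inverse> O t b O (g O (t c)\<inverse>))"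
      by (simp add: O_assoc)
    also have "\<dots> = f O g O (t c)\<inverse>"
      unfolding mor_cancel(2)[OF tb(1)] mor_Id_comp(1)[OF mor_comp[OF g mor_converse[OF tb(2)]]] ..
    finally have "(f O (t b)\<inverse>) O (t b O g O (t c)\<inverse>) = (f O g) O (t c)\<inverse>" by (simp only: O_assoc)
    with pr show ?case by (simp only:)
  qed
  show thesis
  proof (rule that)
    show "finite S" unfolding S_def S0_def
      using finite_standard_sets finite_standard_edges by auto
    show "S \<subseteq> {f. mor a0 f a0}" using t0 mor_converse[OF t0] by (auto simp: S_def)
    show "{f. gen R a0 f a0} \<subseteq> products a0 S"
    proof
      fix f assume "f \<in> {f. gen R a0 f a0}"
      then have f: "gen R a0 f a0" by simp
      have "t a0 \<in> S" by (simp add: S_def)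
      with step[OF f] have "(f O (t a0)\<inverse>) O t a0 \<in> products a0 S" by (rule products_step)
      moreover have "(f O (t a0)\<inverse>) O t a0 = f"
        unfolding O_assoc mor_Id_comp(4)[OF t0] by (rule mor_Id_comp(2)[OF gen_mor[OF f]])
      ultimately show "f \<in> products a0 S" by (simp only:)
    qed
  qed
qed

text \<open>Without branching an infinite path is determined by its source.\<close>

lemma finite_paths_unbranched:
  assumes "\<not> branching" shows "finite X"
proof -
  have "inj_on s X"
  proof (rule inj_onI)
    fix x y assume "x \<in> X" "y \<in> X" "s x = s y"
    then show "x = y"
    proof (coinduction arbitrary: x y)
      case Eq_stream
      obtain e z e' z' where xy: "x = e ## z" "y = e' ## z'" by (metis stream.collapse)
      with Eq_stream have "e \<in> E" "e' \<in> E" "tl_of e = tl_of e'" "z \<in> X" "z' \<in> X"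
        "s z = hd_of e" "s z' = hd_of e'" by (simp_all add: infinite_paths_SCons)
      moreover from this have "e = e'" using assms unfolding branching_def by blast
      ultimately show ?case using xy by auto
    qed
  qed
  moreover have "finite (s ` X)" by (rule finite_subset[of _ V]) (use s_in_V in auto)
  ultimately show ?thesis by (rule finite_imageD[rotated])
qed

lemma mor_finitely_generated:
  assumes "obj a"
  obtains S where "finite S" "S \<subseteq> {f. mor a f a}" "{f. mor a f a} \<subseteq> products a S"
proof (cases "branching")
  case True
  obtain R0 where R0: "reduces_above R0 a" using reduces_above_exists[OF True] by blast
  define R where "R = max R0 (card a)"
  have R: "R0 \<le> R" "card a \<le> R" by (simp_all add: R_def)
  obtain S where S: "finite S" "S \<subseteq> {f. mor a f a}" "{f. gen R a f a} \<subseteq> products a S"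
    by (rule gen_finitely_generated[OF assms R(2)])
  have "gen R a f a" if "mor a f a" for f
    using mor_generated[OF that] gen_bounded[OF R0 R] unfolding generated_def by blast
  with S(3) have "{f. mor a f a} \<subseteq> products a S" by blast
  with S(1,2) that show thesis by blast
next
  case False
  \<comment> \<open>There are finitely many points, hence finitely many automorphisms, and all of
    them are taken as generators.\<close>
  have "cells a \<subseteq> fst ` a \<times> X" by (force simp: cells_def)
  moreover have "finite (fst ` a \<times> X)"
    using finite_paths_unbranched[OF False] assms by (simp add: obj_def)
  ultimately have "finite (cells a \<times> cells a)" by (simp add: finite_subset)
  moreover have "{f. mor a f a} \<subseteq> Pow (cells a \<times> cells a)" by (auto simp: mor_def)
  ultimately have "finite {f. mor a f a}" by (meson finite_Pow_iff finite_subset)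
  moreover have "f \<in> products a {f. mor a f a}" if "mor a f a" for f
    using products_step[OF products_Id, of f "{f. mor a f a}" a] that mor_Id_comp(1)[OF that] by simp
  ultimately show thesis using that by blast
qed


section \<open>Full bisections\<close>

abbreviation "\<G> \<equiv> kep_groupoid N A B"
abbreviation "unit_of \<equiv> kep_unit N A B"

section \<open>Finite paths, basic sets and the topology of the groupoid\<close>

lemma awalk_shift:
  "awalk v p w \<Longrightarrow> y \<in> X \<Longrightarrow> s y = w \<Longrightarrow> p @- y \<in> X \<and> s (p @- y) = v"
  by (induction p arbitrary: v) (auto simp: awalk_Cons_iff awalk_Nil_iff infinite_paths_SCons)

lemma shift_awalk: "p @- y \<in> X \<Longrightarrow> awalk (s (p @- y)) p (s y)"
proof (induction p)
  case Nil
  then have "s y \<in> verts (matrix_graph N A)" using s_in_V[of y] by (simp add: matrix_graph_def)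
  then show ?case by (simp add: awalk_Nil_iff)
qed (simp add: infinite_paths_SCons awalk_Cons_iff)

lemma path_range_awalk: "awalk v p w \<Longrightarrow> path_range N A (v, p) = w"
  unfolding path_range_def fst_conv snd_conv by (rule cas_awlast) (simp add: awalk_def)

lemma finite_path_walk_to:
  assumes "\<mu> \<in> finite_paths N A"
  shows "walk_to (path_range N A \<mu>) (snd \<mu>)"
proof -
  obtain v p where \<mu>: "\<mu> = (v, p)" by fastforce
  from assms obtain w where w: "awalk v p w" by (auto simp: finite_paths_def \<mu>)
  then show ?thesis unfolding walk_to_def \<mu> path_range_awalk[OF w] using awalk_shift by auto
qed

lemma walk_to_finite_path:
  assumes "walk_to w p" "w \<in> V"
  obtains v where "(v, p) \<in> finite_paths N A" "path_range N A (v, p) = w"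
proof -
  obtain y where y: "y \<in> X" "s y = w" using path_from[OF assms(2)] by blast
  with assms(1) have "p @- y \<in> X" by (simp add: walk_to_def)
  from shift_awalk[OF this] have "awalk (s (p @- y)) p w" by (simp add: y)
  then show thesis using that path_range_awalk by (auto simp: finite_paths_def)
qed

lemma basic_quadruple:
  assumes "\<mu> \<in> finite_paths N A" "\<nu> \<in> finite_paths N A" "path_range N A \<mu> = path_range N A \<nu>"
    and "y \<in> tails_of N A \<nu>"
  shows "(\<mu>, m, \<nu>, prepend \<nu> y) \<in> quadruples N A"
  using assms by (simp add: quadruples_iff cylinder_def)

text \<open>Extending a quadruple describes the same arrows over a smaller cylinder. Iterated, this
  puts the basic set of a common extension inside those of both representatives.\<close>

lemma kep_basic_ext_subset:
  assumes "q \<in> quadruples N A"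
  shows "case quad_ext A B q of (\<mu>', m', \<nu>', x') \<Rightarrow> case q of (\<mu>, m, \<nu>, x) \<Rightarrow>
    kep_basic N A B \<mu>' m' \<nu>' \<subseteq> kep_basic N A B \<mu> m \<nu>"
  using assms
proof (cases rule: quad_cases)
  case (1 \<mu> m \<nu> e z)
  have "kep_basic N A B (snoc \<mu> (kappa A B m e)) (phi A B m e) (snoc \<nu> e) \<subseteq> kep_basic N A B \<mu> m \<nu>"
  proof
    fix g assume "g \<in> kep_basic N A B (snoc \<mu> (kappa A B m e)) (phi A B m e) (snoc \<nu> e)"
    then obtain z' where z': "z' \<in> tails_of N A (snoc \<nu> e)"
      "g = kep_class N A B (snoc \<mu> (kappa A B m e)) (phi A B m e) (snoc \<nu> e) (prepend (snoc \<nu> e) z')"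
      unfolding kep_basic_def cylinder_def by blast
    have eq: "prepend (snoc \<nu> e) z' = prepend \<nu> (e ## z')" by (simp add: prepend_def snoc_def)
    have t: "e ## z' \<in> tails_of N A \<nu>"
      using z'(1) 1 by (simp add: tails_of_def infinite_paths_SCons)
    have q: "(\<mu>, m, \<nu>, prepend \<nu> (e ## z')) \<in> quadruples N A"
      using 1(5-7) t by (rule basic_quadruple)
    have "((\<mu>, m, \<nu>, prepend \<nu> (e ## z')),
       (snoc \<mu> (kappa A B m e), phi A B m e, snoc \<nu> e, prepend \<nu> (e ## z'))) \<in> kep_equiv N A B"
      using quad_ext_iter(1)[OF q, where B = B and k = 1] by (simp add: quad_ext_prepend)
    then have "g = kep_class N A B \<mu> m \<nu> (prepend \<nu> (e ## z'))"
      unfolding z'(2) eq kep_class_eq_iff by (rule symD[OF sym_kep_equiv])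
    then show "g \<in> kep_basic N A B \<mu> m \<nu>" unfolding kep_basic_def cylinder_def using t by blast
  qed
  then show ?thesis by (simp add: 1(1) quad_ext_prepend)
qed

lemma kep_basic_iter_subset:
  assumes "(\<mu>, m, \<nu>, x) \<in> quadruples N A" "(quad_ext A B ^^ k) (\<mu>, m, \<nu>, x) = (\<mu>', m', \<nu>', x')"
  shows "kep_basic N A B \<mu>' m' \<nu>' \<subseteq> kep_basic N A B \<mu> m \<nu>"
  using assms(2)
proof (induction k arbitrary: \<mu>' m' \<nu>' x')
  case (Suc k)
  obtain \<mu>'' m'' \<nu>'' x'' where q: "(quad_ext A B ^^ k) (\<mu>, m, \<nu>, x) = (\<mu>'', m'', \<nu>'', x'')"
    by (metis prod_cases4)
  with quad_ext_iter(2)[OF assms(1), where B = B and k = k] have "(\<mu>'', m'', \<nu>'', x'') \<in> quadruples N A" by simp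
  from kep_basic_ext_subset[OF this] Suc.prems q Suc.IH[OF q] show ?case by auto
qed simp

lemma kep_basis_Int:
  assumes "b \<in> kep_basis N A B" "c \<in> kep_basis N A B" "g \<in> b" "g \<in> c"
  shows "\<exists>d \<in> kep_basis N A B. g \<in> d \<and> d \<subseteq> b \<inter> c"
proof -
  from assms(1,3) obtain \<mu> m \<nu> x where b: "b = kep_basic N A B \<mu> m \<nu>" "g = kep_class N A B \<mu> m \<nu> x"
    "(\<mu>, m, \<nu>, x) \<in> quadruples N A" unfolding kep_basis_def kep_basic_def quadruples_iff by blast
  from assms(2,4) obtain \<mu>' m' \<nu>' x' where c: "c = kep_basic N A B \<mu>' m' \<nu>'"
    "g = kep_class N A B \<mu>' m' \<nu>' x'"
    "(\<mu>', m', \<nu>', x') \<in> quadruples N A" unfolding kep_basis_def kep_basic_def quadruples_iff by blast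
  have "((\<mu>, m, \<nu>, x), (\<mu>', m', \<nu>', x')) \<in> kep_equiv N A B"
    using b(2) c(2) by (simp only: kep_class_eq_iff[symmetric])
  then obtain k k' where k: "(quad_ext A B ^^ k) (\<mu>, m, \<nu>, x) = (quad_ext A B ^^ k') (\<mu>', m', \<nu>', x')"
    using kep_equiv_imp_join by blast
  obtain \<alpha> n \<beta> y where q: "(quad_ext A B ^^ k) (\<mu>, m, \<nu>, x) = (\<alpha>, n, \<beta>, y)"
    by (metis prod_cases4)
  let ?d = "kep_basic N A B \<alpha> n \<beta>"
  have "?d \<subseteq> b \<inter> c"
    using kep_basic_iter_subset[OF b(3) q] kep_basic_iter_subset[OF c(3) q[unfolded k]] b(1) c(1) by blast
  moreover have "(\<alpha>, n, \<beta>, y) \<in> quadruples N A" "((\<mu>, m, \<nu>, x), (\<alpha>, n, \<beta>, y)) \<in> kep_equiv N A B"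
    using quad_ext_iter[OF b(3), where B = B and k = k] unfolding q by simp_all
  then have "?d \<in> kep_basis N A B" "g \<in> ?d"
    unfolding kep_basis_def kep_basic_def quadruples_iff b(2) kep_class_eq_iff[symmetric] by blast+
  ultimately show ?thesis by blast
qed

lemma open_kep_basis:
  assumes "openin (gtop \<G>) U" "g \<in> U"
  shows "\<exists>b \<in> kep_basis N A B. g \<in> b \<and> b \<subseteq> U"
proof -
  have "generate_topology_on (kep_basis N A B) U"
    using assms(1) by (simp add: kep_groupoid_def openin_topology_generated_by_iff)
  then show ?thesis using assms(2)
  proof (induction arbitrary: g rule: generate_topology_on.induct)
    case Empty
    then show ?case by simp
  next
    case (Int a b)
    from Int.prems have "g \<in> a" "g \<in> b" by simp_all
    from Int.IH(1)[OF this(1)] Int.IH(2)[OF this(2)] obtain c d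
      where cd: "c \<in> kep_basis N A B" "g \<in> c" "c \<subseteq> a" "d \<in> kep_basis N A B" "g \<in> d" "d \<subseteq> b" by blast
    from kep_basis_Int[OF cd(1,4,2,5)] obtain e where "e \<in> kep_basis N A B" "g \<in> e" "e \<subseteq> c \<inter> d" by blast
    moreover from this cd have "e \<subseteq> a \<inter> b" by blast
    ultimately show ?case by blast
  next
    case (UN K)
    from UN.prems obtain k where k: "k \<in> K" "g \<in> k" by blast
    from UN.IH[OF this] obtain b where "b \<in> kep_basis N A B" "g \<in> b" "b \<subseteq> k" by blast
    moreover from this k(1) have "b \<subseteq> \<Union> K" by blast
    ultimately show ?case by blast
  next
    case (Basis b)
    then show ?case by blast
  qed
qed

section \<open>Full bisections as automorphisms of the union of all cells\<close>

definition base_cells :: cell_set where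
  "base_cells = {0} \<times> V"

text \<open>With the label fixed to 0 the points of this object are just the infinite paths, that
  is, the units.\<close>

lemma cells_base_cells: "(i, x) \<in> cells base_cells \<longleftrightarrow> i = 0 \<and> x \<in> X"
  using s_in_V by (auto simp: cells_def base_cells_def)

lemma obj_base_cells: "obj base_cells"
  by (auto simp: obj_def base_cells_def)

abbreviation "endo f \<equiv> mor base_cells f base_cells"

text \<open>The value is unique because \<open>kep_unit\<close> is injective and \<open>f\<close> is
  single-valued. Restriction to the units matches the extensional maps in
  \<open>BijGroup\<close>.\<close>

definition unit_map :: "point_rel \<Rightarrow> quadruple set \<Rightarrow> quadruple set" where
  "unit_map f = (\<lambda>t \<in> unit_of ` X. unit_of (SOME x'. \<exists>x. t = unit_of x \<and> ((0, x), (0, x')) \<in> f))"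

lemma unit_of_eq_iff [simp]: "unit_of x = unit_of y \<longleftrightarrow> x = y"
  using kep_unit_inject by blast

lemma endo_image:
  assumes "endo f" "x \<in> X"
  obtains x' where "x' \<in> X" "((0, x), (0, x')) \<in> f"
proof -
  have "(0, x) \<in> Domain f" using assms by (simp add: mor_def cells_base_cells)
  then obtain t where "((0, x), t) \<in> f" by blast
  moreover from this have "t \<in> cells base_cells" using assms(1) unfolding mor_def by blast
  ultimately show thesis using that by (cases t) (auto simp: cells_base_cells)
qed

lemma endo_in_X: "endo f \<Longrightarrow> ((0, x), (0, x')) \<in> f \<Longrightarrow> x \<in> X \<and> x' \<in> X"
  unfolding mor_def using cells_base_cells by blast

lemma unit_map_eq:
  assumes "endo f" "((0, x), (0, x')) \<in> f" shows "unit_map f (unit_of x) = unit_of x'"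
proof -
  have "(SOME x'. \<exists>x''. unit_of x = unit_of x'' \<and> ((0, x''), (0, x')) \<in> f) = x'"
    by (rule some_equality) (use assms in \<open>auto simp: mor_def single_valued_def\<close>)
  then show ?thesis using endo_in_X[OF assms] by (simp add: unit_map_def)
qed

lemma unit_map_eqI:
  assumes "endo f" "F \<in> extensional (unit_of ` X)"
    and "\<And>x x'. ((0, x), (0, x')) \<in> f \<Longrightarrow> F (unit_of x) = unit_of x'"
  shows "F = unit_map f"
proof (rule extensionalityI[OF assms(2)])
  show "unit_map f \<in> extensional (unit_of ` X)" by (simp add: unit_map_def)
  fix t assume "t \<in> unit_of ` X"
  then obtain x where x: "x \<in> X" "t = unit_of x" by blast
  obtain x' where "((0, x), (0, x')) \<in> f" using endo_image[OF assms(1) x(1)] by blast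
  then show "F t = unit_map f t" using assms(3) unit_map_eq[OF assms(1)] x(2) by simp
qed

lemma units_eq: "units \<G> = unit_of ` X"
  by (simp add: kep_groupoid_def)

text \<open>The order is reversed, since \<open>f O g\<close> applies \<open>f\<close>
  first.\<close>

lemma unit_map_comp:
  assumes "endo f" "endo g"
  shows "compose (unit_of ` X) (unit_map g) (unit_map f) = unit_map (f O g)"
proof (rule unit_map_eqI[OF mor_comp[OF assms]])
  fix x x' assume "((0, x), (0, x')) \<in> f O g"
  then obtain t where t: "((0, x), t) \<in> f" "(t, (0, x')) \<in> g" by blast
  have "t \<in> cells base_cells" using t(1) assms(1) unfolding mor_def by blast
  then obtain z where "t = (0, z)" by (cases t) (simp add: cells_base_cells)
  with t show "compose (unit_of ` X) (unit_map g) (unit_map f) (unit_of x) = unit_of x'"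
    using unit_map_eq[OF assms(1)] unit_map_eq[OF assms(2)] endo_in_X[OF assms(1)]
    by (simp add: compose_def)
qed simp

lemma unit_map_Id: "unit_map (Id_on (cells base_cells)) = (\<lambda>t \<in> unit_of ` X. t)"
  by (rule unit_map_eqI[OF mor_Id[OF obj_base_cells], symmetric])
    (auto simp: cells_base_cells)

lemma src_class:
  assumes "\<mu> \<in> finite_paths N A" "\<nu> \<in> finite_paths N A" "path_range N A \<mu> = path_range N A \<nu>"
    and "y \<in> tails_of N A \<nu>"
  shows "src \<G> (kep_class N A B \<mu> m \<nu> (prepend \<nu> y)) = unit_of (snd \<nu> @- y)"
    and "rng \<G> (kep_class N A B \<mu> m \<nu> (prepend \<nu> y)) = unit_of (snd \<mu> @- K m y)"
  using kep_src_class[OF basic_quadruple[OF assms] assms(4), of B]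
    kep_rng_class[OF basic_quadruple[OF assms] assms(4), of B]
  by (simp_all add: kep_groupoid_def prepend_def)

lemma bisection_map_unit_map:
  assumes "full_bisection \<G> U" "endo f"
    and "\<And>g x. g \<in> U \<Longrightarrow> src \<G> g = unit_of x \<Longrightarrow> \<exists>x'. rng \<G> g = unit_of x' \<and> ((0, x), (0, x')) \<in> f"
  shows "bisection_map \<G> U = unit_map f"
proof (rule unit_map_eqI[OF assms(2)])
  show "bisection_map \<G> U \<in> extensional (unit_of ` X)"
    by (simp add: bisection_map_def units_eq)
  fix x x' assume xx': "((0, x), (0, x')) \<in> f"
  then have "unit_of x \<in> src \<G> ` U" using assms(1) endo_in_X[OF assms(2) xx']
    by (simp add: full_bisection_def units_eq)
  then obtain g where g: "g \<in> U" "src \<G> g = unit_of x" by auto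
  have "the_inv_into U (src \<G>) (unit_of x) = g"
    using the_inv_into_f_f[of "src \<G>" U g] assms(1) g by (simp add: full_bisection_def)
  then have "bisection_map \<G> U (unit_of x) = rng \<G> g"
    using endo_in_X[OF assms(2) xx'] by (simp add: bisection_map_def units_eq)
  also from assms(3)[OF g] obtain x'' where "rng \<G> g = unit_of x''" "((0, x), (0, x'')) \<in> f" by blast
  then have "rng \<G> g = unit_of x'"
    using xx' assms(2) unfolding mor_def single_valued_def by blast
  finally show "bisection_map \<G> U (unit_of x) = unit_of x'" .
qed

text \<open>The relation pairs the source of each arrow of \<open>U\<close> with its range. It is
  local because the open set \<open>U\<close> contains, around each of its arrows, a basic set, and
  a basic set induces a basic relation.\<close>

lemma full_bisection_endo:
  assumes "full_bisection \<G> U"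
  obtains f where "endo f" "bisection_map \<G> U = unit_map f"
proof -
  have U: "openin (gtop \<G>) U" "inj_on (src \<G>) U" "inj_on (rng \<G>) U"
    "src \<G> ` U = unit_of ` X" "rng \<G> ` U = unit_of ` X"
    using assms by (simp_all add: full_bisection_def units_eq)
  define f :: point_rel where "f = {((0, x), (0, x')) | x x'. \<exists>g \<in> U. src \<G> g = unit_of x \<and> rng \<G> g = unit_of x'}"
  have fI: "((0, x), (0, x')) \<in> f" if "g \<in> U" "src \<G> g = unit_of x" "rng \<G> g = unit_of x'" for g x x'
    using that unfolding f_def by blast
  have rng: "\<exists>x' \<in> X. rng \<G> g = unit_of x'" and src: "\<exists>x \<in> X. src \<G> g = unit_of x" if "g \<in> U" for g
    using imageI[OF that, of "rng \<G>"] imageI[OF that, of "src \<G>"] unfolding U(4,5) by blast+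
  have fE: "\<exists>x x' g. t = ((0, x), (0, x')) \<and> g \<in> U \<and> src \<G> g = unit_of x \<and> rng \<G> g = unit_of x' \<and> x \<in> X \<and> x' \<in> X"
    if "t \<in> f" for t
  proof -
    from that obtain x x' g where *: "t = ((0, x), (0, x'))" "g \<in> U" "src \<G> g = unit_of x" "rng \<G> g = unit_of x'"
      unfolding f_def by blast
    from rng[OF *(2)] src[OF *(2)] have "x \<in> X" "x' \<in> X" unfolding *(3,4) unit_of_eq_iff by simp_all
    with * show ?thesis by blast
  qed
  have "Domain f = cells base_cells"
  proof (intro equalityI subsetI)
    fix t assume "t \<in> cells base_cells"
    then obtain x where x: "t = (0, x)" "x \<in> X" by (cases t) (simp add: cells_base_cells)
    then have "unit_of x \<in> src \<G> ` U" using U(4) by simp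
    then obtain g where "g \<in> U" "src \<G> g = unit_of x" by auto
    with rng fI x(1) show "t \<in> Domain f" by blast
  next
    fix t assume "t \<in> Domain f"
    then obtain u where "(t, u) \<in> f" by blast
    from fE[OF this] show "t \<in> cells base_cells" by (auto simp: cells_base_cells)
  qed
  moreover have "Range f = cells base_cells"
  proof (intro equalityI subsetI)
    fix t assume "t \<in> cells base_cells"
    then obtain x where x: "t = (0, x)" "x \<in> X" by (cases t) (simp add: cells_base_cells)
    then have "unit_of x \<in> rng \<G> ` U" using U(5) by simp
    then obtain g where "g \<in> U" "rng \<G> g = unit_of x" by auto
    with src fI x(1) show "t \<in> Range f" by blast
  next
    fix t assume "t \<in> Range f"
    then obtain u where "(u, t) \<in> f" by blast
    from fE[OF this] show "t \<in> cells base_cells" by (auto simp: cells_base_cells)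
  qed
  moreover have "single_valued f"
  proof (rule single_valuedI)
    fix t u u' assume "(t, u) \<in> f" "(t, u') \<in> f"
    from fE[OF this(1)] fE[OF this(2)] obtain x x1 x2 g1 g2 where
      *: "t = (0, x)" "u = (0, x1)" "u' = (0, x2)" "g1 \<in> U" "src \<G> g1 = unit_of x" "rng \<G> g1 = unit_of x1"
      "g2 \<in> U" "src \<G> g2 = unit_of x" "rng \<G> g2 = unit_of x2" by auto
    have "g1 = g2" by (rule inj_onD[OF U(2)]) (use * in simp_all)
    with * show "u = u'" by simp
  qed
  moreover have "single_valued (f\<inverse>)"
  proof (rule single_valuedI, unfold converse_iff)
    fix t u u' assume "(u, t) \<in> f" "(u', t) \<in> f"
    from fE[OF this(1)] fE[OF this(2)] obtain x x1 x2 g1 g2 where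
      *: "t = (0, x)" "u = (0, x1)" "u' = (0, x2)" "g1 \<in> U" "rng \<G> g1 = unit_of x" "src \<G> g1 = unit_of x1"
      "g2 \<in> U" "rng \<G> g2 = unit_of x" "src \<G> g2 = unit_of x2" by auto
    have "g1 = g2" by (rule inj_onD[OF U(3)]) (use * in simp_all)
    with * show "u = u'" by simp
  qed
  moreover have "local_rel f"
    unfolding local_rel_def
  proof
    fix t assume "t \<in> f"
    from fE[OF this] obtain x x' g where t: "t = ((0, x), (0, x'))" "g \<in> U" "src \<G> g = unit_of x"
      "rng \<G> g = unit_of x'" by blast
    from open_kep_basis[OF U(1) t(2)] obtain \<mu> m \<nu> where b: "\<mu> \<in> finite_paths N A" "\<nu> \<in> finite_paths N A"
      "path_range N A \<mu> = path_range N A \<nu>" "g \<in> kep_basic N A B \<mu> m \<nu>" "kep_basic N A B \<mu> m \<nu> \<subseteq> U"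
      unfolding kep_basis_def by blast
    let ?w = "path_range N A \<nu>"
    from b(4) obtain y where y: "y \<in> tails_of N A \<nu>" "g = kep_class N A B \<mu> m \<nu> (prepend \<nu> y)"
      unfolding kep_basic_def cylinder_def by blast
    \<comment> \<open>The third entry of a quadruple is the prefix of the source, so
      \<open>snd \<nu>\<close> comes first in the basic relation.\<close>
    have "t = ((0, snd \<nu> @- y), (0, snd \<mu> @- K m y))"
      using src_class[OF b(1-3) y(1), of m] t y(2) by simp
    then have "t \<in> basic_rel 0 (snd \<nu>) m 0 (snd \<mu>) ?w"
      using y(1) unfolding basic_rel_def tails_of_def by blast
    moreover have "basic_rel 0 (snd \<nu>) m 0 (snd \<mu>) ?w \<subseteq> f"
    proof
      fix u assume "u \<in> basic_rel 0 (snd \<nu>) m 0 (snd \<mu>) ?w"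
      then obtain z where z: "u = ((0, snd \<nu> @- z), (0, snd \<mu> @- K m z))" "z \<in> tails_of N A \<nu>"
        unfolding basic_rel_def tails_of_def by blast
      have "kep_class N A B \<mu> m \<nu> (prepend \<nu> z) \<in> U"
        using b(5) z(2) unfolding kep_basic_def cylinder_def by blast
      from fI[OF this src_class[OF b(1-3) z(2)]] show "u \<in> f" unfolding z(1) .
    qed
    moreover have "walk_to ?w (snd \<nu>)" "walk_to ?w (snd \<mu>)"
      using finite_path_walk_to[OF b(2)] finite_path_walk_to[OF b(1)] b(3) by simp_all
    ultimately show "\<exists>i p m j q w. walk_to w p \<and> walk_to w q \<and> t \<in> basic_rel i p m j q w \<and>
       basic_rel i p m j q w \<subseteq> f" by blast
  qed
  ultimately have f: "endo f" using obj_base_cells by (simp add: mor_def)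
  moreover have "bisection_map \<G> U = unit_map f"
    by (rule bisection_map_unit_map[OF assms f]) (use rng fI in blast)
  ultimately show thesis by (rule that)
qed

text \<open>Several basic sets may induce the same map on one cylinder, and a priori their arrows
  differ. Choosing one for each cylinder of a uniform depth gives exactly one arrow over each
  unit.\<close>

lemma endo_full_bisection:
  assumes f: "endo f"
  obtains U where "full_bisection \<G> U" "bisection_map \<G> U = unit_map f"
proof -
  obtain n where n: "\<And>i x. (i, x) \<in> cells base_cells \<Longrightarrow> tabulated f i (stake n x) (s (sdrop n x))"
    using tabulated_uniform[OF f] by blast
  define P where "P = (\<lambda>x. (stake n x, s (sdrop n x))) ` X"
  have "\<exists>\<mu> m \<nu>. \<mu> \<in> finite_paths N A \<and> \<nu> \<in> finite_paths N A \<and> path_range N A \<nu> = snd t \<and>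
      path_range N A \<mu> = snd t \<and> snd \<nu> = fst t \<and> basic_rel 0 (fst t) m 0 (snd \<mu>) (snd t) \<subseteq> f"
    if "t \<in> P" for t
  proof -
    from that obtain x where x: "x \<in> X" "t = (stake n x, s (sdrop n x))" unfolding P_def by blast
    let ?p = "stake n x" and ?w = "s (sdrop n x)"
    have "tabulated f 0 ?p ?w" by (rule n) (simp add: cells_base_cells x(1))
    then obtain m j q where *: "walk_to ?w ?p" "walk_to ?w q" "basic_rel 0 ?p m j q ?w \<subseteq> f"
      unfolding tabulated_def by blast
    have z: "sdrop n x \<in> X" using x(1) by (rule sdrop_in_X)
    then have "((0, ?p @- sdrop n x), (j, q @- K m (sdrop n x))) \<in> f"
      by (intro subsetD[OF *(3)]) (auto simp: basic_rel_def)
    then have "(j, q @- K m (sdrop n x)) \<in> cells base_cells" using f unfolding mor_def by blast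
    then have "j = 0" by (simp add: cells_base_cells)
    have w: "?w \<in> V" using z by (rule s_in_V)
    obtain v where "(v, ?p) \<in> finite_paths N A" "path_range N A (v, ?p) = ?w"
      using walk_to_finite_path[OF *(1) w] .
    moreover obtain v' where "(v', q) \<in> finite_paths N A" "path_range N A (v', q) = ?w"
      using walk_to_finite_path[OF *(2) w] .
    ultimately show ?thesis using *(3) \<open>j = 0\<close> unfolding x(2)
      by (intro exI[of _ "(v', q)"] exI[of _ m] exI[of _ "(v, ?p)"]) simp
  qed
  then obtain \<mu> m \<nu> where c: "\<And>t. t \<in> P \<Longrightarrow> \<mu> t \<in> finite_paths N A \<and> \<nu> t \<in> finite_paths N A \<and>
      path_range N A (\<nu> t) = snd t \<and> path_range N A (\<mu> t) = snd t \<and> snd (\<nu> t) = fst t \<and>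
      basic_rel 0 (fst t) (m t) 0 (snd (\<mu> t)) (snd t) \<subseteq> f" by metis
  define U where "U = (\<Union>t \<in> P. kep_basic N A B (\<mu> t) (m t) (\<nu> t))"
  have "openin (gtop \<G>) (kep_basic N A B (\<mu> t) (m t) (\<nu> t))" if "t \<in> P" for t
  proof -
    have "kep_basic N A B (\<mu> t) (m t) (\<nu> t) \<in> kep_basis N A B"
    proof -
      from c[OF that] have "\<mu> t \<in> finite_paths N A" "\<nu> t \<in> finite_paths N A"
        "path_range N A (\<mu> t) = path_range N A (\<nu> t)" by simp_all
      then show ?thesis unfolding kep_basis_def by blast
    qed
    then show ?thesis by (simp add: kep_groupoid_def topology_generated_by_Basis)
  qed
  then have op: "openin (gtop \<G>) U" unfolding U_def by blast
  \<comment> \<open>The arrow of \<open>U\<close> with source \<open>x\<close>: the first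
    \<open>n\<close> edges and the vertex after them determine which basic set was chosen.\<close>
  define \<alpha> where "\<alpha> x = (let t = (stake n x, s (sdrop n x)) in kep_class N A B (\<mu> t) (m t) (\<nu> t) x)" for x
  have \<alpha>: "src \<G> (\<alpha> x) = unit_of x" "\<exists>x'. rng \<G> (\<alpha> x) = unit_of x' \<and> ((0, x), (0, x')) \<in> f" "\<alpha> x \<in> U"
    if "x \<in> X" for x
  proof -
    define t where "t = (stake n x, s (sdrop n x))"
    have t: "t \<in> P" unfolding t_def P_def using that by blast
    note ct = c[OF t]
    have y: "sdrop n x \<in> tails_of N A (\<nu> t)" using ct sdrop_in_X[OF that] by (simp add: tails_of_def t_def)
    have x: "prepend (\<nu> t) (sdrop n x) = x" using ct by (simp add: prepend_def t_def stake_sdrop)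
    have a: "\<alpha> x = kep_class N A B (\<mu> t) (m t) (\<nu> t) (prepend (\<nu> t) (sdrop n x))"
      unfolding x by (simp add: \<alpha>_def t_def Let_def)
    have r: "path_range N A (\<mu> t) = path_range N A (\<nu> t)" using ct by simp
    note sr = src_class[OF _ _ r y, where m = "m t"]
    show "src \<G> (\<alpha> x) = unit_of x" unfolding a using sr(1) ct x by (simp add: prepend_def)
    have "((0, fst t @- sdrop n x), (0, snd (\<mu> t) @- K (m t) (sdrop n x))) \<in> f"
      using ct sdrop_in_X[OF that] by (intro subsetD[of "basic_rel 0 (fst t) (m t) 0 (snd (\<mu> t)) (snd t)" f])
        (auto simp: basic_rel_def t_def)
    then have "((0, x), (0, snd (\<mu> t) @- K (m t) (sdrop n x))) \<in> f" by (simp add: t_def stake_sdrop)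
    then show "\<exists>x'. rng \<G> (\<alpha> x) = unit_of x' \<and> ((0, x), (0, x')) \<in> f" unfolding a using sr(2) ct by blast
    show "\<alpha> x \<in> U" unfolding a U_def kep_basic_def cylinder_def using t y by blast
  qed
  \<comment> \<open>Since \<open>U\<close> is the image of a section of the source map, injectivity
    on \<open>U\<close> can be checked on paths.\<close>
  have U: "U = \<alpha> ` X"
  proof (intro equalityI subsetI)
    fix g assume "g \<in> U"
    then obtain t y where t: "t \<in> P" "y \<in> tails_of N A (\<nu> t)"
      "g = kep_class N A B (\<mu> t) (m t) (\<nu> t) (prepend (\<nu> t) y)"
      unfolding U_def kep_basic_def cylinder_def by blast
    from t(1) obtain x0 where x0: "x0 \<in> X" "t = (stake n x0, s (sdrop n x0))" unfolding P_def by blast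
    have y: "y \<in> X" "s y = snd t" using t(2) c[OF t(1)] by (simp_all add: tails_of_def)
    let ?x = "fst t @- y"
    have "walk_to (snd t) (fst t)" using finite_path_walk_to[of "\<nu> t"] c[OF t(1)] by simp
    then have "?x \<in> X" using y by (simp add: walk_to_def)
    moreover have len: "length (fst t) = n" using x0 by simp
    then have "stake n ?x = fst t" "sdrop n ?x = y"
      by (simp_all add: stake_shift) (metis sdrop_length_shift)
    then have "(stake n ?x, s (sdrop n ?x)) = t" using y(2) by simp
    then have "\<alpha> ?x = g" unfolding t(3) using c[OF t(1)] by (simp add: \<alpha>_def prepend_def)
    ultimately show "g \<in> \<alpha> ` X" by blast
  next
    fix g assume "g \<in> \<alpha> ` X"
    then show "g \<in> U" using \<alpha>(3) by blast
  qed
  have "full_bisection \<G> U"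
    unfolding full_bisection_def units_eq
  proof (intro conjI)
    show "openin (gtop \<G>) U" by (rule op)
    show "inj_on (src \<G>) U" unfolding U by (rule inj_onI) (use \<alpha>(1) in auto)
    show "src \<G> ` U = unit_of ` X" unfolding U image_image using \<alpha>(1) by simp
    show "inj_on (rng \<G>) U"
    proof (rule inj_onI)
      fix g h assume "g \<in> U" "h \<in> U" and gh: "rng \<G> g = rng \<G> h"
      then obtain x z where x: "x \<in> X" "g = \<alpha> x" "z \<in> X" "h = \<alpha> z" unfolding U by blast
      from \<alpha>(2)[OF x(1)] \<alpha>(2)[OF x(3)] gh x obtain x' where "((0, x), (0, x')) \<in> f" "((0, z), (0, x')) \<in> f"
        by auto
      then have "x = z" using f unfolding mor_def single_valued_def by blast
      with x show "g = h" by simp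
    qed
    show "rng \<G> ` U = unit_of ` X"
    proof (intro equalityI subsetI)
      fix t assume "t \<in> rng \<G> ` U"
      then show "t \<in> unit_of ` X" unfolding U using \<alpha>(2) endo_in_X[OF f] by blast
    next
      fix t assume "t \<in> unit_of ` X"
      then obtain x' where x': "x' \<in> X" "t = unit_of x'" by blast
      obtain x where x: "x \<in> X" "((0, x'), (0, x)) \<in> f\<inverse>"
        using endo_image[OF mor_converse[OF f] x'(1)] by blast
      from \<alpha>(2)[OF x(1)] obtain x'' where "rng \<G> (\<alpha> x) = unit_of x''" "((0, x), (0, x'')) \<in> f" by blast
      moreover from this x(2) have "x'' = x'" using f unfolding mor_def single_valued_def by blast
      ultimately show "t \<in> rng \<G> ` U" using \<alpha>(3)[OF x(1)] x'(2) by (metis imageI)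
    qed
  qed
  moreover have "bisection_map \<G> U = unit_map f"
    using \<open>full_bisection \<G> U\<close> f
  proof (rule bisection_map_unit_map)
    fix g x assume "g \<in> U" "src \<G> g = unit_of x"
    then obtain z where z: "z \<in> X" "g = \<alpha> z" unfolding U by blast
    with \<alpha>(1) \<open>src \<G> g = unit_of x\<close> have "z = x" by simp
    with \<alpha>(2)[OF z(1)] z(2) show "\<exists>x'. rng \<G> g = unit_of x' \<and> ((0, x), (0, x')) \<in> f" by simp
  qed
  ultimately show thesis by (rule that)
qed

lemma carrier_topological_full_group:
  "carrier (topological_full_group \<G>) = unit_map ` {f. endo f}"
  unfolding topological_full_group_def
  using full_bisection_endo endo_full_bisection by (auto simp: image_iff) metis+

theorem finitely_generated_topological_full_group:
  "finitely_generated_group (topological_full_group \<G>)"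
proof -
  let ?B = "BijGroup (unit_of ` X)" and ?H = "unit_map ` {f. endo f}"
  let ?T = "topological_full_group \<G>"
  interpret B: group ?B by (rule group_BijGroup)
  have T: "?T = ?B\<lparr>carrier := ?H\<rparr>"
    using carrier_topological_full_group by (simp add: topological_full_group_def units_eq)
  have Bij: "unit_map f \<in> Bij (unit_of ` X)" if f: "endo f" for f
  proof -
    obtain U where "full_bisection \<G> U" "bisection_map \<G> U = unit_map f" using endo_full_bisection[OF f] .
    with bisection_map_Bij[of \<G> U] show ?thesis by (simp add: units_eq)
  qed
  have mult: "unit_map g \<otimes>\<^bsub>?B\<^esub> unit_map f = unit_map (f O g)" if "endo f" "endo g" for f g
    using Bij that unit_map_comp[OF that] by (simp add: BijGroup_def)
  have one: "unit_map (Id_on (cells base_cells)) = \<one>\<^bsub>?B\<^esub>" by (simp add: unit_map_Id BijGroup_def)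
  have inv: "inv\<^bsub>?B\<^esub> (unit_map f) = unit_map (f\<inverse>)" if f: "endo f" for f
    by (rule B.inv_equality)
      (use Bij f mor_converse[OF f] in \<open>simp_all add: mult mor_Id_comp(3)[OF f] one\<close>,
        simp_all add: BijGroup_def)
  have "subgroup ?H ?B"
  proof (rule B.subgroupI)
    show "?H \<subseteq> carrier ?B" using Bij by (auto simp: BijGroup_def)
    show "?H \<noteq> {}" using mor_Id[OF obj_base_cells] by blast
  next
    fix a assume "a \<in> ?H"
    then show "inv\<^bsub>?B\<^esub> a \<in> ?H" using inv mor_converse by auto
  next
    fix a b assume "a \<in> ?H" "b \<in> ?H"
    then show "a \<otimes>\<^bsub>?B\<^esub> b \<in> ?H" using mult mor_comp by (auto simp: image_iff) blast
  qed
  then have group: "group ?T" unfolding T by (rule B.subgroup_imp_group)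
  obtain S where S: "finite S" "S \<subseteq> {f. endo f}" "{f. endo f} \<subseteq> products base_cells S"
    by (rule mor_finitely_generated[OF obj_base_cells])
  have products: "endo f \<and> unit_map f \<in> generate ?T (unit_map ` S)" if "f \<in> products base_cells S" for f
    using that
  proof (induction rule: products.induct)
    case products_Id
    have "\<one>\<^bsub>?T\<^esub> \<in> generate ?T (unit_map ` S)" by (rule generate.one)
    then show ?case using mor_Id[OF obj_base_cells] by (simp add: T one)
  next
    case (products_step f g)
    have g: "endo g" using S(2) products_step(2) by blast
    have "unit_map g \<in> generate ?T (unit_map ` S)"
      by (rule generate.incl) (use products_step(2) in simp)
    \<comment> \<open>By the reversal of order, appending \<open>g\<close> to a product multiplies
      the group element by \<open>unit_map g\<close> from the left.\<close>
    then have "unit_map g \<otimes>\<^bsub>?T\<^esub> unit_map f \<in> generate ?T (unit_map ` S)"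
      using conjunct2[OF products_step.IH] by (rule generate.eng)
    then show ?case using mult[of f g] g products_step.IH mor_comp[of base_cells f base_cells g base_cells] by (simp add: T)
  qed
  have "unit_map ` S \<subseteq> carrier ?T" using S(2) by (auto simp: T)
  moreover from this have "generate ?T (unit_map ` S) \<subseteq> carrier ?T"
    by (rule group.generate_incl[OF group])
  moreover have "carrier ?T \<subseteq> generate ?T (unit_map ` S)" using products S(3) by (auto simp: T)
  ultimately show ?thesis
    unfolding finitely_generated_group_def using group S(1) by blast
qed

end

theorem theorem6p6:
  fixes N :: nat and A B :: "nat \<Rightarrow> nat \<Rightarrow> int"
  assumes "N \<ge> 1"
    and "\<And>i j. i \<in> {1..N} \<Longrightarrow> j \<in> {1..N} \<Longrightarrow> A i j \<ge> 0"
    and "\<And>i. i \<in> {1..N} \<Longrightarrow> \<exists>j \<in> {1..N}. A i j \<noteq> 0"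
    and "\<And>i j. i \<in> {1..N} \<Longrightarrow> j \<in> {1..N} \<Longrightarrow> A i j = 0 \<Longrightarrow> B i j = 0"
    and "hausdorff_groupoid (kep_groupoid N A B)"
    and "effective_groupoid (kep_groupoid N A B)"
    and "minimal_groupoid (kep_groupoid N A B)"
    and "strongly_connected (matrix_graph N A)"
    and "\<And>i j. i \<in> {1..N} \<Longrightarrow> j \<in> {1..N} \<Longrightarrow> A i j \<noteq> 0 \<Longrightarrow> \<bar>B i j\<bar> < A i j"
  shows "finitely_generated_group (topological_full_group (kep_groupoid N A B))"
proof -
  interpret kep N A B using assms(2,3,8) by unfold_locales
  show ?thesis by (rule finitely_generated_topological_full_group)
qed

end
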